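(* Let $H\in\mathcal{H}_2$, and let $\hat H\in\mathcal{M}$, with a pole-residue form $\hat H(s)=\sum_{i=1}^r\frac{c_ib_i^*}{s-\lambda_i}$, have pairwise distinct poles. Then the geometric necessary $\mathcal{H}_2$-optimality condition $$H-\hat H\perp\mathrm{T}_{\hat H}\mathcal{M}$$ is equivalent to the interpolatory necessary conditions $$H(-\overline{\lambda_i})b_i=\hat H(-\overline{\lambda_i})b_i,\quad c_i^*H(-\overline{\lambda_i})=c_i^*\hat H(-\overline{\lambda_i}),\quad c_i^*H'(-\overline{\lambda_i})b_i=c_i^*\hat H'(-\overline{\lambda_i})b_i$$ for $i=1,2,\ldots,r$.
   Context: $\mathcal{H}_2=\mathcal{H}_2^{p\times m}(\mathbb{C}^+)$ is the Hardy space of analytic functions $F:\mathbb{C}^+\to\mathbb{C}^{p\times m}$ on the open right half-plane with $\sup_{\xi>0}\int_{-\infty}^{\infty}\|F(\xi+\mathrm{i}\omega)\|_{\mathrm{F}}^2\,d\omega<\infty$ and inner product $\langle F,G\rangle_{\mathcal{H}_2}=\frac{1}{2\pi}\int_{-\infty}^{\infty}\operatorname{tr}(F(\mathrm{i}\omega)^*G(\mathrm{i}\omega))\,d\omega$; $\perp$ is orthogonality in this inner product. $\mathcal{M}$ is the set of $\hat C(sI-\hat A)^{-1}\hat B$ with $\hat A\in\mathbb{C}^{r\times r}$ Hurwitz (all eigenvalues in the open left half-plane), $\hat B\in\mathbb{C}^{r\times m}$, $\hat C\in\mathbb{C}^{p\times r}$, and $(\hat A,\hat B,\hat C)$ minimal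 (least possible order). $\mathcal{M}$ is an embedded submanifold of $\mathcal{H}_2$ of complex dimension $r(m+p)$; its tangent space $\mathrm{T}_{\hat H}\mathcal{M}$ is viewed as a subspace of $\mathcal{H}_2$, namely the set of velocities $\gamma'(0)$ of smooth curves $\gamma$ in $\mathcal{M}$ with $\gamma(0)=\hat H$. In the pole-residue form, $b_i\in\mathbb{C}^m$, $c_i\in\mathbb{C}^p$, $\lambda_i\in\mathbb{C}$. *)

theory Defs
  imports
    "HOL-Analysis.Analysis"
    "Jordan_Normal_Form.Gauss_Jordan_Elimination"
    "Jordan_Normal_Form.Char_Poly"
begin

no_notation Matrix.vec_index (infixl "$" 100)

text \<open>
  Matrix-valued functions have type \<open>complex \<Rightarrow> complex^'m^'p\<close>, where \<open>'p\<close> and \<open>'m\<close> index rows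
  and columns.  The type class norm on \<open>complex^'m^'p\<close> is the Frobenius norm.  Functions are
  total in HOL, but only their values on the open right half-plane are ever used: two functions
  that agree there represent the same element of the Hardy space.
\<close>

definition right_half_plane :: "complex set" where
  "right_half_plane = {s. Re s > 0}"

definition adjoint_matrix :: "complex^'n^'k \<Rightarrow> complex^'k^'n" where
  "adjoint_matrix A = map_matrix cnj (transpose A)"

definition cnj_vec :: "complex^'n \<Rightarrow> complex^'n" where
  "cnj_vec v = (\<chi> i. cnj (v $ i))"

definition cinner_vec :: "complex^'n \<Rightarrow> complex^'n \<Rightarrow> complex" where
  "cinner_vec v w = (\<Sum>i\<in>UNIV. cnj (v $ i) * w $ i)"

definition matrix_deriv :: "(complex \<Rightarrow> complex^'m^'p) \<Rightarrow> complex \<Rightarrow> complex^'m^'p" where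
  "matrix_deriv F s = (\<chi> i j. deriv (\<lambda>z. F z $ i $ j) s)"


section \<open>The Hardy space of the right half-plane\<close>

definition hardy2 :: "(complex \<Rightarrow> complex^'m^'p) set" where
  "hardy2 = {F. (\<forall>i j. (\<lambda>s. F s $ i $ j) holomorphic_on right_half_plane) \<and>
                (SUP \<xi>\<in>{0<..}. \<integral>\<^sup>+ \<omega>. ennreal ((norm (F (Complex \<xi> \<omega>)))\<^sup>2) \<partial>lborel) < \<infinity>}"

text \<open>
  Elements of the Hardy space live on the open half-plane only; the values \<open>F(\<i> \<omega>)\<close> in the inner
  product are the boundary values, i.e. the limit in \<open>L\<^sup>2(\<real>)\<close> of \<open>\<omega> \<mapsto> F(\<xi> + \<i> \<omega>)\<close> as
  \<open>\<xi>\<close> decreases to \<open>0\<close>.  This limit exists for every \<open>F\<close> in the Hardy space, is unique up to a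
  null set, and coincides almost everywhere with the nontangential limit.
\<close>

definition is_boundary_function ::
    "(complex \<Rightarrow> complex^'m^'p) \<Rightarrow> (real \<Rightarrow> complex^'m^'p) \<Rightarrow> bool" where
  "is_boundary_function F f \<longleftrightarrow> f \<in> borel_measurable lborel \<and>
     ((\<lambda>\<xi>. \<integral>\<^sup>+ \<omega>. ennreal ((norm (F (Complex \<xi> \<omega>) - f \<omega>))\<^sup>2) \<partial>lborel) \<longlongrightarrow> 0) (at_right 0)"

definition boundary_function :: "(complex \<Rightarrow> complex^'m^'p) \<Rightarrow> real \<Rightarrow> complex^'m^'p" where
  "boundary_function F = (SOME f. is_boundary_function F f)"

definition h2_inner ::
    "(complex \<Rightarrow> complex^'m^'p) \<Rightarrow> (complex \<Rightarrow> complex^'m^'p) \<Rightarrow> complex" where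
  "h2_inner F G = complex_of_real (1 / (2 * pi)) *
     (LINT \<omega>|lborel. trace (adjoint_matrix (boundary_function F \<omega>) ** boundary_function G \<omega>))"

definition h2_norm :: "(complex \<Rightarrow> complex^'m^'p) \<Rightarrow> real" where
  "h2_norm F = sqrt (Re (h2_inner F F))"

definition h2_orthogonal ::
    "(complex \<Rightarrow> complex^'m^'p) \<Rightarrow> (complex \<Rightarrow> complex^'m^'p) set \<Rightarrow> bool" where
  "h2_orthogonal F S \<longleftrightarrow> (\<forall>G\<in>S. h2_inner F G = 0)"


section \<open>Stable systems of minimal order\<close>

text \<open>
  A realization of order \<open>n\<close> is given by \<open>A \<in> carrier_mat n n\<close>, the rows \<open>B 0, \<dots>, B (n-1)\<close> of the
  \<open>n \<times> m\<close> input matrix, and the columns \<open>C 0, \<dots>, C (n-1)\<close> of the \<open>p \<times> n\<close> output matrix, so that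
  the order is an ordinary natural number; \<open>B l\<close> and \<open>C l\<close> are irrelevant for \<open>l \<ge> n\<close>.
  The transfer function \<open>C (s I - A)\<^sup>-\<^sup>1 B\<close> is meaningful where \<open>s\<close> is not an eigenvalue of \<open>A\<close>
  (otherwise \<open>mat_inverse\<close> returns \<open>None\<close>).
\<close>

definition resolvent :: "complex mat \<Rightarrow> complex \<Rightarrow> complex mat" where
  "resolvent A s = the (mat_inverse (s \<cdot>\<^sub>m 1\<^sub>m (dim_row A) - A))"

definition transfer_function ::
    "complex mat \<Rightarrow> (nat \<Rightarrow> complex^'m) \<Rightarrow> (nat \<Rightarrow> complex^'p) \<Rightarrow> complex \<Rightarrow> complex^'m^'p" where
  "transfer_function A B C s =
     (\<chi> i j. \<Sum>k<dim_row A. \<Sum>l<dim_row A. C k $ i * resolvent A s $$ (k, l) * B l $ j)"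

definition hurwitz :: "complex mat \<Rightarrow> bool" where
  "hurwitz A \<longleftrightarrow> (\<forall>\<mu>. eigenvalue A \<mu> \<longrightarrow> Re \<mu> < 0)"

text \<open>
  Minimality: no realization of smaller order, stable or not, has the same transfer function as a
  rational function, i.e. away from the eigenvalues of both state matrices.
\<close>

definition minimal_realization ::
    "nat \<Rightarrow> complex mat \<Rightarrow> (nat \<Rightarrow> complex^'m) \<Rightarrow> (nat \<Rightarrow> complex^'p) \<Rightarrow> bool" where
  "minimal_realization n A B C \<longleftrightarrow> A \<in> carrier_mat n n \<and>
     \<not> (\<exists>k<n. \<exists>A'\<in>carrier_mat k k. \<exists>B' C'.
          \<forall>s. \<not> eigenvalue A s \<and> \<not> eigenvalue A' s \<longrightarrow>
              transfer_function A' B' C' s = transfer_function A B C s)"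

definition stable_systems :: "nat \<Rightarrow> (complex \<Rightarrow> complex^'m^'p) set" where
  "stable_systems r = {F. \<exists>A B C. A \<in> carrier_mat r r \<and> hurwitz A \<and> minimal_realization r A B C \<and>
                          (\<forall>s\<in>right_half_plane. F s = transfer_function A B C s)}"

definition pole_residue ::
    "nat \<Rightarrow> (nat \<Rightarrow> complex^'p) \<Rightarrow> (nat \<Rightarrow> complex^'m) \<Rightarrow> (nat \<Rightarrow> complex) \<Rightarrow> complex \<Rightarrow> complex^'m^'p"
  where
  "pole_residue r c b lam s = (\<chi> k l. \<Sum>i=1..r. c i $ k * cnj (b i $ l) / (s - lam i))"


section \<open>Tangent spaces\<close>

definition h2_curve_derivative ::
    "(real \<Rightarrow> complex \<Rightarrow> complex^'m^'p) \<Rightarrow> (complex \<Rightarrow> complex^'m^'p) \<Rightarrow> real \<Rightarrow> bool" where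
  "h2_curve_derivative \<gamma> V t \<longleftrightarrow>
     ((\<lambda>h. h2_norm (\<lambda>s. (1 / h) *\<^sub>R (\<gamma> (t + h) s - \<gamma> t s) - V s)) \<longlongrightarrow> 0) (at 0)"

text \<open>
  \<open>D\<close> lists the derivatives of all orders of a smooth curve \<open>D 0\<close> in the Hardy space, defined on
  an open set \<open>I\<close> of parameters.
\<close>

definition h2_smooth_derivatives ::
    "real set \<Rightarrow> (nat \<Rightarrow> real \<Rightarrow> complex \<Rightarrow> complex^'m^'p) \<Rightarrow> bool" where
  "h2_smooth_derivatives I D \<longleftrightarrow>
     (\<forall>k. \<forall>t\<in>I. D k t \<in> hardy2 \<and> h2_curve_derivative (D k) (D (Suc k) t) t)"

text \<open>
  Velocities at \<open>0\<close> of smooth curves through \<open>F\<close>.  The set \<open>stable_systems r\<close> being an embedded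
  submanifold, smoothness of a curve in it is smoothness as a curve in the Hardy space.
\<close>

definition tangent_space :: "nat \<Rightarrow> (complex \<Rightarrow> complex^'m^'p) \<Rightarrow> (complex \<Rightarrow> complex^'m^'p) set"
  where
  "tangent_space r F = {V. \<exists>\<epsilon>>0. \<exists>D. h2_smooth_derivatives {-\<epsilon><..<\<epsilon>} D \<and>
     (\<forall>t\<in>{-\<epsilon><..<\<epsilon>}. D 0 t \<in> stable_systems r) \<and> D 0 0 = F \<and> D (Suc 0) 0 = V}"

end

theory Submission imports Defs "HOL-Complex_Analysis.Complex_Analysis" begin

text \<open>
  Boundary values in the Hardy space exist because \<open>\<langle>f(a + \<i>\<cdot>), f(b + \<i>\<cdot>)\<rangle>\<close> depends only on \<open>a + b\<close>
  (Cauchy's theorem applied to \<open>cnj (f (a + b - cnj z)) * f z\<close>).  Hence the squared norm on the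
  vertical line at \<open>\<xi>\<close> is a bounded midpoint-convex function of \<open>\<xi>\<close>, so it is antimonotone and
  has a limit at \<open>0\<close>, and the parallelogram identity turns this into a Cauchy condition.
  Cauchy's formula then turns the inner products with \<open>K / (s - \<lambda>)\<close> and \<open>K / (s - \<lambda>)\<^sup>2\<close> into evaluations
  of \<open>F\<close> and \<open>F'\<close> at \<open>- cnj \<lambda>\<close>.

  Moving one of \<open>c\<^sub>i\<close>, \<open>b\<^sub>i\<close>, \<open>\<lambda>\<^sub>i\<close> along a segment gives the tangent vectors
  \<open>x b\<^sub>i\<^sup>* / (s - \<lambda>\<^sub>i)\<close>, \<open>c\<^sub>i y\<^sup>* / (s - \<lambda>\<^sub>i)\<close> and \<open>c\<^sub>i b\<^sub>i\<^sup>* / (s - \<lambda>\<^sub>i)\<^sup>2\<close>, which yields the interpolation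
  conditions.  Conversely, the Loewner kernel \<open>(G s - G w) / (s - w)\<close> of a system of order \<open>r\<close> has
  rank at most \<open>r\<close>.  Differentiating this rank condition along a curve, the kernel of a velocity \<open>V\<close>
  vanishes on the left and right null vectors of the kernel of \<open>Hhat\<close>.  This forces
  \<open>V = (\<Sum>i. R\<^sub>i / (s - \<lambda>\<^sub>i) + S\<^sub>i / (s - \<lambda>\<^sub>i)\<^sup>2)\<close> with \<open>R\<^sub>i = c\<^sub>i y\<^sup>* + x b\<^sub>i\<^sup>*\<close> and \<open>S\<^sub>i\<close> a multiple of
  \<open>c\<^sub>i b\<^sub>i\<^sup>*\<close>, and such \<open>V\<close> are orthogonal to \<open>H - Hhat\<close> by the interpolation conditions.
\<close>

no_notation Formal_Power_Series.fps_nth (infixl "$" 75)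

section \<open>Integrals along vertical lines\<close>

text \<open>No pointwise decay on horizontal segments is at hand, so Cauchy's theorem on tall
  rectangles is closed by averaging: the horizontal sides are small in the mean over their height.
  The tangent space is given by curves, and along a curve only norm convergence of difference
  quotients is known. Tracking poles and residues of nearby systems would need perturbation theory
  for realizations. The rank bound on the Loewner kernel instead concerns finitely many point
  values, and point evaluations are bounded on the Hardy space, so first-order information survives
  along one sequence of parameters. The kernel identity for \<open>V\<close> is made explicit by
  finite weights on points of the half-plane: residues of \<open>p(x) / \<Prod>(x - w)\<close> at
  nodes \<open>w\<close>, with \<open>p\<close> chosen so that the weights form a dual basis to the
  functions \<open>1 / (s - \<lambda>_j)\<close> and \<open>1 / (s - \<lambda>_j)^2\<close>.
  Minimality makes every \<open>c_i\<close> and \<open>b_i\<close> nonzero, and it is what the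
  perturbed systems must preserve. Curve parameters are real, but the vanishing inner products are
  complex numbers, so a real shift of each pole is enough.\<close>

lemma linepath_has_integral_bound:
  fixes h :: "complex \<Rightarrow> complex"
  assumes I: "(h has_contour_integral I) (linepath a b)"
    and cont: "continuous_on (closed_segment a b) h"
  shows "ennreal (norm I) \<le>
    ennreal (norm (b - a)) * (\<integral>\<^sup>+x. indicator {0..1} x * ennreal (norm (h (linepath a b x))) \<partial>lborel)"
proof -
  define \<phi> where "\<phi> x = h (linepath a b x) * (b - a)" for x
  have "continuous_on {0..1} (\<lambda>x. h (linepath a b x))"
    by (rule continuous_on_compose2[OF cont]) (auto simp: linepath_image_01[symmetric] path_image_def intro!: continuous_intros)
  then have "continuous_on {0..1} \<phi>"
    unfolding \<phi>_def by (intro continuous_intros)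
  then have si: "set_integrable lborel {0..1} \<phi>"
    by (rule borel_integrable_atLeastAtMost')
  have "(\<phi> has_integral I) {0..1}"
    using I unfolding \<phi>_def by (simp only: has_contour_integral_linepath)
  then have "I = (LINT x:{0..1}|lborel. \<phi> x)"
    using set_borel_integral_eq_integral(2)[OF si] by (simp add: integral_unique)
  then have "ennreal (norm I) \<le> (\<integral>\<^sup>+x. ennreal (norm (indicator {0..1} x *\<^sub>R \<phi> x)) \<partial>lborel)"
    using integral_norm_bound_ennreal[OF si[unfolded set_integrable_def]]
    by (simp add: set_lebesgue_integral_def)
  also have "\<dots> = (\<integral>\<^sup>+x. ennreal (norm (b - a)) * (indicator {0..1} x * ennreal (norm (h (linepath a b x)))) \<partial>lborel)"
    by (intro nn_integral_cong) (auto simp: \<phi>_def norm_mult indicator_def ennreal_mult[symmetric] mult.commute)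
  also have "\<dots> = ennreal (norm (b - a)) * (\<integral>\<^sup>+x. indicator {0..1} x * ennreal (norm (h (linepath a b x))) \<partial>lborel)"
  proof (rule nn_integral_cmult)
    have "(\<lambda>x. indicator {0..1} x *\<^sub>R h (linepath a b x)) \<in> borel_measurable borel"
      by (intro borel_measurable_continuous_on_indicator) (auto intro: \<open>continuous_on {0..1} (\<lambda>x. h (linepath a b x))\<close>)
    then have "(\<lambda>x. indicator {0..1} x *\<^sub>R h (linepath a b x)) \<in> borel_measurable lborel"
      by (simp only: measurable_lborel1 measurable_lborel2)
    then have "(\<lambda>x. ennreal (norm (indicator {0..1} x *\<^sub>R h (linepath a b x)))) \<in> borel_measurable lborel"
      by (rule measurable_compose) measurable
    also have "(\<lambda>x. ennreal (norm (indicator {0..1} x *\<^sub>R h (linepath a b x)))) =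
       (\<lambda>x. indicator {0..1} x * ennreal (norm (h (linepath a b x))))"
      by (auto simp: indicator_def)
    finally show "(\<lambda>x. indicator {0..1} x * ennreal (norm (h (linepath a b x)))) \<in> borel_measurable lborel" .
  qed
  finally show ?thesis .
qed

lemma symmetric_integral_tendsto:
  fixes f :: "real \<Rightarrow> complex"
  assumes "integrable lborel f"
  shows "((\<lambda>R. LINT x:{-R..R}|lborel. f x) \<longlongrightarrow> (LINT x|lborel. f x)) at_top"
  unfolding set_lebesgue_integral_def
proof (rule integral_dominated_convergence_at_top[where w = "\<lambda>x. norm (f x)"])
  show "AE x in lborel. ((\<lambda>R. indicator {-R..R} x *\<^sub>R f x) \<longlongrightarrow> f x) at_top"
  proof (rule AE_I2)
    fix x :: real
    have "\<forall>\<^sub>F R in at_top. indicator {-R..R} x *\<^sub>R f x = f x"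
      using eventually_ge_at_top[of "\<bar>x\<bar>"] by eventually_elim (auto simp: indicator_def)
    then show "((\<lambda>R. indicator {-R..R} x *\<^sub>R f x) \<longlongrightarrow> f x) at_top"
      by (rule tendsto_eventually)
  qed
qed (use assms in \<open>auto simp: indicator_def\<close>)

text \<open>The two vertical sides converge to the full line integrals, so only the horizontal sides
  are at stake. By Fubini and the mass bound \<open>M\<close>, their sizes are integrable in the
  height; if the limit differed from \<open>J\<close>, they would stay above a positive constant for
  all large heights, and that has infinite integral. The threshold \<open>K\<close> leaves room for
  a singularity between the lines.\<close>

lemma vertical_line_jump:
  fixes h :: "complex \<Rightarrow> complex"
  assumes tau: "\<tau>1 < \<tau>2"
    and rect: "\<And>R. R > K \<Longrightarrow> (h has_contour_integral J) (rectpath (Complex \<tau>1 (-R)) (Complex \<tau>2 R))"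
    and K: "K \<ge> 0"
    and cont: "continuous_on {z. \<tau>1 \<le> Re z \<and> Re z \<le> \<tau>2 \<and> (Re z = \<tau>1 \<or> Re z = \<tau>2 \<or> \<bar>Im z\<bar> > K)} h"
    and int1: "integrable lborel (\<lambda>\<omega>. h (Complex \<tau>1 \<omega>))"
    and int2: "integrable lborel (\<lambda>\<omega>. h (Complex \<tau>2 \<omega>))"
    and meas: "(\<lambda>(x, \<omega>). indicator {\<tau>1..\<tau>2} x * h (Complex x \<omega>)) \<in> borel_measurable (lborel \<Otimes>\<^sub>M lborel)"
    and M: "\<And>x. x \<in> {\<tau>1..\<tau>2} \<Longrightarrow> (\<integral>\<^sup>+\<omega>. indicator {\<omega>. \<bar>\<omega>\<bar> > K} \<omega> * ennreal (norm (h (Complex x \<omega>))) \<partial>lborel) \<le> ennreal M"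
  shows "\<i> * ((LINT \<omega>|lborel. h (Complex \<tau>2 \<omega>)) - (LINT \<omega>|lborel. h (Complex \<tau>1 \<omega>))) = J"
proof (rule ccontr)
  define I where "I \<tau> R = (LINT \<omega>:{-R..R}|lborel. h (Complex \<tau> \<omega>))" for \<tau> R
  define u where "u x = linepath \<tau>1 \<tau>2 x" for x
  have u: "u x \<in> {\<tau>1..\<tau>2}" if "x \<in> {0..1}" for x
    using that tau linepath_in_path[of x \<tau>1 \<tau>2] by (auto simp: u_def closed_segment_eq_real_ivl)
  have lp: "linepath (Complex \<tau>1 R) (Complex \<tau>2 R) x = Complex (u x) R" for x R
    by (simp add: linepath_def u_def complex_eq_iff algebra_simps)
  define k where "k R = (\<integral>\<^sup>+x. indicator {0..1} x * ennreal (norm (h (Complex (u x) R))) \<partial>lborel)" for R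
  define D where "D = \<tau>2 - \<tau>1"
  have D0: "D > 0" using tau by (simp add: D_def)
  have Dn: "norm (Complex \<tau>2 R - Complex \<tau>1 R) = D" for R
    using tau by (simp add: D_def cmod_def)
  have bd: "ennreal (norm (J - \<i> * (I \<tau>2 R - I \<tau>1 R))) \<le> ennreal D * (k R + k (-R))" if R: "R > K" for R
  proof -
    have Rp: "-R < R" using R K by auto
    let ?a1 = "Complex \<tau>1 (-R)" and ?a2 = "Complex \<tau>2 (-R)" and ?a3 = "Complex \<tau>2 R" and ?a4 = "Complex \<tau>1 R"
    have seg: "closed_segment ?a1 ?a2 \<subseteq> {z. \<tau>1 \<le> Re z \<and> Re z \<le> \<tau>2 \<and> \<bar>Im z\<bar> > K}"
      "closed_segment ?a4 ?a3 \<subseteq> {z. \<tau>1 \<le> Re z \<and> Re z \<le> \<tau>2 \<and> \<bar>Im z\<bar> > K}"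
      using tau R K by (auto simp: closed_segment_same_Im closed_segment_eq_real_ivl)
    have cs: "continuous_on (closed_segment ?a1 ?a2) h" "continuous_on (closed_segment ?a4 ?a3) h"
      "continuous_on (closed_segment ?a2 ?a3) h" "continuous_on (closed_segment ?a1 ?a4) h"
      using seg tau by (auto intro!: continuous_on_subset[OF cont] simp: closed_segment_same_Re)
    obtain i1 i3 where i1: "(h has_contour_integral i1) (linepath ?a1 ?a2)"
       and i3: "(h has_contour_integral i3) (linepath ?a4 ?a3)"
      using contour_integrable_continuous_linepath cs(1,2) by (meson contour_integrable_on_def)
    have vert: "(h has_contour_integral \<i> * I \<tau> R) (linepath (Complex \<tau> (-R)) (Complex \<tau> R))"
      if "\<tau> = \<tau>1 \<or> \<tau> = \<tau>2" for \<tau>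
    proof -
      have "set_integrable lborel {-R..R} (\<lambda>\<omega>. h (Complex \<tau> \<omega>))"
        using int1 int2 that by (auto simp: set_integrable_def intro!: integrable_mult_indicator)
      then have "((\<lambda>\<omega>. h (Complex \<tau> \<omega>)) has_integral I \<tau> R) {-R..R}"
        using set_borel_integral_eq_integral[of "{-R..R}" "\<lambda>\<omega>. h (Complex \<tau> \<omega>)"]
        by (simp add: I_def has_integral_integrable_integral)
      then show ?thesis
        using has_contour_integral_linepath_same_Re_iff[of "Complex \<tau> (-R)" \<tau> "Complex \<tau> R" "-R" R h "\<i> * I \<tau> R"] Rp
        by simp
    qed
    have "(h has_contour_integral (i1 + (\<i> * I \<tau>2 R + ((- i3) + (- (\<i> * I \<tau>1 R)))))) (rectpath ?a1 ?a3)"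
      unfolding rectpath_def Let_def
      by (intro has_contour_integral_join valid_path_join valid_path_linepath)
        (use i1 i3 vert[of \<tau>1] vert[of \<tau>2] in \<open>auto dest: has_contour_integral_reverse_linepath\<close>)
    with rect[OF R] have "J = i1 + (\<i> * I \<tau>2 R + ((- i3) + (- (\<i> * I \<tau>1 R))))"
      by (rule contour_integral_unique[symmetric, THEN trans, OF _ contour_integral_unique])
    then have "J - \<i> * (I \<tau>2 R - I \<tau>1 R) = i1 - i3" by (simp add: algebra_simps)
    then have "ennreal (norm (J - \<i> * (I \<tau>2 R - I \<tau>1 R))) \<le> ennreal (norm i1) + ennreal (norm i3)"
      by (metis ennreal_leI ennreal_plus norm_ge_zero norm_triangle_ineq4)
    also have "ennreal (norm i1) \<le> ennreal D * k (-R)"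
      using linepath_has_integral_bound[OF i1 cs(1)] by (simp add: lp k_def Dn)
    also have "ennreal (norm i3) \<le> ennreal D * k R"
      using linepath_has_integral_bound[OF i3 cs(2)] by (simp add: lp k_def Dn)
    finally show ?thesis by (simp add: algebra_simps add_mono)
  qed
  assume neq: "\<not> ?thesis"
  define L where "L = J - \<i> * ((LINT \<omega>|lborel. h (Complex \<tau>2 \<omega>)) - (LINT \<omega>|lborel. h (Complex \<tau>1 \<omega>)))"
  have "((\<lambda>R. norm (J - \<i> * (I \<tau>2 R - I \<tau>1 R))) \<longlongrightarrow> norm L) at_top"
    unfolding I_def L_def by (intro tendsto_intros symmetric_integral_tendsto int1 int2)
  moreover have Lp: "norm L > norm L / 2" "norm L > 0" using neq by (auto simp: L_def)
  ultimately have "\<forall>\<^sub>F R in at_top. norm (J - \<i> * (I \<tau>2 R - I \<tau>1 R)) > norm L / 2"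
    by (intro order_tendstoD(1))
  then obtain R1 where R1: "\<And>R. R \<ge> R1 \<Longrightarrow> norm (J - \<i> * (I \<tau>2 R - I \<tau>1 R)) > norm L / 2"
    by (auto simp: eventually_at_top_linorder)
  define R2 where "R2 = max R1 (K + 1)"
  define c where "c = norm L / 2 / D"
  have cpos: "c > 0" using Lp D0 by (simp add: c_def)
  \<comment> \<open>\<open>norm L\<close> is the assumed defect. Beyond \<open>R2\<close> half of it
    must be carried by the two horizontal sides, whose common length is \<open>D\<close>.\<close>
  have low: "ennreal c \<le> k R + k (-R)" if "R \<ge> R2" for R
  proof -
    have "ennreal (D * c) \<le> ennreal (norm (J - \<i> * (I \<tau>2 R - I \<tau>1 R)))"
      using R1[of R] that D0 by (auto simp: R2_def c_def intro!: ennreal_leI)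
    also have "\<dots> \<le> ennreal D * (k R + k (-R))"
      using bd[of R] that by (auto simp: R2_def)
    finally have "ennreal D * ennreal c \<le> ennreal D * (k R + k (-R))"
      using D0 cpos by (simp add: ennreal_mult)
    then show ?thesis
      using D0 by (subst (asm) ennreal_mult_le_mult_iff) auto
  qed
  define S where "S = {\<omega>. \<bar>\<omega>\<bar> > K}"
  have [measurable]: "S \<in> sets borel" unfolding S_def by measurable
  \<comment> \<open>Cut off to the parameters of the segment and to the heights above
    \<open>K\<close>, so that Fubini applies on the whole plane.\<close>
  define g where "g x \<omega> = indicator {0..1} x * (indicator S \<omega> * ennreal (norm (h (Complex (u x) \<omega>))))" for x \<omega>
  have gm: "(\<lambda>(x, \<omega>). g x \<omega>) \<in> borel_measurable (lborel \<Otimes>\<^sub>M lborel)"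
  proof -
    have [measurable]: "u \<in> borel_measurable borel"
      unfolding u_def linepath_def by measurable
    have "(\<lambda>p. case (case p of (x, \<omega>) \<Rightarrow> (u x, \<omega>)) of (x, \<omega>) \<Rightarrow> indicator {\<tau>1..\<tau>2} x * h (Complex x \<omega>)) \<in> borel_measurable (lborel \<Otimes>\<^sub>M lborel)"
      by (rule measurable_compose[OF _ meas]) measurable
    then have [measurable]: "(\<lambda>(x,\<omega>). indicator {\<tau>1..\<tau>2} (u x) * h (Complex (u x) \<omega>)) \<in> borel_measurable (lborel \<Otimes>\<^sub>M lborel)"
      by (simp add: case_prod_beta)
    have "(\<lambda>(x, \<omega>). g x \<omega>) = (\<lambda>(x, \<omega>). indicator {0..1} x * (indicator S \<omega> * ennreal (norm (indicator {\<tau>1..\<tau>2} (u x) * h (Complex (u x) \<omega>)))))"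
      using u by (auto simp: g_def fun_eq_iff indicator_def)
    also have "\<dots> \<in> borel_measurable (lborel \<Otimes>\<^sub>M lborel)" by measurable
    finally show ?thesis .
  qed
  have kint: "(\<integral>\<^sup>+\<omega>. indicator S \<omega> * k \<omega> \<partial>lborel) \<le> ennreal M"
  proof -
    have gx[measurable]: "(\<lambda>x. g x \<omega>) \<in> borel_measurable lborel" for \<omega>
      using gm by simp
    have "indicator S \<omega> * k \<omega> = (\<integral>\<^sup>+x. g x \<omega> \<partial>lborel)" for \<omega>
      by (cases "\<omega> \<in> S") (auto simp: k_def g_def)
    then have "(\<integral>\<^sup>+\<omega>. indicator S \<omega> * k \<omega> \<partial>lborel) = (\<integral>\<^sup>+\<omega>. \<integral>\<^sup>+x. g x \<omega> \<partial>lborel \<partial>lborel)"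
      by simp
    also have "\<dots> = (\<integral>\<^sup>+x. \<integral>\<^sup>+\<omega>. g x \<omega> \<partial>lborel \<partial>lborel)"
      by (rule lborel_pair.Fubini'[OF gm])
    also have "\<dots> \<le> (\<integral>\<^sup>+x. ennreal M * indicator {0..1::real} x \<partial>lborel)"
    proof (rule nn_integral_mono)
      fix x :: real
      show "(\<integral>\<^sup>+\<omega>. g x \<omega> \<partial>lborel) \<le> ennreal M * indicator {0..1} x"
        using M[OF u[of x]] by (cases "x \<in> {0..1}") (auto simp: g_def S_def)
    qed
    also have "\<dots> = ennreal M" by (simp add: nn_integral_cmult_indicator)
    finally show ?thesis .
  qed
  have km: "(\<lambda>\<omega>. indicator S \<omega> * k \<omega>) \<in> borel_measurable lborel"
  proof -
    have "indicator S \<omega> * k \<omega> = (\<integral>\<^sup>+x. g x \<omega> \<partial>lborel)" for \<omega>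
      by (cases "\<omega> \<in> S") (auto simp: k_def g_def)
    moreover have "(\<lambda>\<omega>. \<integral>\<^sup>+x. g x \<omega> \<partial>lborel) \<in> borel_measurable lborel"
      using gm by measurable
    ultimately show ?thesis by simp
  qed
  have km': "(\<lambda>\<omega>. indicator S (-\<omega>) * k (-\<omega>)) \<in> borel_measurable lborel"
    by (rule measurable_compose[OF _ km]) auto
  \<comment> \<open>The lower sides are folded onto the upper ones by reflecting the height, so a
    single integral controls both.\<close>
  have "(\<integral>\<^sup>+\<omega>. indicator S (-\<omega>) * k (-\<omega>) \<partial>lborel) = (\<integral>\<^sup>+\<omega>. indicator S \<omega> * k \<omega> \<partial>lborel)"
    using nn_integral_real_affine[of "\<lambda>\<omega>. indicator S \<omega> * k \<omega>" "-1" 0] km by simp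
  then have "(\<integral>\<^sup>+\<omega>. indicator S \<omega> * k \<omega> + indicator S (-\<omega>) * k (-\<omega>) \<partial>lborel) \<le> ennreal M + ennreal M"
    using kint by (subst nn_integral_add[OF km km']) (auto intro: add_mono)
  moreover have "(\<integral>\<^sup>+\<omega>. ennreal c * indicator {R2..} \<omega> \<partial>lborel) \<le> (\<integral>\<^sup>+\<omega>. indicator S \<omega> * k \<omega> + indicator S (-\<omega>) * k (-\<omega>) \<partial>lborel)"
  proof (rule nn_integral_mono)
    fix \<omega> :: real
    show "ennreal c * indicator {R2..} \<omega> \<le> indicator S \<omega> * k \<omega> + indicator S (-\<omega>) * k (-\<omega>)"
      using low[of \<omega>] K by (cases "\<omega> \<ge> R2") (auto simp: S_def R2_def)
  qed
  moreover have "emeasure lborel {R2..} = \<infinity>"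
  proof -
    have "emeasure lborel {R2..R2 + real n} \<le> emeasure lborel {R2..}" for n by (rule emeasure_mono) auto
    then have le: "ennreal (real n) \<le> emeasure lborel {R2..}" for n by simp
    show ?thesis
    proof (cases "emeasure lborel {R2..}")
      case (real r)
      obtain n where "r < real n" using reals_Archimedean2 by blast
      with le[of n] real show ?thesis by (simp add: ennreal_le_iff)
    qed simp
  qed
  then have "(\<integral>\<^sup>+\<omega>. ennreal c * indicator {R2..} \<omega> \<partial>lborel) = \<infinity>"
    using cpos by (simp add: nn_integral_cmult_indicator ennreal_mult_top)
  ultimately show False by (simp add: top_unique)
qed

section \<open>Square-integrable functions on the real line\<close>

definition L2 :: "(real \<Rightarrow> complex) \<Rightarrow> bool" where
  "L2 f \<longleftrightarrow> f \<in> borel_measurable lborel \<and> integrable lborel (\<lambda>\<omega>. (cmod (f \<omega>))\<^sup>2)"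

text \<open>The squared norm without the factor \<open>1 / (2 * pi)\<close>, which enters only with
  \<open>h2_inner\<close> and \<open>h2_norm\<close>.\<close>

definition l2sq :: "(real \<Rightarrow> complex) \<Rightarrow> real" where
  "l2sq f = (LINT \<omega>|lborel. (cmod (f \<omega>))\<^sup>2)"

lemma L2_measurable [measurable_dest]: "L2 f \<Longrightarrow> f \<in> borel_measurable lborel"
  by (simp add: L2_def)

lemma L2_integrable: "L2 f \<Longrightarrow> integrable lborel (\<lambda>\<omega>. (cmod (f \<omega>))\<^sup>2)"
  by (simp add: L2_def)

lemma l2sq_nonneg [simp]: "l2sq f \<ge> 0"
  by (simp add: l2sq_def)

lemma L2_nn_integral: "L2 f \<Longrightarrow> (\<integral>\<^sup>+\<omega>. ennreal ((cmod (f \<omega>))\<^sup>2) \<partial>lborel) = ennreal (l2sq f)"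
  unfolding L2_def l2sq_def by (intro nn_integral_eq_integral) auto

lemma L2_iff_nn_integral:
  "L2 f \<longleftrightarrow> f \<in> borel_measurable lborel \<and> (\<integral>\<^sup>+\<omega>. ennreal ((cmod (f \<omega>))\<^sup>2) \<partial>lborel) < \<infinity>"
  unfolding L2_def by (auto simp: integrable_iff_bounded)

lemma L2_of_nn_integral_le:
  assumes "f \<in> borel_measurable lborel" "(\<integral>\<^sup>+\<omega>. ennreal ((cmod (f \<omega>))\<^sup>2) \<partial>lborel) \<le> ennreal M" "M \<ge> 0"
  shows "L2 f" "l2sq f \<le> M"
proof -
  show *: "L2 f" using assms by (auto simp: L2_iff_nn_integral intro: le_less_trans)
  show "l2sq f \<le> M" using L2_nn_integral[OF *] assms by simp
qed

lemma L2_dominated: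
  assumes "L2 g" "f \<in> borel_measurable lborel" "\<And>\<omega>. cmod (f \<omega>) \<le> cmod (g \<omega>)"
  shows "L2 f" "l2sq f \<le> l2sq g"
proof -
  have le: "(cmod (f \<omega>))\<^sup>2 \<le> (cmod (g \<omega>))\<^sup>2" for \<omega> using assms(3) by (intro power_mono) auto
  show *: "L2 f" unfolding L2_def
  proof
    show "integrable lborel (\<lambda>\<omega>. (cmod (f \<omega>))\<^sup>2)"
      by (rule Bochner_Integration.integrable_bound[OF L2_integrable[OF assms(1)]]) (use assms(2) le in auto)
  qed (rule assms)
  show "l2sq f \<le> l2sq g" unfolding l2sq_def
    using assms(1) * le by (intro integral_mono L2_integrable) auto
qed

lemma L2_cmult: "L2 f \<Longrightarrow> L2 (\<lambda>\<omega>. c * f \<omega>)"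
  unfolding L2_def by (auto simp: norm_mult power_mult_distrib)

lemma l2sq_cmult: "l2sq (\<lambda>\<omega>. c * f \<omega>) = (cmod c)\<^sup>2 * l2sq f"
  unfolding l2sq_def by (simp add: norm_mult power_mult_distrib)

lemma norm_sum_sq_le: "(norm (a + b))\<^sup>2 \<le> 2 * (norm a)\<^sup>2 + 2 * (norm b)\<^sup>2" for a b :: "'a::real_normed_vector"
proof -
  have "(norm (a + b))\<^sup>2 \<le> (norm a + norm b)\<^sup>2" by (intro power_mono norm_triangle_ineq) auto
  also have "\<dots> \<le> 2 * (norm a)\<^sup>2 + 2 * (norm b)\<^sup>2"
    using sum_squares_bound[of "norm a" "norm b"] by (simp add: power2_sum)
  finally show ?thesis .
qed

lemma L2_add: assumes "L2 f" "L2 g" shows "L2 (\<lambda>\<omega>. f \<omega> + g \<omega>)" "l2sq (\<lambda>\<omega>. f \<omega> + g \<omega>) \<le> 2 * l2sq f + 2 * l2sq g"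
proof -
  note [measurable] = L2_measurable[OF assms(1)] L2_measurable[OF assms(2)]
  have i: "integrable lborel (\<lambda>\<omega>. 2 * (cmod (f \<omega>))\<^sup>2 + 2 * (cmod (g \<omega>))\<^sup>2)"
    using assms by (simp add: L2_def)
  show *: "L2 (\<lambda>\<omega>. f \<omega> + g \<omega>)" unfolding L2_def
    by (intro conjI Bochner_Integration.integrable_bound[OF i]) (auto simp: norm_sum_sq_le)
  have "l2sq (\<lambda>\<omega>. f \<omega> + g \<omega>) \<le> (LINT \<omega>|lborel. 2 * (cmod (f \<omega>))\<^sup>2 + 2 * (cmod (g \<omega>))\<^sup>2)"
    unfolding l2sq_def using i * by (intro integral_mono) (auto simp: norm_sum_sq_le L2_def)
  also have "\<dots> = 2 * l2sq f + 2 * l2sq g"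
    unfolding l2sq_def using assms by (subst Bochner_Integration.integral_add) (auto simp: L2_def)
  finally show "l2sq (\<lambda>\<omega>. f \<omega> + g \<omega>) \<le> 2 * l2sq f + 2 * l2sq g" .
qed

lemma L2_diff: assumes "L2 f" "L2 g" shows "L2 (\<lambda>\<omega>. f \<omega> - g \<omega>)"
  using L2_add(1)[OF assms(1) L2_cmult[OF assms(2), of "-1"]] by simp

lemma cnj_borel_measurable [measurable]: "cnj \<in> borel_measurable borel"
  by (intro borel_measurable_continuous_onI continuous_intros)

lemma L2_cnj: "L2 f \<Longrightarrow> L2 (\<lambda>\<omega>. cnj (f \<omega>))" "l2sq (\<lambda>\<omega>. cnj (f \<omega>)) = l2sq f"
  by (auto simp: L2_def l2sq_def)

lemma norm_mult_le_sq: "norm (a * b) \<le> (norm a)\<^sup>2 + (norm b)\<^sup>2" for a b :: complex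
proof -
  have "2 * norm (a * b) \<le> (norm a)\<^sup>2 + (norm b)\<^sup>2"
    using sum_squares_bound[of "norm a" "norm b"] by (simp add: norm_mult)
  then show ?thesis using norm_ge_zero[of "a * b"] by linarith
qed

lemma L2_mult_integrable:
  assumes "L2 f" "L2 g" shows "integrable lborel (\<lambda>\<omega>. f \<omega> * g \<omega>)"
proof -
  note [measurable] = L2_measurable[OF assms(1)] L2_measurable[OF assms(2)]
  have i: "integrable lborel (\<lambda>\<omega>. (cmod (f \<omega>))\<^sup>2 + (cmod (g \<omega>))\<^sup>2)"
    using assms by (simp add: L2_def)
  show ?thesis
    using norm_mult_le_sq
    by (intro Bochner_Integration.integrable_bound[OF i]) (auto intro!: AE_I2 order.trans[OF _ abs_ge_self])
qed

text \<open>The integral of \<open>(t |f| - |g|)^2\<close> is a quadratic in \<open>t\<close> that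
  is never negative; its minimiser \<open>I / l2sq f\<close> gives the bound. No conjugate appears
  in the pairing because everything passes through \<open>|f g|\<close>.\<close>

lemma L2_Cauchy_Schwarz:
  assumes f: "L2 f" and g: "L2 g"
  shows "(norm (LINT \<omega>|lborel. f \<omega> * g \<omega>))\<^sup>2 \<le> l2sq f * l2sq g"
proof -
  define I where "I = (LINT \<omega>|lborel. norm (f \<omega> * g \<omega>))"
  have int: "integrable lborel (\<lambda>\<omega>. norm (f \<omega> * g \<omega>))"
    using L2_mult_integrable[OF f g] by simp
  have I0: "I \<ge> 0" by (simp add: I_def)
  have *: "0 \<le> t\<^sup>2 * l2sq f - 2 * t * I + l2sq g" for t
  proof -
    have "0 \<le> (LINT \<omega>|lborel. (t * cmod (f \<omega>) - cmod (g \<omega>))\<^sup>2)" by simp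
    also have "(\<lambda>\<omega>. (t * cmod (f \<omega>) - cmod (g \<omega>))\<^sup>2) =
      (\<lambda>\<omega>. (t\<^sup>2 * (cmod (f \<omega>))\<^sup>2 - 2 * t * norm (f \<omega> * g \<omega>)) + (cmod (g \<omega>))\<^sup>2)"
      by (auto simp: fun_eq_iff power2_diff power_mult_distrib norm_mult)
    also have "(LINT \<omega>|lborel. (t\<^sup>2 * (cmod (f \<omega>))\<^sup>2 - 2 * t * norm (f \<omega> * g \<omega>)) + (cmod (g \<omega>))\<^sup>2) = t\<^sup>2 * l2sq f - 2 * t * I + l2sq g"
      unfolding l2sq_def I_def using f g int
      by (subst Bochner_Integration.integral_add Bochner_Integration.integral_diff, (simp_all add: L2_def)[3])+
    finally show ?thesis .
  qed
  have "I\<^sup>2 \<le> l2sq f * l2sq g"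
  proof (cases "l2sq f = 0")
    case True
    have "I = 0"
    proof (rule ccontr)
      assume "I \<noteq> 0"
      \<comment> \<open>When \<open>l2sq f = 0\<close> the quadratic is affine in \<open>t\<close>,
        and this \<open>t\<close> makes it equal to -1.\<close>
      then show False using *[of "(l2sq g + 1) / (2 * I)"] True by simp
    qed
    then show ?thesis using True by simp
  next
    case False
    then have "l2sq f > 0" using l2sq_nonneg[of f] by linarith
    then show ?thesis using *[of "I / l2sq f"] by (simp add: field_simps power2_eq_square)
  qed
  moreover have "norm (LINT \<omega>|lborel. f \<omega> * g \<omega>) \<le> I"
    unfolding I_def by (rule integral_norm_bound)
  ultimately show ?thesis
    by (meson norm_ge_zero order.trans power_mono)
qed

lemma L2_integral_tendsto:
  assumes "\<forall>\<^sub>F \<xi> in F. L2 (f \<xi>)" "L2 g" "L2 k" "((\<lambda>\<xi>. l2sq (\<lambda>\<omega>. f \<xi> \<omega> - g \<omega>)) \<longlongrightarrow> 0) F"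
  shows "((\<lambda>\<xi>. LINT \<omega>|lborel. k \<omega> * f \<xi> \<omega>) \<longlongrightarrow> (LINT \<omega>|lborel. k \<omega> * g \<omega>)) F"
proof -
  have "((\<lambda>\<xi>. sqrt (l2sq k * l2sq (\<lambda>\<omega>. f \<xi> \<omega> - g \<omega>))) \<longlongrightarrow> sqrt (l2sq k * 0)) F"
    by (intro tendsto_intros assms)
  then have lim: "((\<lambda>\<xi>. sqrt (l2sq k * l2sq (\<lambda>\<omega>. f \<xi> \<omega> - g \<omega>))) \<longlongrightarrow> 0) F" by simp
  have "((\<lambda>\<xi>. (LINT \<omega>|lborel. k \<omega> * f \<xi> \<omega>) - (LINT \<omega>|lborel. k \<omega> * g \<omega>)) \<longlongrightarrow> 0) F"
  proof (rule Lim_null_comparison[OF _ lim])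
    show "\<forall>\<^sub>F \<xi> in F. norm ((LINT \<omega>|lborel. k \<omega> * f \<xi> \<omega>) - (LINT \<omega>|lborel. k \<omega> * g \<omega>)) \<le> sqrt (l2sq k * l2sq (\<lambda>\<omega>. f \<xi> \<omega> - g \<omega>))"
      using assms(1)
    proof eventually_elim
      case (elim \<xi>)
      have "(LINT \<omega>|lborel. k \<omega> * f \<xi> \<omega>) - (LINT \<omega>|lborel. k \<omega> * g \<omega>) = (LINT \<omega>|lborel. k \<omega> * (f \<xi> \<omega> - g \<omega>))"
        using L2_mult_integrable[OF assms(3) elim] L2_mult_integrable[OF assms(3,2)]
        by (simp add: right_diff_distrib)
      then show ?case
        using L2_Cauchy_Schwarz[OF assms(3) L2_diff[OF elim assms(2)]] by (simp add: real_le_rsqrt)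
    qed
  qed
  then show ?thesis by (simp add: LIM_zero_iff)
qed

text \<open>Weighted by \<open>2^n\<close>, the squared increments still have integrals summing to a
  geometric series of ratio 1/4, so their sum is finite almost everywhere. At such a point an
  increment \<open>d\<close> is either at most \<open>2^-n\<close> or satisfies
  \<open>d <= 2^n d^2\<close>; either way the increments are summable.\<close>

lemma AE_convergent_of_L2_increments:
  fixes f :: "nat \<Rightarrow> real \<Rightarrow> complex"
  assumes m[measurable]: "\<And>n. f n \<in> borel_measurable lborel"
    and inc: "\<And>n. (\<integral>\<^sup>+\<omega>. ennreal ((cmod (f (Suc n) \<omega> - f n \<omega>))\<^sup>2) \<partial>lborel) \<le> ennreal ((1/8)^n)"
  shows "AE \<omega> in lborel. convergent (\<lambda>n. f n \<omega>)"
proof -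
  define e where "e n \<omega> = 2^n * (cmod (f (Suc n) \<omega> - f n \<omega>))\<^sup>2" for n \<omega>
  have [measurable]: "e n \<in> borel_measurable lborel" for n unfolding e_def by measurable
  have "(\<integral>\<^sup>+\<omega>. (\<Sum>n. ennreal (e n \<omega>)) \<partial>lborel) = (\<Sum>n. \<integral>\<^sup>+\<omega>. ennreal (e n \<omega>) \<partial>lborel)"
    by (rule nn_integral_suminf) measurable
  also have "\<dots> \<le> (\<Sum>n. ennreal ((1/4)^n))"
  proof (intro suminf_le)
    fix n
    have "(\<integral>\<^sup>+\<omega>. ennreal (e n \<omega>) \<partial>lborel) = ennreal (2^n) * (\<integral>\<^sup>+\<omega>. ennreal ((cmod (f (Suc n) \<omega> - f n \<omega>))\<^sup>2) \<partial>lborel)"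
      unfolding e_def by (subst nn_integral_cmult[symmetric]) (auto simp: ennreal_mult)
    also have "\<dots> \<le> ennreal (2^n) * ennreal ((1/8)^n)" by (intro mult_left_mono inc) auto
    also have "\<dots> = ennreal ((1/4)^n)" by (simp add: ennreal_mult[symmetric] power_mult_distrib[symmetric])
    finally show "(\<integral>\<^sup>+\<omega>. ennreal (e n \<omega>) \<partial>lborel) \<le> ennreal ((1/4)^n)" .
  qed auto
  also have "\<dots> = ennreal (\<Sum>n. (1/4)^n)" by (rule suminf_ennreal_eq[OF _ summable_sums]) (auto intro: summable_geometric)
  finally have "(\<integral>\<^sup>+\<omega>. (\<Sum>n. ennreal (e n \<omega>)) \<partial>lborel) \<noteq> \<infinity>"
    by (auto simp: top_unique)
  then have "AE \<omega> in lborel. (\<Sum>n. ennreal (e n \<omega>)) \<noteq> \<infinity>"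
    by (intro nn_integral_noteq_infinite) measurable
  then show ?thesis
  proof eventually_elim
    case (elim \<omega>)
    have se: "summable (\<lambda>n. e n \<omega>)"
      using elim by (intro summable_suminf_not_top) (auto simp: e_def)
    have "summable (\<lambda>n. e n \<omega> + (1/2)^n)"
      by (intro summable_add se summable_geometric) auto
    then have "summable (\<lambda>n. f (Suc n) \<omega> - f n \<omega>)"
    proof (rule summable_comparison_test'[where N = 0])
      fix n :: nat
      let ?d = "cmod (f (Suc n) \<omega> - f n \<omega>)"
      show "norm (f (Suc n) \<omega> - f n \<omega>) \<le> e n \<omega> + (1/2)^n"
      proof (cases "?d \<le> (1/2)^n")
        case False
        then have "2^n * ?d \<ge> 1" by (simp add: field_simps power_one_over)
        then have "1 * ?d \<le> 2^n * ?d * ?d" by (intro mult_right_mono) auto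
        then show ?thesis by (simp add: e_def power2_eq_square mult.assoc add_increasing2)
      qed (simp add: e_def add_increasing)
    qed
    then have "(\<lambda>m. f 0 \<omega> + (\<Sum>n<m. f (Suc n) \<omega> - f n \<omega>)) \<longlonglongrightarrow> f 0 \<omega> + (\<Sum>n. f (Suc n) \<omega> - f n \<omega>)"
      by (intro tendsto_intros summable_LIMSEQ)
    moreover have "(\<Sum>n<m. f (Suc n) \<omega> - f n \<omega>) = f m \<omega> - f 0 \<omega>" for m
      by (rule sum_lessThan_telescope)
    ultimately show ?case by (auto simp: convergent_def)
  qed
qed

section \<open>Boundary values\<close>

text \<open>The scalar Hardy space with an explicit bound, which need not be the supremum: the
  contour arguments ask for one number that serves all vertical lines.\<close>

definition hardy_bound :: "(complex \<Rightarrow> complex) \<Rightarrow> real \<Rightarrow> bool" where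
  "hardy_bound f M \<longleftrightarrow> f holomorphic_on right_half_plane \<and> M \<ge> 0 \<and>
     (\<forall>\<xi>>0. (\<integral>\<^sup>+\<omega>. ennreal ((cmod (f (Complex \<xi> \<omega>)))\<^sup>2) \<partial>lborel) \<le> ennreal M)"

text \<open>The scalar form of \<open>is_boundary_function\<close>. Being a relation, it accepts any
  representative, so explicit boundary values can be supplied for explicit functions.\<close>

definition bdry :: "(complex \<Rightarrow> complex) \<Rightarrow> (real \<Rightarrow> complex) \<Rightarrow> bool" where
  "bdry f g \<longleftrightarrow> g \<in> borel_measurable lborel \<and>
     ((\<lambda>\<xi>. \<integral>\<^sup>+\<omega>. ennreal ((cmod (f (Complex \<xi> \<omega>) - g \<omega>))\<^sup>2) \<partial>lborel) \<longlongrightarrow> 0) (at_right 0)"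

lemma open_right_half_plane [simp]: "open right_half_plane"
  unfolding right_half_plane_def by (rule open_halfspace_Re_gt)

lemma convex_right_half_plane [simp]: "convex right_half_plane"
  unfolding right_half_plane_def by (rule convex_halfspace_Re_gt)

lemma Complex_in_right_half_plane [simp]: "Complex \<xi> \<omega> \<in> right_half_plane \<longleftrightarrow> \<xi> > 0"
  by (simp add: right_half_plane_def)

lemma continuous_on_Complex_vert [continuous_intros]: "continuous_on A (Complex \<xi>)"
  unfolding Complex_eq by (intro continuous_intros)

lemma vertical_line_measurable:
  assumes "continuous_on right_half_plane f" "\<xi> > 0"
  shows "(\<lambda>\<omega>. f (Complex \<xi> \<omega>)) \<in> borel_measurable lborel"
proof -
  have "continuous_on UNIV (\<lambda>\<omega>. f (Complex \<xi> \<omega>))"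
    by (rule continuous_on_compose2[OF assms(1)]) (use assms(2) in \<open>auto intro: continuous_intros\<close>)
  then show ?thesis by (simp add: borel_measurable_continuous_onI)
qed

text \<open>Provides the joint measurability that Fubini asks for in
  \<open>vertical_line_jump\<close>; the indicator removes the region where nothing is known about
  \<open>f\<close>.\<close>

lemma strip_measurable:
  fixes f :: "complex \<Rightarrow> complex"
  assumes "continuous_on {z. Re z \<in> {\<tau>1..\<tau>2}} f"
  shows "(\<lambda>(x, \<omega>). indicator {\<tau>1..\<tau>2} x * f (Complex x \<omega>)) \<in> borel_measurable (lborel \<Otimes>\<^sub>M lborel)"
proof -
  have "continuous_on ({\<tau>1..\<tau>2} \<times> UNIV) (\<lambda>p. f (Complex (fst p) (snd p)))"
    by (rule continuous_on_compose2[OF assms]) (auto simp: Complex_eq intro!: continuous_intros)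
  moreover have "{\<tau>1..\<tau>2} \<times> (UNIV :: real set) \<in> sets borel"
    by (intro borel_closed closed_Times) auto
  ultimately have "(\<lambda>p. indicator ({\<tau>1..\<tau>2} \<times> UNIV) p *\<^sub>R f (Complex (fst p) (snd p))) \<in> borel_measurable borel"
    by (intro borel_measurable_continuous_on_indicator) auto
  also have "(\<lambda>p. indicator ({\<tau>1..\<tau>2} \<times> UNIV) p *\<^sub>R f (Complex (fst p) (snd p))) =
     (\<lambda>(x, \<omega>). indicator {\<tau>1..\<tau>2} x * f (Complex x \<omega>))"
    by (auto simp: fun_eq_iff indicator_def)
  also have "borel_measurable borel = borel_measurable (lborel \<Otimes>\<^sub>M (lborel :: real measure))"
    unfolding lborel_prod by simp
  finally show ?thesis .
qed

lemma hardy_L2: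
  assumes "hardy_bound f M" "\<xi> > 0"
  shows "L2 (\<lambda>\<omega>. f (Complex \<xi> \<omega>))" "l2sq (\<lambda>\<omega>. f (Complex \<xi> \<omega>)) \<le> M"
proof -
  have "(\<lambda>\<omega>. f (Complex \<xi> \<omega>)) \<in> borel_measurable lborel"
    using assms by (intro vertical_line_measurable holomorphic_on_imp_continuous_on) (auto simp: hardy_bound_def)
  then show "L2 (\<lambda>\<omega>. f (Complex \<xi> \<omega>))" "l2sq (\<lambda>\<omega>. f (Complex \<xi> \<omega>)) \<le> M"
    using assms L2_of_nn_integral_le[of "\<lambda>\<omega>. f (Complex \<xi> \<omega>)" M] by (auto simp: hardy_bound_def)
qed

lemma L2_nn_integral_mult_le:
  assumes "L2 f" "L2 g"
  shows "(\<integral>\<^sup>+\<omega>. ennreal (cmod (f \<omega> * g \<omega>)) \<partial>lborel) \<le> ennreal (l2sq f + l2sq g)"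
proof -
  note [measurable] = L2_measurable[OF assms(1)] L2_measurable[OF assms(2)]
  have "(\<integral>\<^sup>+\<omega>. ennreal (cmod (f \<omega> * g \<omega>)) \<partial>lborel) \<le> (\<integral>\<^sup>+\<omega>. ennreal ((cmod (f \<omega>))\<^sup>2) + ennreal ((cmod (g \<omega>))\<^sup>2) \<partial>lborel)"
    using norm_mult_le_sq by (intro nn_integral_mono) (simp flip: ennreal_plus)
  also have "\<dots> = ennreal (l2sq f) + ennreal (l2sq g)"
    by (subst nn_integral_add) (auto simp: L2_nn_integral assms)
  finally show ?thesis by simp
qed

section \<open>Shifting lines, convexity of the norm on lines, and existence of boundary
  values\<close>

lemma rectpath_integral_0:
  assumes "h holomorphic_on {z. \<alpha> < Re z \<and> Re z < \<beta>}" "\<alpha> < \<tau>1" "\<tau>1 < \<tau>2" "\<tau>2 < \<beta>" "R > 0"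
  shows "(h has_contour_integral 0) (rectpath (Complex \<tau>1 (-R)) (Complex \<tau>2 R))"
proof (rule Cauchy_theorem_convex_simple[OF assms(1)])
  have "convex ({z. Re z > \<alpha>} \<inter> {z. Re z < \<beta>})"
    by (intro convex_Int convex_halfspace_Re_gt convex_halfspace_Re_lt)
  then show "convex {z. \<alpha> < Re z \<and> Re z < \<beta>}" by (simp add: Collect_conj_eq)
  have "path_image (rectpath (Complex \<tau>1 (-R)) (Complex \<tau>2 R)) \<subseteq> cbox (Complex \<tau>1 (-R)) (Complex \<tau>2 R)"
    using assms by (intro path_image_rectpath_subset_cbox) auto
  then show "path_image (rectpath (Complex \<tau>1 (-R)) (Complex \<tau>2 R)) \<subseteq> {z. \<alpha> < Re z \<and> Re z < \<beta>}"
    using assms by (auto simp: in_cbox_complex_iff)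
qed auto

text \<open>The reflection \<open>z -> \<sigma> - cnj z\<close> keeps the imaginary part, so on each
  vertical line \<open>h\<close> pairs the values of \<open>f\<close> at equal heights on two lines
  with abscissae adding up to \<open>\<sigma>\<close>. As \<open>h\<close> is holomorphic in the
  strip, \<open>vertical_line_jump\<close> applies with \<open>J = 0\<close>.\<close>

lemma hardy_inner_shift_less:
  assumes f: "hardy_bound f M" and pos: "a > 0" "b > 0" "a' > 0" "b' > 0" and eq: "a + b = a' + b'" and less: "b < b'"
  shows "(LINT \<omega>|lborel. cnj (f (Complex a \<omega>)) * f (Complex b \<omega>)) =
         (LINT \<omega>|lborel. cnj (f (Complex a' \<omega>)) * f (Complex b' \<omega>))"
proof -
  define \<sigma> where "\<sigma> = a + b"
  define h where "h z = cnj (f (of_real \<sigma> - cnj z)) * f z" for z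
  have hol: "f holomorphic_on right_half_plane" using f by (simp add: hardy_bound_def)
  define U where "U = {z. 0 < Re z \<and> Re z < \<sigma>}"
  have opU: "open U"
  proof -
    have "open ({z. Re z > 0} \<inter> {z. Re z < \<sigma>})"
      by (intro open_Int open_halfspace_Re_gt open_halfspace_Re_lt)
    then show ?thesis by (simp add: U_def Collect_conj_eq)
  qed
  have hU: "h holomorphic_on U"
  proof -
    have "(\<lambda>z. f (of_real \<sigma> - z)) holomorphic_on cnj ` U"
      by (rule holomorphic_on_compose_gen[OF _ hol, unfolded o_def])
        (auto intro!: holomorphic_intros simp: U_def right_half_plane_def)
    from holomorphic_on_compose_cnj_cnj[OF this opU]
    have "(\<lambda>z. cnj (f (of_real \<sigma> - cnj z))) holomorphic_on U" by (simp add: o_def)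
    moreover have "f holomorphic_on U"
      by (rule holomorphic_on_subset[OF hol]) (auto simp: U_def right_half_plane_def)
    ultimately show ?thesis unfolding h_def by (rule holomorphic_on_mult)
  qed
  have line: "h (Complex x \<omega>) = cnj (f (Complex (\<sigma> - x) \<omega>)) * f (Complex x \<omega>)" for x \<omega>
  proof -
    have "of_real \<sigma> - cnj (Complex x \<omega>) = Complex (\<sigma> - x) \<omega>" by (simp add: complex_eq_iff)
    then show ?thesis by (simp add: h_def)
  qed
  have L: "L2 (\<lambda>\<omega>. cnj (f (Complex (\<sigma> - x) \<omega>)))" "L2 (\<lambda>\<omega>. f (Complex x \<omega>))"
     "l2sq (\<lambda>\<omega>. cnj (f (Complex (\<sigma> - x) \<omega>))) \<le> M" "l2sq (\<lambda>\<omega>. f (Complex x \<omega>)) \<le> M"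
    if "0 < x" "x < \<sigma>" for x
    using hardy_L2[OF f, of x] hardy_L2[OF f, of "\<sigma> - x"] that by (auto simp: L2_cnj)
  have contU: "continuous_on U h" using hU by (rule holomorphic_on_imp_continuous_on)
  have b's: "b' < \<sigma>" "b < \<sigma>" using pos eq by (auto simp: \<sigma>_def)
  have "\<i> * ((LINT \<omega>|lborel. h (Complex b' \<omega>)) - (LINT \<omega>|lborel. h (Complex b \<omega>))) = 0"
  proof (rule vertical_line_jump[where K = 0 and M = "2 * M"])
    show "b < b'" by fact
    show "(h has_contour_integral 0) (rectpath (Complex b (-R)) (Complex b' R))" if "R > 0" for R
      using hU unfolding U_def by (rule rectpath_integral_0) (use that pos less b's in auto)
    show "continuous_on {z. b \<le> Re z \<and> Re z \<le> b' \<and> (Re z = b \<or> Re z = b' \<or> 0 < \<bar>Im z\<bar>)} h"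
      by (rule continuous_on_subset[OF contU]) (use b's pos in \<open>auto simp: U_def\<close>)
    show "integrable lborel (\<lambda>\<omega>. h (Complex b \<omega>))" "integrable lborel (\<lambda>\<omega>. h (Complex b' \<omega>))"
      unfolding line using pos b's by (auto intro!: L2_mult_integrable L)
    show "(\<lambda>(x, \<omega>). indicator {b..b'} x * h (Complex x \<omega>)) \<in> borel_measurable (lborel \<Otimes>\<^sub>M lborel)"
      by (rule strip_measurable, rule continuous_on_subset[OF contU]) (use b's pos in \<open>auto simp: U_def\<close>)
    fix x assume x: "x \<in> {b..b'}"
    have "(\<integral>\<^sup>+\<omega>. indicator {\<omega>. 0 < \<bar>\<omega>\<bar>} \<omega> * ennreal (cmod (h (Complex x \<omega>))) \<partial>lborel) \<le> (\<integral>\<^sup>+\<omega>. ennreal (cmod (h (Complex x \<omega>))) \<partial>lborel)"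
      by (intro nn_integral_mono) (auto simp: indicator_def)
    also have "\<dots> \<le> ennreal (l2sq (\<lambda>\<omega>. cnj (f (Complex (\<sigma> - x) \<omega>))) + l2sq (\<lambda>\<omega>. f (Complex x \<omega>)))"
      unfolding line by (rule L2_nn_integral_mult_le) (use L[of x] x pos b's in auto)
    also have "\<dots> \<le> ennreal (2 * M)"
      using L[of x] x pos b's by (intro ennreal_leI) auto
    finally show "(\<integral>\<^sup>+\<omega>. indicator {\<omega>. 0 < \<bar>\<omega>\<bar>} \<omega> * ennreal (cmod (h (Complex x \<omega>))) \<partial>lborel) \<le> ennreal (2 * M)" .
  qed simp
  moreover have "\<sigma> - b = a" "\<sigma> - b' = a'" using eq by (auto simp: \<sigma>_def)
  ultimately show ?thesis by (simp add: line)
qed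

lemma hardy_inner_shift:
  assumes "hardy_bound f M" "a > 0" "b > 0" "a' > 0" "b' > 0" "a + b = a' + b'"
  shows "(LINT \<omega>|lborel. cnj (f (Complex a \<omega>)) * f (Complex b \<omega>)) =
         (LINT \<omega>|lborel. cnj (f (Complex a' \<omega>)) * f (Complex b' \<omega>))"
proof (cases b b' rule: linorder_cases)
  case less
  with assms show ?thesis by (intro hardy_inner_shift_less)
next
  case equal
  with assms(6) show ?thesis by simp
next
  case greater
  with assms show ?thesis by (intro hardy_inner_shift_less[symmetric]) simp_all
qed

lemma l2sq_diff_expand:
  assumes "L2 f" "L2 g"
  shows "l2sq (\<lambda>\<omega>. f \<omega> - g \<omega>) = l2sq f - 2 * Re (LINT \<omega>|lborel. cnj (f \<omega>) * g \<omega>) + l2sq g"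
proof -
  have i: "integrable lborel (\<lambda>\<omega>. cnj (f \<omega>) * g \<omega>)"
    using assms by (intro L2_mult_integrable L2_cnj)
  have "(cmod (f \<omega> - g \<omega>))\<^sup>2 = ((cmod (f \<omega>))\<^sup>2 - 2 * Re (cnj (f \<omega>) * g \<omega>)) + (cmod (g \<omega>))\<^sup>2" for \<omega>
    unfolding cmod_power2 by (simp add: power2_eq_square algebra_simps)
  then have "l2sq (\<lambda>\<omega>. f \<omega> - g \<omega>) = (LINT \<omega>|lborel. ((cmod (f \<omega>))\<^sup>2 - 2 * Re (cnj (f \<omega>) * g \<omega>)) + (cmod (g \<omega>))\<^sup>2)"
    unfolding l2sq_def by (simp only:)
  also have "\<dots> = l2sq f - 2 * Re (LINT \<omega>|lborel. cnj (f \<omega>) * g \<omega>) + l2sq g"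
  proof -
    have *: "(LINT \<omega>|lborel. (u \<omega> - 2 * v \<omega>) + w \<omega>) = (LINT \<omega>|lborel. u \<omega>) - 2 * (LINT \<omega>|lborel. v \<omega>) + (LINT \<omega>|lborel. w \<omega>)"
      if "integrable lborel u" "integrable lborel v" "integrable lborel w" for u v w :: "real \<Rightarrow> real"
      using that by simp
    show ?thesis
      unfolding l2sq_def integral_Re[OF i, symmetric]
      using assms integrable_Re[OF i] by (intro *) (simp_all only: L2_def)
  qed
  finally show ?thesis .
qed

text \<open>Along the progression \<open>x + n (y - x)\<close> midpoint convexity makes the
  increments of \<phi> nondecreasing. A first increment \<open>d > 0\<close> would force growth of
  at least \<open>n d\<close>, past the bound \<open>M\<close>.\<close>

lemma bounded_midconvex_antimono:
  fixes \<phi> :: "real \<Rightarrow> real"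
  assumes bd: "\<And>x. x > 0 \<Longrightarrow> \<phi> x \<le> M"
    and conv: "\<And>x y. x > 0 \<Longrightarrow> y > 0 \<Longrightarrow> 2 * \<phi> ((x + y) / 2) \<le> \<phi> x + \<phi> y"
    and xy: "0 < x" "x \<le> y"
  shows "\<phi> y \<le> \<phi> x"
proof (rule ccontr)
  assume neg: "\<not> ?thesis"
  define d where "d = \<phi> y - \<phi> x"
  have d: "d > 0" using neg by (simp add: d_def)
  define a where "a n = \<phi> (x + real n * (y - x))" for n
  have step: "2 * a (Suc n) \<le> a n + a (Suc (Suc n))" for n
  proof -
    have "2 * \<phi> (((x + real n * (y - x)) + (x + real (Suc (Suc n)) * (y - x))) / 2) \<le> a n + a (Suc (Suc n))"
      unfolding a_def by (rule conv) (use xy in \<open>auto intro!: add_pos_nonneg\<close>)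
    also have "((x + real n * (y - x)) + (x + real (Suc (Suc n)) * (y - x))) / 2 = x + real (Suc n) * (y - x)"
      by (simp add: field_simps)
    finally show ?thesis by (simp add: a_def)
  qed
  have inc: "a (Suc n) - a n \<ge> d" for n
  proof (induction n)
    case (Suc n) then show ?case using step[of n] by linarith
  qed (simp add: a_def d_def)
  have "a n \<ge> a 0 + real n * d" for n
  proof (induction n)
    case (Suc n) then show ?case using inc[of n] by (simp add: algebra_simps)
  qed simp
  moreover obtain n where "(M - a 0) / d < real n" using reals_Archimedean2 by blast
  then have "M < a 0 + real n * d" using d by (simp add: field_simps)
  moreover have "a n \<le> M" unfolding a_def using xy by (intro bd) (auto intro!: add_pos_nonneg)
  ultimately show False by (metis linorder_not_less order.strict_trans1)
qed

text \<open>The squared distance of the lines at \<xi> and \<eta> is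
  \<open>\<phi> (2\<xi>) - 2 \<phi> (\<xi>+\<eta>) + \<phi> (2\<eta>)\<close>. All three values lie
  between \<open>\<phi> x0\<close> and the supremum \<open>L\<close> when the arguments are at most
  \<open>x0\<close>, so the expression is at most \<open>2 (L - \<phi> x0) < e\<close>.
  Nonnegativity of the same expression is the midpoint convexity.\<close>

lemma hardy_increment_tendsto_0:
  assumes f: "hardy_bound f M" and e: "e > 0"
  obtains \<delta> where "\<delta> > 0" "\<And>\<xi> \<eta>. 0 < \<xi> \<Longrightarrow> \<xi> \<le> \<delta> \<Longrightarrow> 0 < \<eta> \<Longrightarrow> \<eta> \<le> \<delta> \<Longrightarrow>
    l2sq (\<lambda>\<omega>. f (Complex \<xi> \<omega>) - f (Complex \<eta> \<omega>)) \<le> e"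
proof -
  \<comment> \<open>Indexed by the sum of two abscissae: the pairing of two lines is the squared
    norm on the line half-way between them.\<close>
  define \<phi> where "\<phi> x = l2sq (\<lambda>\<omega>. f (Complex (x/2) \<omega>))" for x
  have inner: "Re (LINT \<omega>|lborel. cnj (f (Complex \<xi> \<omega>)) * f (Complex \<eta> \<omega>)) = \<phi> (\<xi> + \<eta>)" if "\<xi> > 0" "\<eta> > 0" for \<xi> \<eta>
  proof -
    have "(LINT \<omega>|lborel. cnj (f (Complex \<xi> \<omega>)) * f (Complex \<eta> \<omega>)) =
      (LINT \<omega>|lborel. cnj (f (Complex ((\<xi>+\<eta>)/2) \<omega>)) * f (Complex ((\<xi>+\<eta>)/2) \<omega>))"
      by (rule hardy_inner_shift[OF f]) (use that in auto)
    also have "\<dots> = (LINT \<omega>|lborel. complex_of_real ((cmod (f (Complex ((\<xi>+\<eta>)/2) \<omega>)))\<^sup>2))"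
      by (intro Bochner_Integration.integral_cong refl) (metis complex_norm_square mult.commute)
    finally show ?thesis by (simp only: integral_complex_of_real Re_complex_of_real \<phi>_def l2sq_def)
  qed
  have exp: "l2sq (\<lambda>\<omega>. f (Complex \<xi> \<omega>) - f (Complex \<eta> \<omega>)) = \<phi> (2*\<xi>) - 2 * \<phi> (\<xi>+\<eta>) + \<phi> (2*\<eta>)"
    if "\<xi> > 0" "\<eta> > 0" for \<xi> \<eta>
    using that by (subst l2sq_diff_expand) (simp_all only: hardy_L2(1)[OF f] inner, simp add: \<phi>_def)
  have conv: "2 * \<phi> ((x + y) / 2) \<le> \<phi> x + \<phi> y" if "x > 0" "y > 0" for x y
    using exp[of "x/2" "y/2"] l2sq_nonneg[of "\<lambda>\<omega>. f (Complex (x/2) \<omega>) - f (Complex (y/2) \<omega>)"] that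
    by (simp add: add_divide_distrib del: l2sq_nonneg)
  have bd: "\<phi> x \<le> M" if "x > 0" for x using that hardy_L2(2)[OF f, of "x/2"] by (simp add: \<phi>_def)
  have anti: "\<phi> y \<le> \<phi> x" if "0 < x" "x \<le> y" for x y
    by (rule bounded_midconvex_antimono[of \<phi> M]) (fact bd conv that)+
  define L where "L = (SUP x\<in>{0<..}. \<phi> x)"
  have bdd: "bdd_above (\<phi> ` {0<..})" using bd by (intro bdd_aboveI2[where M = M]) auto
  have "L - e/2 < L" using e by simp
  moreover have "{0<..} \<noteq> ({} :: real set)" by auto
  ultimately obtain x0 where x0: "x0 > 0" "L - e/2 < \<phi> x0"
    using less_cSUP_iff[of "{0<..}" \<phi> "L - e/2"] bdd unfolding L_def by blast
  show ?thesis
  proof (rule that[of "x0/2"])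
    fix \<xi> \<eta> assume a: "0 < \<xi>" "\<xi> \<le> x0/2" "0 < \<eta>" "\<eta> \<le> x0/2"
    have "\<phi> (2*\<xi>) \<le> L" "\<phi> (2*\<eta>) \<le> L" unfolding L_def using a by (intro cSUP_upper[OF _ bdd]; simp)+
    moreover have "\<phi> x0 \<le> \<phi> (\<xi>+\<eta>)" using a by (intro anti) auto
    ultimately show "l2sq (\<lambda>\<omega>. f (Complex \<xi> \<omega>) - f (Complex \<eta> \<omega>)) \<le> e"
      using a x0 by (simp add: exp)
  qed (use x0 in auto)
qed

text \<open>Completeness of the square-integrable functions done by hand: a fast sequence of lines
  converges almost everywhere, and Fatou's lemma carries the Cauchy estimate from the sequence over
  to its limit.\<close>

lemma hardy_bdry_exists:
  assumes f: "hardy_bound f M"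
  shows "\<exists>g. bdry f g"
proof -
  have "\<exists>\<delta>>0. \<forall>\<xi> \<eta>. 0 < \<xi> \<longrightarrow> \<xi> \<le> \<delta> \<longrightarrow> 0 < \<eta> \<longrightarrow> \<eta> \<le> \<delta> \<longrightarrow>
    l2sq (\<lambda>\<omega>. f (Complex \<xi> \<omega>) - f (Complex \<eta> \<omega>)) \<le> (1/8)^n" for n :: nat
  proof -
    have "(1/8::real)^n > 0" by simp
    show ?thesis by (rule hardy_increment_tendsto_0[OF f \<open>(1/8::real)^n > 0\<close>]) blast
  qed
  then have "\<exists>\<delta>. \<forall>n::nat. \<delta> n > 0 \<and> (\<forall>\<xi> \<eta>. 0 < \<xi> \<longrightarrow> \<xi> \<le> \<delta> n \<longrightarrow> 0 < \<eta> \<longrightarrow> \<eta> \<le> \<delta> n \<longrightarrow>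
    l2sq (\<lambda>\<omega>. f (Complex \<xi> \<omega>) - f (Complex \<eta> \<omega>)) \<le> (1/8)^n)"
    by (intro choice allI)
  then obtain \<delta> where \<delta>: "\<And>n::nat. \<delta> n > 0" "\<And>n \<xi> \<eta>. 0 < \<xi> \<Longrightarrow> \<xi> \<le> \<delta> n \<Longrightarrow> 0 < \<eta> \<Longrightarrow> \<eta> \<le> \<delta> n \<Longrightarrow>
    l2sq (\<lambda>\<omega>. f (Complex \<xi> \<omega>) - f (Complex \<eta> \<omega>)) \<le> (1/8)^n"
    by blast
  \<comment> \<open>The minimum over all earlier thresholds ensures \<open>x m <= \<delta> n\<close>
    for every \<open>m >= n\<close>, so the tail of the sequence obeys each of the earlier
    estimates.\<close>
  define x where "x n = Min (\<delta> ` {..n})" for n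
  have xpos: "x n > 0" for n unfolding x_def using \<delta>(1) by (subst Min_gr_iff) auto
  have xle: "x m \<le> \<delta> n" if "n \<le> m" for m n unfolding x_def using that by (intro Min_le) auto
  have L: "L2 (\<lambda>\<omega>. f (Complex \<xi> \<omega>) - f (Complex \<eta> \<omega>))" if "\<xi> > 0" "\<eta> > 0" for \<xi> \<eta>
    by (intro L2_diff hardy_L2[OF f] that)
  have m[measurable]: "(\<lambda>\<omega>. f (Complex \<xi> \<omega>)) \<in> borel_measurable lborel" if "\<xi> > 0" for \<xi>
    using hardy_L2(1)[OF f that] by (rule L2_measurable)
  have conv: "AE \<omega> in lborel. convergent (\<lambda>n. f (Complex (x n) \<omega>))"
  proof (rule AE_convergent_of_L2_increments)
    fix n
    show "(\<integral>\<^sup>+\<omega>. ennreal ((cmod (f (Complex (x (Suc n)) \<omega>) - f (Complex (x n) \<omega>)))\<^sup>2) \<partial>lborel) \<le> ennreal ((1/8)^n)"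
      by (subst L2_nn_integral) (auto intro!: L xpos ennreal_leI \<delta>(2) xle)
  qed (use m xpos in auto)
  define g where "g \<omega> = lim (\<lambda>n. f (Complex (x n) \<omega>))" for \<omega>
  have gm[measurable]: "g \<in> borel_measurable lborel"
    unfolding g_def by (intro borel_measurable_lim_metric m xpos)
  have est: "(\<integral>\<^sup>+\<omega>. ennreal ((cmod (f (Complex \<xi> \<omega>) - g \<omega>))\<^sup>2) \<partial>lborel) \<le> ennreal ((1/8)^n)"
    if "0 < \<xi>" "\<xi> \<le> \<delta> n" for \<xi> n
  proof -
    have "(\<integral>\<^sup>+\<omega>. ennreal ((cmod (f (Complex \<xi> \<omega>) - g \<omega>))\<^sup>2) \<partial>lborel) =
      (\<integral>\<^sup>+\<omega>. liminf (\<lambda>k. ennreal ((cmod (f (Complex \<xi> \<omega>) - f (Complex (x k) \<omega>)))\<^sup>2)) \<partial>lborel)"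
    proof (rule nn_integral_cong_AE)
      show "AE \<omega> in lborel. ennreal ((cmod (f (Complex \<xi> \<omega>) - g \<omega>))\<^sup>2) =
         liminf (\<lambda>k. ennreal ((cmod (f (Complex \<xi> \<omega>) - f (Complex (x k) \<omega>)))\<^sup>2))"
        using conv
      proof eventually_elim
        case (elim \<omega>)
        then have "(\<lambda>n. f (Complex (x n) \<omega>)) \<longlonglongrightarrow> g \<omega>"
          by (simp add: g_def convergent_LIMSEQ_iff)
        then have "(\<lambda>k. ennreal ((cmod (f (Complex \<xi> \<omega>) - f (Complex (x k) \<omega>)))\<^sup>2)) \<longlonglongrightarrow> ennreal ((cmod (f (Complex \<xi> \<omega>) - g \<omega>))\<^sup>2)"
          by (intro tendsto_intros)
        then show ?case by (intro lim_imp_Liminf[symmetric]) auto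
      qed
    qed
    also have "\<dots> \<le> liminf (\<lambda>k. \<integral>\<^sup>+\<omega>. ennreal ((cmod (f (Complex \<xi> \<omega>) - f (Complex (x k) \<omega>)))\<^sup>2) \<partial>lborel)"
    proof (rule nn_integral_liminf)
      fix k
      have [measurable]: "(\<lambda>\<omega>. f (Complex \<xi> \<omega>) - f (Complex (x k) \<omega>)) \<in> borel_measurable lborel"
        using L[OF that(1) xpos] by (rule L2_measurable)
      show "(\<lambda>\<omega>. ennreal ((cmod (f (Complex \<xi> \<omega>) - f (Complex (x k) \<omega>)))\<^sup>2)) \<in> borel_measurable lborel"
        by measurable
    qed
    also have "\<dots> \<le> ennreal ((1/8)^n)"
    proof (rule Liminf_le)
      show "\<forall>\<^sub>F k in sequentially. (\<integral>\<^sup>+\<omega>. ennreal ((cmod (f (Complex \<xi> \<omega>) - f (Complex (x k) \<omega>)))\<^sup>2) \<partial>lborel) \<le> ennreal ((1/8)^n)"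
        using eventually_ge_at_top[of n]
      proof eventually_elim
        case (elim k)
        then show ?case
          by (subst L2_nn_integral) (use that in \<open>auto intro!: L xpos ennreal_leI \<delta>(2) xle\<close>)
      qed
    qed simp
    finally show ?thesis .
  qed
  have "((\<lambda>\<xi>. \<integral>\<^sup>+\<omega>. ennreal ((cmod (f (Complex \<xi> \<omega>) - g \<omega>))\<^sup>2) \<partial>lborel) \<longlongrightarrow> 0) (at_right 0)"
  proof (rule order_tendstoI)
    fix a :: ennreal assume "0 < a"
    have "(\<lambda>n. ennreal ((1/8)^n)) \<longlonglongrightarrow> ennreal 0"
      by (intro tendsto_ennrealI LIMSEQ_power_zero) auto
    then have "\<forall>\<^sub>F n in sequentially. ennreal ((1/8)^n) < a"
      using \<open>0 < a\<close> by (auto dest: order_tendstoD(2))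
    then obtain n where n: "ennreal ((1/8)^n) < a" by (auto simp: eventually_sequentially)
    have "(\<integral>\<^sup>+\<omega>. ennreal ((cmod (f (Complex \<xi> \<omega>) - g \<omega>))\<^sup>2) \<partial>lborel) < a" if "0 < \<xi>" "\<xi> < \<delta> n" for \<xi>
      using est[of \<xi> n] that n by (intro le_less_trans[OF est n]) auto
    then show "\<forall>\<^sub>F \<xi> in at_right 0. (\<integral>\<^sup>+\<omega>. ennreal ((cmod (f (Complex \<xi> \<omega>) - g \<omega>))\<^sup>2) \<partial>lborel) < a"
      unfolding eventually_at_right_field using \<delta>(1)[of n] by blast
  qed simp
  with gm show ?thesis unfolding bdry_def by blast
qed

section \<open>Integrability, uniqueness and linearity of boundary values\<close>

lemma bdry_L2:
  assumes f: "hardy_bound f M" and g: "bdry f g"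
  shows "L2 g"
proof -
  have gm: "g \<in> borel_measurable lborel" using g by (simp add: bdry_def)
  have "((\<lambda>\<xi>. \<integral>\<^sup>+\<omega>. ennreal ((cmod (f (Complex \<xi> \<omega>) - g \<omega>))\<^sup>2) \<partial>lborel) \<longlongrightarrow> 0) (at_right 0)"
    using g by (simp add: bdry_def)
  then have "\<forall>\<^sub>F \<xi> in at_right 0. (\<integral>\<^sup>+\<omega>. ennreal ((cmod (f (Complex \<xi> \<omega>) - g \<omega>))\<^sup>2) \<partial>lborel) < 1"
    by (rule order_tendstoD) simp
  then obtain \<xi> where xi: "\<xi> > 0" "(\<integral>\<^sup>+\<omega>. ennreal ((cmod (f (Complex \<xi> \<omega>) - g \<omega>))\<^sup>2) \<partial>lborel) < 1"
    unfolding eventually_at_right_field by (metis dense)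
  have fL: "L2 (\<lambda>\<omega>. f (Complex \<xi> \<omega>))" using f xi by (intro hardy_L2)
  have "L2 (\<lambda>\<omega>. f (Complex \<xi> \<omega>) - g \<omega>)"
    unfolding L2_iff_nn_integral
    using L2_measurable[OF fL] gm xi(2) by (auto intro: less_trans[of _ 1])
  from L2_diff[OF fL this] show ?thesis by simp
qed

lemma bdry_l2sq_tendsto:
  assumes f: "hardy_bound f M" and g: "bdry f g"
  shows "((\<lambda>\<xi>. l2sq (\<lambda>\<omega>. f (Complex \<xi> \<omega>) - g \<omega>)) \<longlongrightarrow> 0) (at_right 0)"
proof -
  have ev: "\<forall>\<^sub>F \<xi> in at_right 0. (\<integral>\<^sup>+\<omega>. ennreal ((cmod (f (Complex \<xi> \<omega>) - g \<omega>))\<^sup>2) \<partial>lborel) = ennreal (l2sq (\<lambda>\<omega>. f (Complex \<xi> \<omega>) - g \<omega>))"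
    using eventually_at_right_less
    by eventually_elim (intro L2_nn_integral L2_diff bdry_L2[OF f g] hardy_L2[OF f])
  have "((\<lambda>\<xi>. \<integral>\<^sup>+\<omega>. ennreal ((cmod (f (Complex \<xi> \<omega>) - g \<omega>))\<^sup>2) \<partial>lborel) \<longlongrightarrow> 0) (at_right 0)"
    using g by (simp add: bdry_def)
  then have "((\<lambda>\<xi>. ennreal (l2sq (\<lambda>\<omega>. f (Complex \<xi> \<omega>) - g \<omega>))) \<longlongrightarrow> ennreal 0) (at_right 0)"
    using tendsto_cong[OF ev] by simp
  then show ?thesis by (rule tendsto_ennrealD) auto
qed

lemma l2sq_0_imp_AE:
  assumes "L2 f" "l2sq f = 0" shows "AE \<omega> in lborel. f \<omega> = 0"
proof -
  have "AE \<omega> in lborel. (cmod (f \<omega>))\<^sup>2 = 0"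
    using assms integral_nonneg_eq_0_iff_AE[of lborel "\<lambda>\<omega>. (cmod (f \<omega>))\<^sup>2"] by (auto simp: L2_def l2sq_def)
  then show ?thesis by simp
qed

lemma bdry_unique:
  assumes f: "hardy_bound f M" and g: "bdry f g" and g': "bdry f g'"
  shows "AE \<omega> in lborel. g \<omega> = g' \<omega>"
proof -
  note L = bdry_L2[OF f g] bdry_L2[OF f g']
  have "((\<lambda>\<xi>. 2 * l2sq (\<lambda>\<omega>. f (Complex \<xi> \<omega>) - g \<omega>) + 2 * l2sq (\<lambda>\<omega>. f (Complex \<xi> \<omega>) - g' \<omega>)) \<longlongrightarrow> 2 * 0 + 2 * 0) (at_right 0)"
    by (intro tendsto_intros bdry_l2sq_tendsto[OF f] g g')
  moreover have "\<forall>\<^sub>F \<xi> in at_right 0. l2sq (\<lambda>\<omega>. g \<omega> - g' \<omega>) \<le> 2 * l2sq (\<lambda>\<omega>. f (Complex \<xi> \<omega>) - g \<omega>) + 2 * l2sq (\<lambda>\<omega>. f (Complex \<xi> \<omega>) - g' \<omega>)"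
    using eventually_at_right_less
  proof eventually_elim
    case (elim \<xi>)
    have 1: "L2 (\<lambda>\<omega>. f (Complex \<xi> \<omega>) - g' \<omega>)" and 2: "L2 (\<lambda>\<omega>. (-1) * (f (Complex \<xi> \<omega>) - g \<omega>))"
      using elim by (auto intro!: L2_diff L2_cmult hardy_L2[OF f] L simp del: mult_minus1)
    have "l2sq (\<lambda>\<omega>. (-1) * (f (Complex \<xi> \<omega>) - g \<omega>)) = l2sq (\<lambda>\<omega>. f (Complex \<xi> \<omega>) - g \<omega>)"
      by (subst l2sq_cmult) simp
    then show ?case using L2_add(2)[OF 1 2] by simp
  qed
  ultimately have "l2sq (\<lambda>\<omega>. g \<omega> - g' \<omega>) \<le> 2 * 0 + 2 * 0"
    by (rule tendsto_lowerbound) simp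
  then have "l2sq (\<lambda>\<omega>. g \<omega> - g' \<omega>) = 0" using l2sq_nonneg[of "\<lambda>\<omega>. g \<omega> - g' \<omega>"] by linarith
  from l2sq_0_imp_AE[OF L2_diff[OF L] this] show ?thesis by simp
qed

lemma bdry_of_l2sq_tendsto:
  assumes "g \<in> borel_measurable lborel"
    and "\<And>\<xi>. \<xi> > 0 \<Longrightarrow> L2 (\<lambda>\<omega>. f (Complex \<xi> \<omega>) - g \<omega>)"
    and "((\<lambda>\<xi>. l2sq (\<lambda>\<omega>. f (Complex \<xi> \<omega>) - g \<omega>)) \<longlongrightarrow> 0) (at_right 0)"
  shows "bdry f g"
  unfolding bdry_def
proof
  have ev: "\<forall>\<^sub>F \<xi> in at_right 0. (\<integral>\<^sup>+\<omega>. ennreal ((cmod (f (Complex \<xi> \<omega>) - g \<omega>))\<^sup>2) \<partial>lborel) = ennreal (l2sq (\<lambda>\<omega>. f (Complex \<xi> \<omega>) - g \<omega>))"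
    using eventually_at_right_less by eventually_elim (intro L2_nn_integral assms(2))
  have "((\<lambda>\<xi>. ennreal (l2sq (\<lambda>\<omega>. f (Complex \<xi> \<omega>) - g \<omega>))) \<longlongrightarrow> ennreal 0) (at_right 0)"
    by (intro tendsto_ennrealI assms)
  then show "((\<lambda>\<xi>. \<integral>\<^sup>+\<omega>. ennreal ((cmod (f (Complex \<xi> \<omega>) - g \<omega>))\<^sup>2) \<partial>lborel) \<longlongrightarrow> 0) (at_right 0)"
    using tendsto_cong[OF ev] by simp
qed (rule assms)

lemma bdry_cong:
  assumes "\<And>s. s \<in> right_half_plane \<Longrightarrow> f s = f' s" "bdry f g"
  shows "bdry f' g"
proof -
  have ev: "\<forall>\<^sub>F \<xi> in at_right 0. (\<integral>\<^sup>+\<omega>. ennreal ((cmod (f (Complex \<xi> \<omega>) - g \<omega>))\<^sup>2) \<partial>lborel) = (\<integral>\<^sup>+\<omega>. ennreal ((cmod (f' (Complex \<xi> \<omega>) - g \<omega>))\<^sup>2) \<partial>lborel)"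
    using eventually_at_right_less[of 0] by eventually_elim (simp add: assms(1))
  show ?thesis using assms(2) tendsto_cong[OF ev] by (simp add: bdry_def)
qed

lemma bdry_lincomb:
  assumes f: "hardy_bound f M" "hardy_bound f' M'" and g: "bdry f g" "bdry f' g'"
  shows "bdry (\<lambda>s. a * f s + b * f' s) (\<lambda>\<omega>. a * g \<omega> + b * g' \<omega>)"
proof (rule bdry_of_l2sq_tendsto)
  note L = bdry_L2[OF f(1) g(1)] bdry_L2[OF f(2) g(2)]
  show "(\<lambda>\<omega>. a * g \<omega> + b * g' \<omega>) \<in> borel_measurable lborel"
    by (intro L2_measurable L2_add L2_cmult L)
  have eq: "(a * f (Complex \<xi> \<omega>) + b * f' (Complex \<xi> \<omega>)) - (a * g \<omega> + b * g' \<omega>) =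
     a * (f (Complex \<xi> \<omega>) - g \<omega>) + b * (f' (Complex \<xi> \<omega>) - g' \<omega>)" for \<xi> \<omega>
    by (simp add: algebra_simps)
  have L': "L2 (\<lambda>\<omega>. a * (f (Complex \<xi> \<omega>) - g \<omega>))" "L2 (\<lambda>\<omega>. b * (f' (Complex \<xi> \<omega>) - g' \<omega>))" if "\<xi> > 0" for \<xi>
    using that by (auto intro!: L2_cmult L2_diff L hardy_L2[OF f(1)] hardy_L2[OF f(2)])
  show "L2 (\<lambda>\<omega>. (a * f (Complex \<xi> \<omega>) + b * f' (Complex \<xi> \<omega>)) - (a * g \<omega> + b * g' \<omega>))" if "\<xi> > 0" for \<xi>
    unfolding eq by (intro L2_add L'[OF that])
  have "((\<lambda>\<xi>. 2 * ((cmod a)\<^sup>2 * l2sq (\<lambda>\<omega>. f (Complex \<xi> \<omega>) - g \<omega>)) + 2 * ((cmod b)\<^sup>2 * l2sq (\<lambda>\<omega>. f' (Complex \<xi> \<omega>) - g' \<omega>)))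
      \<longlongrightarrow> 2 * ((cmod a)\<^sup>2 * 0) + 2 * ((cmod b)\<^sup>2 * 0)) (at_right 0)"
    by (intro tendsto_intros bdry_l2sq_tendsto[OF f(1)] bdry_l2sq_tendsto[OF f(2)] g)
  then have lim: "((\<lambda>\<xi>. 2 * ((cmod a)\<^sup>2 * l2sq (\<lambda>\<omega>. f (Complex \<xi> \<omega>) - g \<omega>)) + 2 * ((cmod b)\<^sup>2 * l2sq (\<lambda>\<omega>. f' (Complex \<xi> \<omega>) - g' \<omega>)))
      \<longlongrightarrow> 0) (at_right 0)" by simp
  show "((\<lambda>\<xi>. l2sq (\<lambda>\<omega>. (a * f (Complex \<xi> \<omega>) + b * f' (Complex \<xi> \<omega>)) - (a * g \<omega> + b * g' \<omega>))) \<longlongrightarrow> 0) (at_right 0)"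
  proof (rule Lim_null_comparison[OF _ lim])
    show "\<forall>\<^sub>F \<xi> in at_right 0. norm (l2sq (\<lambda>\<omega>. (a * f (Complex \<xi> \<omega>) + b * f' (Complex \<xi> \<omega>)) - (a * g \<omega> + b * g' \<omega>))) \<le>
      2 * ((cmod a)\<^sup>2 * l2sq (\<lambda>\<omega>. f (Complex \<xi> \<omega>) - g \<omega>)) + 2 * ((cmod b)\<^sup>2 * l2sq (\<lambda>\<omega>. f' (Complex \<xi> \<omega>) - g' \<omega>))"
      using eventually_at_right_less
    proof eventually_elim
      case (elim \<xi>)
      show ?case unfolding eq using L2_add(2)[OF L'[OF elim]] by (simp only: l2sq_cmult real_norm_def abs_of_nonneg[OF l2sq_nonneg])
    qed
  qed
qed

lemma hardy_bound_lincomb: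
  assumes f: "hardy_bound f M" "hardy_bound f' M'"
  shows "hardy_bound (\<lambda>s. a * f s + b * f' s) (2 * ((cmod a)\<^sup>2 * M) + 2 * ((cmod b)\<^sup>2 * M'))"
  unfolding hardy_bound_def
proof (intro conjI allI impI)
  show "(\<lambda>s. a * f s + b * f' s) holomorphic_on right_half_plane"
    using f by (auto simp: hardy_bound_def intro!: holomorphic_intros)
  show "0 \<le> 2 * ((cmod a)\<^sup>2 * M) + 2 * ((cmod b)\<^sup>2 * M')" using f by (auto simp: hardy_bound_def)
  fix \<xi> :: real assume xi: "\<xi> > 0"
  have L': "L2 (\<lambda>\<omega>. a * f (Complex \<xi> \<omega>))" "L2 (\<lambda>\<omega>. b * f' (Complex \<xi> \<omega>))"
    using xi by (auto intro!: L2_cmult hardy_L2[OF f(1)] hardy_L2[OF f(2)])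
  have "l2sq (\<lambda>\<omega>. a * f (Complex \<xi> \<omega>) + b * f' (Complex \<xi> \<omega>)) \<le> 2 * ((cmod a)\<^sup>2 * l2sq (\<lambda>\<omega>. f (Complex \<xi> \<omega>))) + 2 * ((cmod b)\<^sup>2 * l2sq (\<lambda>\<omega>. f' (Complex \<xi> \<omega>)))"
    using L2_add(2)[OF L'] by (simp only: l2sq_cmult)
  also have "\<dots> \<le> 2 * ((cmod a)\<^sup>2 * M) + 2 * ((cmod b)\<^sup>2 * M')"
    using hardy_L2(2)[OF f(1) xi] hardy_L2(2)[OF f(2) xi] by (intro add_mono mult_left_mono) auto
  finally show "(\<integral>\<^sup>+\<omega>. ennreal ((cmod (a * f (Complex \<xi> \<omega>) + b * f' (Complex \<xi> \<omega>)))\<^sup>2) \<partial>lborel) \<le> ennreal (2 * ((cmod a)\<^sup>2 * M) + 2 * ((cmod b)\<^sup>2 * M'))"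
    by (subst L2_nn_integral[OF L2_add(1)[OF L']]) (rule ennreal_leI)
qed

lemma nn_integral_inverse_1_plus_square:
  "(\<integral>\<^sup>+y. ennreal (1 / (1 + y\<^sup>2)) \<partial>lborel) \<le> ennreal pi"
proof -
  have half: "(\<integral>\<^sup>+y. ennreal (1 / (1 + y\<^sup>2)) * indicator {0..} y \<partial>lborel) = ennreal (pi/2 - arctan 0)"
  proof (rule nn_integral_FTC_atLeast)
    fix y :: real
    show "(arctan has_real_derivative 1 / (1 + y\<^sup>2)) (at y)"
      using DERIV_arctan[of y] by (simp add: inverse_eq_divide)
    show "0 \<le> 1 / (1 + y\<^sup>2)" by simp
  qed (auto simp: tendsto_arctan_at_top)
  have "(\<integral>\<^sup>+y. ennreal (1 / (1 + (-y)\<^sup>2)) * indicator {0..} (-y) \<partial>lborel) = (\<integral>\<^sup>+y. ennreal (1 / (1 + y\<^sup>2)) * indicator {0..} y \<partial>lborel)"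
    using nn_integral_real_affine[of "\<lambda>y. ennreal (1 / (1 + y\<^sup>2)) * indicator {0..} y" "-1" 0] by simp
  note half' = this[unfolded half]
  have "(\<integral>\<^sup>+y. ennreal (1 / (1 + y\<^sup>2)) \<partial>lborel) \<le> (\<integral>\<^sup>+y. ennreal (1 / (1 + y\<^sup>2)) * indicator {0..} y + ennreal (1 / (1 + (-y)\<^sup>2)) * indicator {0..} (-y) \<partial>lborel)"
    by (intro nn_integral_mono) (auto simp: indicator_def)
  also have "\<dots> = ennreal (pi/2 - arctan 0) + ennreal (pi/2 - arctan 0)"
    by (subst nn_integral_add) (auto simp: half half'[simplified])
  also have "\<dots> = ennreal pi" by (simp flip: ennreal_plus)
  finally show ?thesis .
qed

section \<open>Cauchy formulas\<close>

text \<open>The Cauchy kernel \<open>1 / (s - \<mu>)\<close> on the vertical line at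
  \<open>x\<close>. It has two uses: with \<mu> in the left half-plane it is a Hardy function, with
  \<mu> to the right of the line it reproduces values at \<mu>.\<close>

definition pole_fun :: "complex \<Rightarrow> real \<Rightarrow> real \<Rightarrow> complex" where
  "pole_fun \<mu> x \<omega> = 1 / (Complex x \<omega> - \<mu>)"

lemma pole_fun_measurable [measurable]: "pole_fun \<mu> x \<in> borel_measurable borel"
proof -
  have [measurable]: "Complex x \<in> borel_measurable borel"
    by (intro borel_measurable_continuous_onI continuous_intros)
  show ?thesis unfolding pole_fun_def by measurable
qed

text \<open>Centring at \<open>Im \<mu>\<close> and rescaling by the distance \<open>d\<close> from
  \<mu> to the line turns the squared modulus into \<open>1 / (1 + y^2)\<close>, up to the factor
  \<open>1 / d\<close>.\<close>

lemma pole_fun_L2: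
  assumes "x \<noteq> Re \<mu>"
  shows "L2 (pole_fun \<mu> x)" "l2sq (pole_fun \<mu> x) \<le> pi / \<bar>x - Re \<mu>\<bar>"
proof -
  define d where "d = \<bar>x - Re \<mu>\<bar>"
  have d: "d > 0" using assms by (simp add: d_def)
  have "(\<integral>\<^sup>+\<omega>. ennreal ((cmod (pole_fun \<mu> x \<omega>))\<^sup>2) \<partial>lborel) = ennreal d * (\<integral>\<^sup>+y. ennreal ((cmod (pole_fun \<mu> x (Im \<mu> + d * y)))\<^sup>2) \<partial>lborel)"
    using nn_integral_real_affine[of "\<lambda>\<omega>. ennreal ((cmod (pole_fun \<mu> x \<omega>))\<^sup>2)" d "Im \<mu>"] d by simp
  also have "(\<lambda>y. ennreal ((cmod (pole_fun \<mu> x (Im \<mu> + d * y)))\<^sup>2)) = (\<lambda>y. ennreal (1 / d\<^sup>2) * ennreal (1 / (1 + y\<^sup>2)))"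
  proof
    fix y
    have "(cmod (Complex x (Im \<mu> + d * y) - \<mu>))\<^sup>2 = d\<^sup>2 * (1 + y\<^sup>2)"
      by (simp add: cmod_power2 d_def power_mult_distrib algebra_simps)
    then have "(cmod (pole_fun \<mu> x (Im \<mu> + d * y)))\<^sup>2 = 1 / d\<^sup>2 * (1 / (1 + y\<^sup>2))"
      by (simp add: pole_fun_def norm_divide power_divide)
    then show "ennreal ((cmod (pole_fun \<mu> x (Im \<mu> + d * y)))\<^sup>2) = ennreal (1 / d\<^sup>2) * ennreal (1 / (1 + y\<^sup>2))"
      by (simp only: ennreal_mult'' divide_nonneg_nonneg zero_le_one add_nonneg_nonneg zero_le_power2)
  qed
  also have "ennreal d * (\<integral>\<^sup>+y. ennreal (1 / d\<^sup>2) * ennreal (1 / (1 + y\<^sup>2)) \<partial>lborel) = ennreal d * (ennreal (1 / d\<^sup>2) * (\<integral>\<^sup>+y. ennreal (1 / (1 + y\<^sup>2)) \<partial>lborel))"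
    by (subst nn_integral_cmult) auto
  also have "\<dots> \<le> ennreal d * (ennreal (1 / d\<^sup>2) * ennreal pi)"
    by (intro mult_left_mono nn_integral_inverse_1_plus_square) auto
  also have "\<dots> = ennreal (pi / d)"
    using d by (simp flip: ennreal_mult add: power2_eq_square)
  finally have *: "(\<integral>\<^sup>+\<omega>. ennreal ((cmod (pole_fun \<mu> x \<omega>))\<^sup>2) \<partial>lborel) \<le> ennreal (pi / d)" .
  show "L2 (pole_fun \<mu> x)" "l2sq (pole_fun \<mu> x) \<le> pi / \<bar>x - Re \<mu>\<bar>"
    using L2_of_nn_integral_le[OF _ *] d by (auto simp: d_def)
qed

text \<open>Every rectangle of half-height above \<open>K\<close> winds once around
  \<open>s0\<close>, so \<open>vertical_line_jump\<close> applies with \<open>J\<close> equal to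
  \<open>2 pi i f(s0)\<close>.\<close>

lemma Cauchy_line_jump:
  fixes f :: "complex \<Rightarrow> complex" and s0 :: complex
  assumes f: "hardy_bound f M" and s0: "0 < \<xi>" "\<xi> < Re s0" "Re s0 < T"
  shows "(LINT \<omega>|lborel. pole_fun s0 T \<omega> * f (Complex T \<omega>)) - (LINT \<omega>|lborel. pole_fun s0 \<xi> \<omega> * f (Complex \<xi> \<omega>)) = 2 * pi * f s0"
proof -
  define h where "h z = f z / (z - s0)" for z
  \<comment> \<open>The extra 1 keeps all heights beyond \<open>K\<close> at distance at least 1
    from \<open>s0\<close>, on whichever vertical line, including the one through
    \<open>s0\<close>.\<close>
  define K where "K = \<bar>Im s0\<bar> + 1"
  have K: "K \<ge> 0" by (simp add: K_def)
  have hol: "f holomorphic_on right_half_plane" using f by (simp add: hardy_bound_def)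
  have fc: "continuous_on right_half_plane f" using hol by (rule holomorphic_on_imp_continuous_on)
  have s0R: "s0 \<in> right_half_plane" using s0 by (simp add: right_half_plane_def)
  have line: "h (Complex x \<omega>) = pole_fun s0 x \<omega> * f (Complex x \<omega>)" for x \<omega>
    by (simp add: h_def pole_fun_def)
  have far: "z \<noteq> s0" if "Re z = \<xi> \<or> Re z = T \<or> \<bar>Im z\<bar> > K" for z
    using that s0 by (auto simp: K_def)
  have "\<i> * ((LINT \<omega>|lborel. h (Complex T \<omega>)) - (LINT \<omega>|lborel. h (Complex \<xi> \<omega>))) = 2 * pi * \<i> * f s0"
  proof (rule vertical_line_jump[where K = K and M = "M + 4 * pi"])
    show "\<xi> < T" using s0 by simp
    show "K \<ge> 0" by fact
    show "(h has_contour_integral 2 * pi * \<i> * f s0) (rectpath (Complex \<xi> (-R)) (Complex T R))" if R: "R > K" for R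
    proof -
      have box: "s0 \<in> box (Complex \<xi> (-R)) (Complex T R)"
        using s0 R by (auto simp: in_box_complex_iff K_def)
      have img: "path_image (rectpath (Complex \<xi> (-R)) (Complex T R)) \<subseteq> right_half_plane - {s0}"
      proof -
        have "path_image (rectpath (Complex \<xi> (-R)) (Complex T R)) \<subseteq> cbox (Complex \<xi> (-R)) (Complex T R)"
          using s0 R K by (intro path_image_rectpath_subset_cbox) auto
        moreover have "path_image (rectpath (Complex \<xi> (-R)) (Complex T R)) \<inter> box (Complex \<xi> (-R)) (Complex T R) = {}"
          using s0 R K by (intro path_image_rectpath_inter_box) auto
        ultimately show ?thesis using box s0 by (auto simp: in_cbox_complex_iff right_half_plane_def)
      qed
      have "((\<lambda>w. f w / (w - s0)) has_contour_integral complex_of_real (2 * pi) * \<i> * winding_number (rectpath (Complex \<xi> (-R)) (Complex T R)) s0 * f s0)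
         (rectpath (Complex \<xi> (-R)) (Complex T R))"
        by (rule Cauchy_integral_formula_convex_simple[OF _ hol]) (use img s0R in \<open>auto simp: interior_open\<close>)
      then show ?thesis by (simp add: winding_number_rectpath[OF box] h_def[abs_def])
    qed
    show "continuous_on {z. \<xi> \<le> Re z \<and> Re z \<le> T \<and> (Re z = \<xi> \<or> Re z = T \<or> \<bar>Im z\<bar> > K)} h"
      unfolding h_def
      by (intro continuous_intros continuous_on_subset[OF fc]) (use far s0 in \<open>auto simp: right_half_plane_def\<close>)
    show "integrable lborel (\<lambda>\<omega>. h (Complex \<xi> \<omega>))" "integrable lborel (\<lambda>\<omega>. h (Complex T \<omega>))"
      unfolding line using s0 by (auto intro!: L2_mult_integrable pole_fun_L2 hardy_L2[OF f])
    have "(\<lambda>(x, \<omega>). indicator {\<xi>..T} x * f (Complex x \<omega>)) \<in> borel_measurable (lborel \<Otimes>\<^sub>M lborel)"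
      by (rule strip_measurable, rule continuous_on_subset[OF fc]) (use s0 in \<open>auto simp: right_half_plane_def\<close>)
    moreover have "(\<lambda>(x, \<omega>). Complex x \<omega> - s0) \<in> borel_measurable (lborel \<Otimes>\<^sub>M lborel)"
    proof -
      have "(\<lambda>p. Complex (fst p) (snd p) - s0) \<in> borel_measurable (borel :: (real \<times> real) measure)"
        by (intro borel_measurable_continuous_onI) (auto simp: Complex_eq intro!: continuous_intros)
      also have "borel_measurable borel = borel_measurable (lborel \<Otimes>\<^sub>M (lborel :: real measure))"
        unfolding lborel_prod by simp
      finally show ?thesis by (simp add: case_prod_beta)
    qed
    ultimately have "(\<lambda>p. (case p of (x, \<omega>) \<Rightarrow> indicator {\<xi>..T} x * f (Complex x \<omega>)) / (case p of (x, \<omega>) \<Rightarrow> Complex x \<omega> - s0)) \<in> borel_measurable (lborel \<Otimes>\<^sub>M lborel)"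
      by (rule borel_measurable_divide)
    then show "(\<lambda>(x, \<omega>). indicator {\<xi>..T} x * h (Complex x \<omega>)) \<in> borel_measurable (lborel \<Otimes>\<^sub>M lborel)"
      by (simp add: h_def case_prod_beta)
    fix x assume x: "x \<in> {\<xi>..T}"
    define k where "k \<omega> = (if \<bar>\<omega>\<bar> > K then pole_fun s0 x \<omega> else 0)" for \<omega>
    \<comment> \<open>A bound uniform in \<open>x\<close>: with \<open>t = \<omega> - Im s0\<close>
      and \<open>|t| >= 1\<close> one has \<open>1 + t^2 <= 4 ((x - Re s0)^2 + t^2)\<close>. The
      comparison kernel lies on the line at distance 1 from \<open>s0\<close>, which is where
      \<open>4 * pi\<close> comes from.\<close>
    have le: "cmod (k \<omega>) \<le> cmod (2 * pole_fun s0 (Re s0 + 1) \<omega>)" for \<omega>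
    proof (cases "\<bar>\<omega>\<bar> > K")
      case True
      then have 1: "\<bar>\<omega> - Im s0\<bar> \<ge> 1" by (auto simp: K_def)
      then have "(\<omega> - Im s0)\<^sup>2 \<ge> 1" using abs_le_square_iff[of 1 "\<omega> - Im s0"] by simp
      then have "(cmod (Complex (Re s0 + 1) \<omega> - s0))\<^sup>2 \<le> (2 * cmod (Complex x \<omega> - s0))\<^sup>2"
        by (simp add: cmod_power2 power_mult_distrib)
           (smt (verit) zero_le_power2)
      then have "cmod (Complex (Re s0 + 1) \<omega> - s0) \<le> 2 * cmod (Complex x \<omega> - s0)"
        by (rule power2_le_imp_le) simp
      moreover have "cmod (Complex (Re s0 + 1) \<omega> - s0) > 0" "cmod (Complex x \<omega> - s0) > 0"
        using 1 by (auto simp: complex_eq_iff)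
      ultimately show ?thesis using True by (auto simp: k_def pole_fun_def norm_divide norm_mult field_simps)
    qed (simp add: k_def)
    have "k = (\<lambda>\<omega>. indicator {\<omega>. \<bar>\<omega>\<bar> > K} \<omega> * pole_fun s0 x \<omega>)" by (auto simp: k_def fun_eq_iff)
    also have "\<dots> \<in> borel_measurable lborel" by measurable
    finally have km: "k \<in> borel_measurable lborel" .
    have kL: "L2 k" "l2sq k \<le> 4 * pi"
    proof -
      have L: "L2 (\<lambda>\<omega>. 2 * pole_fun s0 (Re s0 + 1) \<omega>)" by (intro L2_cmult pole_fun_L2) simp
      show "L2 k" by (rule L2_dominated[OF L km le])
      have "l2sq k \<le> l2sq (\<lambda>\<omega>. 2 * pole_fun s0 (Re s0 + 1) \<omega>)" by (rule L2_dominated[OF L km le])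
      also have "\<dots> \<le> 4 * pi" using pole_fun_L2(2)[of "Re s0 + 1" s0] by (subst l2sq_cmult) simp
      finally show "l2sq k \<le> 4 * pi" .
    qed
    have fL: "L2 (\<lambda>\<omega>. f (Complex x \<omega>))" "l2sq (\<lambda>\<omega>. f (Complex x \<omega>)) \<le> M"
      using x s0 by (auto intro!: hardy_L2[OF f])
    have "(\<integral>\<^sup>+\<omega>. indicator {\<omega>. K < \<bar>\<omega>\<bar>} \<omega> * ennreal (cmod (h (Complex x \<omega>))) \<partial>lborel) = (\<integral>\<^sup>+\<omega>. ennreal (cmod (k \<omega> * f (Complex x \<omega>))) \<partial>lborel)"
      by (intro nn_integral_cong) (auto simp: k_def line)
    also have "\<dots> \<le> ennreal (l2sq k + l2sq (\<lambda>\<omega>. f (Complex x \<omega>)))"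
      by (intro L2_nn_integral_mult_le kL fL)
    also have "\<dots> \<le> ennreal (M + 4 * pi)" using kL fL by (intro ennreal_leI) auto
    finally show "(\<integral>\<^sup>+\<omega>. indicator {\<omega>. K < \<bar>\<omega>\<bar>} \<omega> * ennreal (cmod (h (Complex x \<omega>))) \<partial>lborel) \<le> ennreal (M + 4 * pi)" .
  qed
  then show ?thesis by (simp add: line)
qed

text \<open>The right-hand line of \<open>Cauchy_line_jump\<close> is pushed to infinity: by
  Cauchy-Schwarz the square of its integral is at most \<open>pi M / (T - Re s0)\<close>.\<close>

lemma Cauchy_line:
  fixes f :: "complex \<Rightarrow> complex" and s0 :: complex
  assumes f: "hardy_bound f M" and s0: "0 < \<xi>" "\<xi> < Re s0"
  shows "(LINT \<omega>|lborel. pole_fun s0 \<xi> \<omega> * f (Complex \<xi> \<omega>)) = - 2 * pi * f s0"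
proof -
  define N where "N = norm ((LINT \<omega>|lborel. pole_fun s0 \<xi> \<omega> * f (Complex \<xi> \<omega>)) + 2 * pi * f s0)"
  have le: "N\<^sup>2 \<le> pi / (T - Re s0) * M" if T: "T > Re s0" for T
  proof -
    have "(LINT \<omega>|lborel. pole_fun s0 T \<omega> * f (Complex T \<omega>)) = (LINT \<omega>|lborel. pole_fun s0 \<xi> \<omega> * f (Complex \<xi> \<omega>)) + 2 * pi * f s0"
      using Cauchy_line_jump[OF f s0 T] by (simp add: algebra_simps)
    then have "N\<^sup>2 = (norm (LINT \<omega>|lborel. pole_fun s0 T \<omega> * f (Complex T \<omega>)))\<^sup>2" by (simp add: N_def)
    also have "\<dots> \<le> l2sq (pole_fun s0 T) * l2sq (\<lambda>\<omega>. f (Complex T \<omega>))"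
      using T s0 by (intro L2_Cauchy_Schwarz pole_fun_L2 hardy_L2[OF f]) auto
    also have "\<dots> \<le> pi / (T - Re s0) * M"
      using pole_fun_L2(2)[of T s0] hardy_L2(2)[OF f, of T] T s0 by (intro mult_mono) auto
    finally show ?thesis .
  qed
  have "((\<lambda>T. pi / (T - Re s0) * M) \<longlongrightarrow> 0 * M) at_top"
    by (intro tendsto_intros tendsto_divide_0[OF tendsto_const] filterlim_at_top_imp_at_infinity filterlim_tendsto_add_at_top[of "\<lambda>_. - Re s0", simplified] filterlim_ident)
      (auto intro!: filterlim_tendsto_add_at_top[OF tendsto_const filterlim_ident, of "- Re s0", simplified])
  then have "N\<^sup>2 \<le> 0 * M"
    by (rule tendsto_lowerbound[OF _ eventually_mono[OF eventually_gt_at_top[of "Re s0"] le]]) simp_all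
  then have "N = 0" by simp
  then show ?thesis by (simp add: N_def add_eq_0_iff)
qed

text \<open>Moving the line and the evaluation point by the same \<xi> leaves the kernel unchanged.
  Hence only \<open>f\<close> varies under the integral, and convergence in the mean towards
  \<open>g\<close> passes to the limit.\<close>

lemma Cauchy_boundary:
  fixes f :: "complex \<Rightarrow> complex" and s0 :: complex
  assumes f: "hardy_bound f M" and g: "bdry f g" and s0: "Re s0 > 0"
  shows "(LINT \<omega>|lborel. pole_fun s0 0 \<omega> * g \<omega>) = - 2 * pi * f s0"
proof -
  have kL: "L2 (pole_fun s0 0)" using s0 by (intro pole_fun_L2) simp
  have ev: "\<forall>\<^sub>F \<xi> in at_right 0. L2 (\<lambda>\<omega>. f (Complex \<xi> \<omega>))"
    using eventually_at_right_less by eventually_elim (rule hardy_L2[OF f])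
  have 1: "((\<lambda>\<xi>. LINT \<omega>|lborel. pole_fun s0 0 \<omega> * f (Complex \<xi> \<omega>)) \<longlongrightarrow> (LINT \<omega>|lborel. pole_fun s0 0 \<omega> * g \<omega>)) (at_right 0)"
    by (rule L2_integral_tendsto[OF ev bdry_L2[OF f g] kL bdry_l2sq_tendsto[OF f g]])
  have "\<forall>\<^sub>F \<xi> in at_right 0. - 2 * pi * f (s0 + of_real \<xi>) = (LINT \<omega>|lborel. pole_fun s0 0 \<omega> * f (Complex \<xi> \<omega>))"
    using eventually_at_right_less
  proof eventually_elim
    case (elim \<xi>)
    have "pole_fun s0 0 \<omega> = pole_fun (s0 + of_real \<xi>) \<xi> \<omega>" for \<omega>
    proof -
      have "Complex 0 \<omega> - s0 = Complex \<xi> \<omega> - (s0 + of_real \<xi>)" by (simp add: complex_eq_iff)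
      then show ?thesis by (simp only: pole_fun_def)
    qed
    then show ?case using Cauchy_line[OF f elim, of "s0 + of_real \<xi>"] s0 by simp
  qed
  moreover have "((\<lambda>\<xi>. - 2 * pi * f (s0 + of_real \<xi>)) \<longlongrightarrow> - 2 * pi * f (s0 + of_real 0)) (at_right 0)"
  proof (intro tendsto_intros)
    have "continuous_on right_half_plane f"
      using f by (intro holomorphic_on_imp_continuous_on) (simp add: hardy_bound_def)
    then have "isCont f s0" using s0 by (simp add: continuous_on_eq_continuous_at right_half_plane_def open_right_half_plane[unfolded right_half_plane_def])
    moreover have "((\<lambda>\<xi>. s0 + of_real \<xi>) \<longlongrightarrow> s0 + of_real 0) (at_right 0)" by (intro tendsto_intros)
    ultimately show "((\<lambda>\<xi>. f (s0 + of_real \<xi>)) \<longlongrightarrow> f (s0 + of_real 0)) (at_right 0)"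
      by (intro isCont_tendsto_compose[of _ f]) simp_all
  qed
  ultimately have "((\<lambda>\<xi>. LINT \<omega>|lborel. pole_fun s0 0 \<omega> * f (Complex \<xi> \<omega>)) \<longlongrightarrow> - 2 * pi * f (s0 + of_real 0)) (at_right 0)"
    by (rule Lim_transform_eventually[rotated])
  with 1 show ?thesis using tendsto_unique[of "at_right (0::real)"] by auto
qed

text \<open>The difference quotient of \<open>Cauchy_boundary\<close> in the point: the difference
  of the kernels at \<open>s n\<close> and \<open>s0\<close> is \<open>e n\<close> times their
  product. Since the points move to the right, the kernels stay below \<open>1 / Re s0\<close>,
  which dominates the limit.\<close>

lemma Cauchy_boundary_deriv:
  fixes f :: "complex \<Rightarrow> complex" and s0 :: complex
  assumes f: "hardy_bound f M" and g: "bdry f g" and s0: "Re s0 > 0"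
  shows "(LINT \<omega>|lborel. (pole_fun s0 0 \<omega>)\<^sup>2 * g \<omega>) = - 2 * pi * deriv f s0"
proof -
  note gL = bdry_L2[OF f g]
  have kL: "L2 (pole_fun s 0)" if "Re s > 0" for s using that by (intro pole_fun_L2) simp
  have gm[measurable]: "g \<in> borel_measurable lborel" using gL by (rule L2_measurable)
  define e where "e n = 1 / real (Suc n)" for n
  have e0: "e n > 0" for n by (simp add: e_def)
  have elim0: "e \<longlonglongrightarrow> 0" unfolding e_def by (rule LIMSEQ_Suc[OF lim_1_over_n])
  define s where "s n = s0 + of_real (e n)" for n
  have sRe: "Re (s n) > 0" "Re (s n) \<ge> Re s0" for n using s0 e0[of n] by (auto simp: s_def)
  have ne: "Complex 0 \<omega> - z \<noteq> 0" if "Re z > 0" for z \<omega> using that by (auto simp: complex_eq_iff)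
  have bound: "cmod (pole_fun z 0 \<omega>) \<le> 1 / Re s0" if "Re z \<ge> Re s0" for z \<omega>
  proof -
    have "Re s0 \<le> cmod (Complex 0 \<omega> - z)" using abs_Re_le_cmod[of "Complex 0 \<omega> - z"] that s0 by simp
    then show ?thesis using s0 by (simp add: pole_fun_def norm_divide frac_le)
  qed
  have prod: "pole_fun (s n) 0 \<omega> * pole_fun s0 0 \<omega> = (pole_fun (s n) 0 \<omega> - pole_fun s0 0 \<omega>) / of_real (e n)" for n \<omega>
    using ne[OF s0, of \<omega>] ne[OF sRe(1)[of n], of \<omega>] e0[of n]
    by (simp add: pole_fun_def divide_simps) (simp add: s_def algebra_simps)
  have eq: "(LINT \<omega>|lborel. pole_fun (s n) 0 \<omega> * pole_fun s0 0 \<omega> * g \<omega>) = - 2 * pi * ((f (s n) - f s0) / of_real (e n))" for n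
  proof -
    have "(LINT \<omega>|lborel. pole_fun (s n) 0 \<omega> * pole_fun s0 0 \<omega> * g \<omega>) = (LINT \<omega>|lborel. (pole_fun (s n) 0 \<omega> * g \<omega> - pole_fun s0 0 \<omega> * g \<omega>) / of_real (e n))"
      unfolding prod by (intro Bochner_Integration.integral_cong refl) (simp add: algebra_simps diff_divide_distrib)
    also have "\<dots> = ((LINT \<omega>|lborel. pole_fun (s n) 0 \<omega> * g \<omega>) - (LINT \<omega>|lborel. pole_fun s0 0 \<omega> * g \<omega>)) / of_real (e n)"
      using L2_mult_integrable[OF kL[OF sRe(1)] gL] L2_mult_integrable[OF kL[OF s0] gL] by simp
    also have "\<dots> = - 2 * pi * ((f (s n) - f s0) / of_real (e n))"
      using Cauchy_boundary[OF f g sRe(1)[of n]] Cauchy_boundary[OF f g s0] by (simp add: algebra_simps diff_divide_distrib)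
    finally show ?thesis .
  qed
  have s_lim: "s \<longlonglongrightarrow> s0" unfolding s_def using tendsto_add[OF tendsto_const tendsto_of_real[OF elim0], of s0] by simp
  have lim1: "(\<lambda>n. LINT \<omega>|lborel. pole_fun (s n) 0 \<omega> * pole_fun s0 0 \<omega> * g \<omega>) \<longlonglongrightarrow> (LINT \<omega>|lborel. (pole_fun s0 0 \<omega>)\<^sup>2 * g \<omega>)"
  proof (rule integral_dominated_convergence[where w = "\<lambda>\<omega>. 1 / Re s0 * norm (pole_fun s0 0 \<omega> * g \<omega>)"])
    show "integrable lborel (\<lambda>\<omega>. 1 / Re s0 * norm (pole_fun s0 0 \<omega> * g \<omega>))"
      using L2_mult_integrable[OF kL[OF s0] gL] by (intro integrable_mult_right integrable_norm)
    show "AE \<omega> in lborel. (\<lambda>n. pole_fun (s n) 0 \<omega> * pole_fun s0 0 \<omega> * g \<omega>) \<longlonglongrightarrow> (pole_fun s0 0 \<omega>)\<^sup>2 * g \<omega>"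
    proof (rule AE_I2)
      fix \<omega>
      have "(\<lambda>n. pole_fun (s n) 0 \<omega>) \<longlonglongrightarrow> pole_fun s0 0 \<omega>"
        unfolding pole_fun_def using ne[OF s0] by (intro tendsto_intros s_lim)
      then show "(\<lambda>n. pole_fun (s n) 0 \<omega> * pole_fun s0 0 \<omega> * g \<omega>) \<longlonglongrightarrow> (pole_fun s0 0 \<omega>)\<^sup>2 * g \<omega>"
        unfolding power2_eq_square by (intro tendsto_intros)
    qed
    show "AE \<omega> in lborel. norm (pole_fun (s n) 0 \<omega> * pole_fun s0 0 \<omega> * g \<omega>) \<le> 1 / Re s0 * norm (pole_fun s0 0 \<omega> * g \<omega>)" for n
      using bound[OF sRe(2)] by (intro AE_I2) (simp only: norm_mult mult.assoc mult_right_mono mult_nonneg_nonneg norm_ge_zero)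
  qed measurable
  have "f field_differentiable (at s0)"
    using f s0 by (intro holomorphic_on_imp_differentiable_at[of f right_half_plane]) (auto simp: hardy_bound_def right_half_plane_def open_right_half_plane[unfolded right_half_plane_def])
  then have "(f has_field_derivative deriv f s0) (at s0)"
    by (simp add: field_differentiable_derivI)
  then have "((\<lambda>h. (f (s0 + h) - f s0) / h) \<longlongrightarrow> deriv f s0) (at 0)"
    by (simp add: DERIV_def)
  moreover have "filterlim (\<lambda>n. complex_of_real (e n)) (at 0) sequentially"
    unfolding filterlim_at using tendsto_of_real[OF elim0, where 'a=complex] e0 by (auto simp: less_imp_neq[THEN not_sym])
  ultimately have "(\<lambda>n. (f (s n) - f s0) / of_real (e n)) \<longlonglongrightarrow> deriv f s0"
    unfolding s_def by (rule filterlim_compose)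
  then have "(\<lambda>n. - 2 * pi * ((f (s n) - f s0) / of_real (e n))) \<longlonglongrightarrow> - 2 * pi * deriv f s0"
    by (intro tendsto_intros)
  with lim1 show ?thesis unfolding eq by (rule LIMSEQ_unique)
qed

section \<open>Powers of the Cauchy kernel as Hardy functions\<close>

lemma norm_power_diff_le:
  fixes a b :: complex
  assumes "norm a \<le> B" "norm b \<le> B"
  shows "norm (a ^ n - b ^ n) \<le> real n * B ^ (n - 1) * norm (a - b)"
proof (induction n)
  case (Suc n)
  have B: "B \<ge> 0" using assms(1) norm_ge_zero[of a] by linarith
  have "a ^ Suc n - b ^ Suc n = a * (a ^ n - b ^ n) + (a - b) * b ^ n" by (simp add: algebra_simps)
  also have "norm \<dots> \<le> norm a * norm (a ^ n - b ^ n) + norm (a - b) * norm b ^ n"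
    by (intro order.trans[OF norm_triangle_ineq]) (simp add: norm_mult norm_power)
  also have "\<dots> \<le> B * (real n * B ^ (n - 1) * norm (a - b)) + norm (a - b) * B ^ n"
    using Suc assms B by (intro add_mono mult_mono power_mono) auto
  also have "\<dots> = real (Suc n) * B ^ (Suc n - 1) * norm (a - b)"
    by (cases n) (simp_all add: algebra_simps)
  finally show ?case .
qed simp

lemma pole_fun_bound:
  assumes "Re \<mu> < 0" "x \<ge> 0" shows "cmod (pole_fun \<mu> x \<omega>) \<le> 1 / \<bar>Re \<mu>\<bar>"
proof -
  have "\<bar>Re \<mu>\<bar> \<le> cmod (Complex x \<omega> - \<mu>)" using abs_Re_le_cmod[of "Complex x \<omega> - \<mu>"] assms by simp
  then have "1 / cmod (Complex x \<omega> - \<mu>) \<le> 1 / \<bar>Re \<mu>\<bar>"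
    using assms by (intro divide_left_mono mult_pos_pos) auto
  then show ?thesis by (simp only: pole_fun_def norm_divide norm_one)
qed

lemma pole_fun_antimono:
  assumes "Re \<mu> < 0" "x \<ge> 0" shows "cmod (pole_fun \<mu> x \<omega>) \<le> cmod (pole_fun \<mu> 0 \<omega>)"
proof -
  have "(cmod (Complex 0 \<omega> - \<mu>))\<^sup>2 \<le> (cmod (Complex x \<omega> - \<mu>))\<^sup>2"
    using assms by (simp add: cmod_power2 power_mono abs_le_square_iff[symmetric])
  then have "cmod (Complex 0 \<omega> - \<mu>) \<le> cmod (Complex x \<omega> - \<mu>)" by (rule power2_le_imp_le) simp
  moreover have "cmod (Complex 0 \<omega> - \<mu>) > 0" using assms by (auto simp: complex_eq_iff)
  ultimately show ?thesis by (simp add: pole_fun_def norm_divide frac_le)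
qed

text \<open>One factor carries the integrability; the remaining \<open>n\<close> are bounded by the
  inverse distance of \<mu> to the imaginary axis.\<close>

lemma pole_fun_power_L2:
  assumes "Re \<mu> < 0" "x \<ge> 0"
  shows "L2 (\<lambda>\<omega>. (pole_fun \<mu> x \<omega>) ^ Suc n)" "l2sq (\<lambda>\<omega>. (pole_fun \<mu> x \<omega>) ^ Suc n) \<le> ((1 / \<bar>Re \<mu>\<bar>) ^ n)\<^sup>2 * l2sq (pole_fun \<mu> 0)"
proof -
  let ?c = "(1 / \<bar>Re \<mu>\<bar>) ^ n"
  have L: "L2 (\<lambda>\<omega>. of_real ?c * pole_fun \<mu> 0 \<omega>)" using assms by (intro L2_cmult pole_fun_L2) simp
  have m: "(\<lambda>\<omega>. (pole_fun \<mu> x \<omega>) ^ Suc n) \<in> borel_measurable lborel" by measurable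
  have le: "cmod ((pole_fun \<mu> x \<omega>) ^ Suc n) \<le> cmod (of_real ?c * pole_fun \<mu> 0 \<omega>)" for \<omega>
  proof -
    have "cmod ((pole_fun \<mu> x \<omega>) ^ Suc n) = cmod (pole_fun \<mu> x \<omega>) ^ n * cmod (pole_fun \<mu> x \<omega>)"
      by (simp add: norm_mult norm_power)
    also have "\<dots> \<le> ?c * cmod (pole_fun \<mu> 0 \<omega>)"
      by (intro mult_mono power_mono pole_fun_bound pole_fun_antimono assms) auto
    finally show ?thesis by (simp add: norm_mult norm_power norm_divide)
  qed
  show "L2 (\<lambda>\<omega>. (pole_fun \<mu> x \<omega>) ^ Suc n)" by (rule L2_dominated[OF L m le])
  have "l2sq (\<lambda>\<omega>. (pole_fun \<mu> x \<omega>) ^ Suc n) \<le> l2sq (\<lambda>\<omega>. of_real ?c * pole_fun \<mu> 0 \<omega>)"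
    by (rule L2_dominated[OF L m le])
  also have "\<dots> = ?c\<^sup>2 * l2sq (pole_fun \<mu> 0)" by (subst l2sq_cmult) (simp add: norm_power norm_divide)
  finally show "l2sq (\<lambda>\<omega>. (pole_fun \<mu> x \<omega>) ^ Suc n) \<le> ?c\<^sup>2 * l2sq (pole_fun \<mu> 0)" .
qed

lemma pole_power_hardy:
  assumes mu: "Re \<mu> < 0"
  shows "hardy_bound (\<lambda>s. (1 / (s - \<mu>)) ^ Suc n) (((1 / \<bar>Re \<mu>\<bar>) ^ n)\<^sup>2 * l2sq (pole_fun \<mu> 0))"
  unfolding hardy_bound_def
proof (intro conjI allI impI)
  show "(\<lambda>s. (1 / (s - \<mu>)) ^ Suc n) holomorphic_on right_half_plane"
    using mu by (intro holomorphic_intros) (auto simp: right_half_plane_def)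
  fix \<xi> :: real assume "\<xi> > 0"
  then show "(\<integral>\<^sup>+\<omega>. ennreal ((cmod ((1 / (Complex \<xi> \<omega> - \<mu>)) ^ Suc n))\<^sup>2) \<partial>lborel) \<le> ennreal (((1 / \<bar>Re \<mu>\<bar>) ^ n)\<^sup>2 * l2sq (pole_fun \<mu> 0))"
    using pole_fun_power_L2[OF mu, of \<xi> n] by (subst L2_nn_integral) (auto simp: pole_fun_def intro!: ennreal_leI)
qed simp

text \<open>The kernels at abscissae \<xi> and 0 differ by \<xi> times their product, so the powers
  differ by at most a constant times \<xi> times the kernel on the imaginary axis.\<close>

lemma pole_power_bdry:
  assumes mu: "Re \<mu> < 0"
  shows "bdry (\<lambda>s. (1 / (s - \<mu>)) ^ Suc n) (\<lambda>\<omega>. (pole_fun \<mu> 0 \<omega>) ^ Suc n)"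
proof (rule bdry_of_l2sq_tendsto)
  show m: "(\<lambda>\<omega>. (pole_fun \<mu> 0 \<omega>) ^ Suc n) \<in> borel_measurable lborel" by measurable
  have line: "(1 / (Complex \<xi> \<omega> - \<mu>)) ^ Suc n = (pole_fun \<mu> \<xi> \<omega>) ^ Suc n" for \<xi> \<omega> by (simp add: pole_fun_def)
  show L: "L2 (\<lambda>\<omega>. (1 / (Complex \<xi> \<omega> - \<mu>)) ^ Suc n - (pole_fun \<mu> 0 \<omega>) ^ Suc n)" if "\<xi> > 0" for \<xi>
    unfolding line using that by (intro L2_diff pole_fun_power_L2 mu) auto
  define B where "B = 1 / \<bar>Re \<mu>\<bar>"
  have Bp: "B > 0" using mu by (simp add: B_def)
  have pb: "cmod (pole_fun \<mu> x \<omega>) \<le> B" if "x \<ge> 0" for x \<omega>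
    unfolding B_def by (rule pole_fun_bound[OF mu that])
  define c where "c = real (Suc n) * B ^ n * B"
  have le: "cmod ((pole_fun \<mu> \<xi> \<omega>) ^ Suc n - (pole_fun \<mu> 0 \<omega>) ^ Suc n) \<le> cmod (of_real (\<xi> * c) * pole_fun \<mu> 0 \<omega>)" if "\<xi> > 0" for \<xi> \<omega>
  proof -
    have nz: "Complex \<xi> \<omega> - \<mu> \<noteq> 0" "Complex 0 \<omega> - \<mu> \<noteq> 0" using mu that by (auto simp: complex_eq_iff)
    have d: "pole_fun \<mu> \<xi> \<omega> - pole_fun \<mu> 0 \<omega> = - of_real \<xi> * (pole_fun \<mu> \<xi> \<omega> * pole_fun \<mu> 0 \<omega>)"
    proof -
      have "Complex \<xi> \<omega> - \<mu> = of_real \<xi> + (Complex 0 \<omega> - \<mu>)" by (simp add: complex_eq_iff)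
      then show ?thesis using nz unfolding pole_fun_def by (simp add: field_simps)
    qed
    have "cmod ((pole_fun \<mu> \<xi> \<omega>) ^ Suc n - (pole_fun \<mu> 0 \<omega>) ^ Suc n) \<le> real (Suc n) * B ^ (Suc n - 1) * cmod (pole_fun \<mu> \<xi> \<omega> - pole_fun \<mu> 0 \<omega>)"
      using that by (intro norm_power_diff_le pb) auto
    also have "cmod (pole_fun \<mu> \<xi> \<omega> - pole_fun \<mu> 0 \<omega>) = \<xi> * (cmod (pole_fun \<mu> \<xi> \<omega>) * cmod (pole_fun \<mu> 0 \<omega>))"
      unfolding d using that by (simp add: norm_mult)
    also have "real (Suc n) * B ^ (Suc n - 1) * (\<xi> * (cmod (pole_fun \<mu> \<xi> \<omega>) * cmod (pole_fun \<mu> 0 \<omega>))) \<le> real (Suc n) * B ^ (Suc n - 1) * (\<xi> * (B * cmod (pole_fun \<mu> 0 \<omega>)))"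
      using that Bp by (intro mult_left_mono mult_right_mono pb) auto
    also have "\<dots> = \<bar>\<xi> * c\<bar> * cmod (pole_fun \<mu> 0 \<omega>)"
      using that Bp by (simp add: c_def abs_mult del: of_nat_Suc)
    also have "\<dots> = cmod (of_real (\<xi> * c) * pole_fun \<mu> 0 \<omega>)"
      by (simp only: norm_mult norm_of_real)
    finally show ?thesis .
  qed
  have "((\<lambda>\<xi>. (\<xi> * c)\<^sup>2 * l2sq (pole_fun \<mu> 0)) \<longlongrightarrow> (0 * c)\<^sup>2 * l2sq (pole_fun \<mu> 0)) (at_right 0)"
    by (intro tendsto_intros)
  then have lim: "((\<lambda>\<xi>. (\<xi> * c)\<^sup>2 * l2sq (pole_fun \<mu> 0)) \<longlongrightarrow> 0) (at_right 0)" by simp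
  show "((\<lambda>\<xi>. l2sq (\<lambda>\<omega>. (1 / (Complex \<xi> \<omega> - \<mu>)) ^ Suc n - (pole_fun \<mu> 0 \<omega>) ^ Suc n)) \<longlongrightarrow> 0) (at_right 0)"
  proof (rule Lim_null_comparison[OF _ lim])
    show "\<forall>\<^sub>F \<xi> in at_right 0. norm (l2sq (\<lambda>\<omega>. (1 / (Complex \<xi> \<omega> - \<mu>)) ^ Suc n - (pole_fun \<mu> 0 \<omega>) ^ Suc n)) \<le> (\<xi> * c)\<^sup>2 * l2sq (pole_fun \<mu> 0)"
      using eventually_at_right_less
    proof eventually_elim
      case (elim \<xi>)
      have LL: "L2 (\<lambda>\<omega>. of_real (\<xi> * c) * pole_fun \<mu> 0 \<omega>)" using mu by (intro L2_cmult pole_fun_L2) simp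
      have "l2sq (\<lambda>\<omega>. (pole_fun \<mu> \<xi> \<omega>) ^ Suc n - (pole_fun \<mu> 0 \<omega>) ^ Suc n) \<le> l2sq (\<lambda>\<omega>. of_real (\<xi> * c) * pole_fun \<mu> 0 \<omega>)"
        using L2_dominated(2)[OF LL _ le[OF elim]] L2_measurable[OF L[OF elim]] unfolding line by blast
      also have "\<dots> = (\<xi> * c)\<^sup>2 * l2sq (pole_fun \<mu> 0)" by (subst l2sq_cmult) (simp only: norm_of_real power2_abs)
      finally show ?case unfolding line by simp
    qed
  qed
qed

section \<open>The matrix-valued Hardy space\<close>

lemma norm_matrix_sq: "(norm (A :: complex^'m^'p))\<^sup>2 = (\<Sum>i\<in>UNIV. \<Sum>j\<in>UNIV. (cmod (A $ i $ j))\<^sup>2)"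
  by (simp add: norm_vec_def L2_set_def sum_nonneg real_sqrt_pow2)

lemma norm_entry_le: "cmod ((A :: complex^'m^'p) $ i $ j) \<le> norm A"
  by (meson Finite_Cartesian_Product.norm_nth_le order.trans)

lemma matrix_measurable_iff:
  fixes f :: "real \<Rightarrow> complex^'m^'p"
  shows "f \<in> borel_measurable M \<longleftrightarrow> (\<forall>i j. (\<lambda>\<omega>. f \<omega> $ i $ j) \<in> borel_measurable M)"
proof
  assume f: "f \<in> borel_measurable M"
  show "\<forall>i j. (\<lambda>\<omega>. f \<omega> $ i $ j) \<in> borel_measurable M"
  proof (intro allI)
    fix i j
    have "(\<lambda>A::complex^'m^'p. A $ i $ j) \<in> borel_measurable borel"
      by (intro borel_measurable_continuous_onI continuous_intros)
    from measurable_compose[OF f this] show "(\<lambda>\<omega>. f \<omega> $ i $ j) \<in> borel_measurable M" .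
  qed
next
  assume *: "\<forall>i j. (\<lambda>\<omega>. f \<omega> $ i $ j) \<in> borel_measurable M"
  show "f \<in> borel_measurable M"
    unfolding borel_measurable_euclidean_space[where f = f]
  proof
    fix b :: "complex^'m^'p" assume "b \<in> Basis"
    then obtain i j u where b: "b = axis i (axis j u)" "u \<in> Basis" by (auto simp: Basis_vec_def)
    have "(\<lambda>\<omega>. f \<omega> $ i $ j \<bullet> u) \<in> borel_measurable M" using * by (intro borel_measurable_inner) auto
    then show "(\<lambda>\<omega>. f \<omega> \<bullet> b) \<in> borel_measurable M" by (simp add: b inner_axis)
  qed
qed

lemma hardy2_entry:
  fixes F :: "complex \<Rightarrow> complex^'m^'p"
  assumes "F \<in> hardy2"
  obtains M where "\<And>i j. hardy_bound (\<lambda>s. F s $ i $ j) M"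
proof -
  define S where "S = (SUP \<xi>\<in>{0<..}. \<integral>\<^sup>+ \<omega>. ennreal ((norm (F (Complex \<xi> \<omega>)))\<^sup>2) \<partial>lborel)"
  have S: "S < \<infinity>" using assms by (simp add: hardy2_def S_def)
  have "hardy_bound (\<lambda>s. F s $ i $ j) (enn2real S)" for i j
    unfolding hardy_bound_def
  proof (intro conjI allI impI)
    show "(\<lambda>s. F s $ i $ j) holomorphic_on right_half_plane" using assms by (simp add: hardy2_def)
    fix \<xi> :: real assume "\<xi> > 0"
    have "(\<integral>\<^sup>+\<omega>. ennreal ((cmod (F (Complex \<xi> \<omega>) $ i $ j))\<^sup>2) \<partial>lborel) \<le> (\<integral>\<^sup>+\<omega>. ennreal ((norm (F (Complex \<xi> \<omega>)))\<^sup>2) \<partial>lborel)"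
      by (intro nn_integral_mono ennreal_leI power_mono norm_entry_le) auto
    also have "\<dots> \<le> S" unfolding S_def using \<open>\<xi> > 0\<close> by (intro SUP_upper) auto
    finally show "(\<integral>\<^sup>+\<omega>. ennreal ((cmod (F (Complex \<xi> \<omega>) $ i $ j))\<^sup>2) \<partial>lborel) \<le> ennreal (enn2real S)"
      using S by simp
  qed auto
  then show ?thesis by (rule that)
qed

lemma nn_integral_norm_matrix_sq:
  fixes f :: "real \<Rightarrow> complex^'m^'p"
  assumes "\<And>i j. (\<lambda>\<omega>. f \<omega> $ i $ j) \<in> borel_measurable lborel"
  shows "(\<integral>\<^sup>+\<omega>. ennreal ((norm (f \<omega>))\<^sup>2) \<partial>lborel) = (\<Sum>i\<in>UNIV. \<Sum>j\<in>UNIV. \<integral>\<^sup>+\<omega>. ennreal ((cmod (f \<omega> $ i $ j))\<^sup>2) \<partial>lborel)"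
proof -
  have [measurable]: "(\<lambda>\<omega>. f \<omega> $ i $ j) \<in> borel_measurable lborel" for i j by (rule assms)
  have "(\<integral>\<^sup>+\<omega>. ennreal ((norm (f \<omega>))\<^sup>2) \<partial>lborel) = (\<integral>\<^sup>+\<omega>. (\<Sum>i\<in>UNIV. \<Sum>j\<in>UNIV. ennreal ((cmod (f \<omega> $ i $ j))\<^sup>2)) \<partial>lborel)"
    by (intro nn_integral_cong) (simp add: norm_matrix_sq sum_ennreal sum_nonneg)
  also have "\<dots> = (\<Sum>i\<in>UNIV. \<Sum>j\<in>UNIV. \<integral>\<^sup>+\<omega>. ennreal ((cmod (f \<omega> $ i $ j))\<^sup>2) \<partial>lborel)"
    by (subst nn_integral_sum, measurable, subst nn_integral_sum, measurable)
  finally show ?thesis .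
qed

lemma hardy2I:
  fixes F :: "complex \<Rightarrow> complex^'m^'p"
  assumes h: "\<And>i j. hardy_bound (\<lambda>s. F s $ i $ j) (M i j)"
  shows "F \<in> hardy2"
proof -
  have "(\<integral>\<^sup>+ \<omega>. ennreal ((norm (F (Complex \<xi> \<omega>)))\<^sup>2) \<partial>lborel) \<le> ennreal (\<Sum>i\<in>UNIV. \<Sum>j\<in>UNIV. M i j)" if "\<xi> > 0" for \<xi>
  proof -
    have "(\<integral>\<^sup>+ \<omega>. ennreal ((norm (F (Complex \<xi> \<omega>)))\<^sup>2) \<partial>lborel) = (\<Sum>i\<in>UNIV. \<Sum>j\<in>UNIV. \<integral>\<^sup>+\<omega>. ennreal ((cmod (F (Complex \<xi> \<omega>) $ i $ j))\<^sup>2) \<partial>lborel)"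
      by (intro nn_integral_norm_matrix_sq L2_measurable hardy_L2(1)[OF h that])
    also have "\<dots> \<le> (\<Sum>i\<in>UNIV. \<Sum>j\<in>UNIV. ennreal (M i j))"
      using h that by (intro sum_mono) (auto simp: hardy_bound_def)
    also have "\<dots> = ennreal (\<Sum>i\<in>UNIV. \<Sum>j\<in>UNIV. M i j)"
      using h by (simp add: hardy_bound_def sum_ennreal sum_nonneg)
    finally show ?thesis .
  qed
  then have "(SUP \<xi>\<in>{0<..}. \<integral>\<^sup>+ \<omega>. ennreal ((norm (F (Complex \<xi> \<omega>)))\<^sup>2) \<partial>lborel) \<le> ennreal (\<Sum>i\<in>UNIV. \<Sum>j\<in>UNIV. M i j)"
    by (intro SUP_least) auto
  then show ?thesis using h by (auto simp: hardy2_def hardy_bound_def intro: le_less_trans)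
qed

lemma hardy2_lincomb:
  fixes F G :: "complex \<Rightarrow> complex^'m^'p"
  assumes "F \<in> hardy2" "G \<in> hardy2" "\<And>s i j. s \<in> right_half_plane \<Longrightarrow> K s $ i $ j = a * F s $ i $ j + b * G s $ i $ j"
  shows "K \<in> hardy2"
proof -
  obtain M N where M: "\<And>i j. hardy_bound (\<lambda>s. F s $ i $ j) M" and N: "\<And>i j. hardy_bound (\<lambda>s. G s $ i $ j) N"
    using hardy2_entry[OF assms(1)] hardy2_entry[OF assms(2)] by metis
  have "hardy_bound (\<lambda>s. K s $ i $ j) (2 * ((cmod a)\<^sup>2 * M) + 2 * ((cmod b)\<^sup>2 * N))" for i j
    using hardy_bound_lincomb[OF M[of i j] N[of i j], of a b]
    by (simp add: hardy_bound_def assms(3) cong: holomorphic_cong)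
  then show ?thesis by (rule hardy2I)
qed

text \<open>The squared Frobenius norm is the sum of the squared entries, so mean-square convergence
  of matrices is convergence of each entry. From here on the analysis is scalar.\<close>

lemma is_boundary_function_iff:
  fixes F :: "complex \<Rightarrow> complex^'m^'p"
  assumes F: "F \<in> hardy2"
  shows "is_boundary_function F f \<longleftrightarrow> (\<forall>i j. bdry (\<lambda>s. F s $ i $ j) (\<lambda>\<omega>. f \<omega> $ i $ j))"
proof -
  obtain M where M: "\<And>i j. hardy_bound (\<lambda>s. F s $ i $ j) M" using hardy2_entry[OF F] by metis
  define J where "J \<xi> = (\<integral>\<^sup>+\<omega>. ennreal ((norm (F (Complex \<xi> \<omega>) - f \<omega>))\<^sup>2) \<partial>lborel)" for \<xi>
  define j where "j \<xi> i k = (\<integral>\<^sup>+\<omega>. ennreal ((cmod (F (Complex \<xi> \<omega>) $ i $ k - f \<omega> $ i $ k))\<^sup>2) \<partial>lborel)" for \<xi> i k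
  have le: "j \<xi> i k \<le> J \<xi>" for \<xi> i k
    unfolding j_def J_def
  proof (intro nn_integral_mono ennreal_leI power_mono)
    fix \<omega> show "cmod (F (Complex \<xi> \<omega>) $ i $ k - f \<omega> $ i $ k) \<le> norm (F (Complex \<xi> \<omega>) - f \<omega>)"
      using norm_entry_le[of "F (Complex \<xi> \<omega>) - f \<omega>" i k] by simp
  qed auto
  have eq: "J \<xi> = (\<Sum>i\<in>UNIV. \<Sum>k\<in>UNIV. j \<xi> i k)" if "\<xi> > 0" "f \<in> borel_measurable lborel" for \<xi>
  proof -
    have "(\<lambda>\<omega>. (F (Complex \<xi> \<omega>) - f \<omega>) $ i $ k) \<in> borel_measurable lborel" for i k
      unfolding vector_minus_component
      using that(2)[unfolded matrix_measurable_iff]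
      by (intro borel_measurable_diff L2_measurable[OF hardy_L2(1)[OF M that(1)]]) blast
    from nn_integral_norm_matrix_sq[OF this] show ?thesis by (simp add: J_def j_def)
  qed
  show ?thesis
  proof
    assume "is_boundary_function F f"
    then have 1: "f \<in> borel_measurable lborel" "(J \<longlongrightarrow> 0) (at_right 0)"
      by (auto simp: is_boundary_function_def J_def[abs_def])
    have "((\<lambda>\<xi>. j \<xi> i k) \<longlongrightarrow> 0) (at_right 0)" for i k
      by (rule tendsto_sandwich[OF _ _ tendsto_const 1(2)]) (auto simp: le)
    then show "\<forall>i j. bdry (\<lambda>s. F s $ i $ j) (\<lambda>\<omega>. f \<omega> $ i $ j)"
      using 1(1)[unfolded matrix_measurable_iff] by (simp add: bdry_def j_def)
  next
    assume *: "\<forall>i j. bdry (\<lambda>s. F s $ i $ j) (\<lambda>\<omega>. f \<omega> $ i $ j)"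
    then have m: "f \<in> borel_measurable lborel" unfolding matrix_measurable_iff by (simp add: bdry_def)
    have "((\<lambda>\<xi>. \<Sum>i\<in>UNIV. \<Sum>k\<in>UNIV. j \<xi> i k) \<longlongrightarrow> (\<Sum>i\<in>(UNIV::'p set). \<Sum>k\<in>(UNIV::'m set). 0)) (at_right 0)"
      using * by (intro tendsto_sum) (simp add: bdry_def j_def)
    moreover have "\<forall>\<^sub>F \<xi> in at_right 0. (\<Sum>i\<in>UNIV. \<Sum>k\<in>UNIV. j \<xi> i k) = J \<xi>"
      using eventually_at_right_less by eventually_elim (rule eq[OF _ m, symmetric])
    ultimately have "(J \<longlongrightarrow> 0) (at_right 0)" by (auto intro: Lim_transform_eventually)
    then show "is_boundary_function F f" using m by (simp add: is_boundary_function_def J_def[abs_def])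
  qed
qed

lemma boundary_function_bdry:
  fixes F :: "complex \<Rightarrow> complex^'m^'p"
  assumes F: "F \<in> hardy2"
  shows "bdry (\<lambda>s. F s $ i $ j) (\<lambda>\<omega>. boundary_function F \<omega> $ i $ j)"
proof -
  obtain M where M: "\<And>i j. hardy_bound (\<lambda>s. F s $ i $ j) M" using hardy2_entry[OF F] by metis
  have "\<exists>g. bdry (\<lambda>s. F s $ i $ j) g" for i j by (rule hardy_bdry_exists[OF M])
  then obtain g where "\<And>i j. bdry (\<lambda>s. F s $ i $ j) (g i j)" by metis
  then have "is_boundary_function F (\<lambda>\<omega>. \<chi> i j. g i j \<omega>)" by (simp add: is_boundary_function_iff[OF F])
  then have "is_boundary_function F (boundary_function F)" unfolding boundary_function_def by (rule someI[of "is_boundary_function F"])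
  then show ?thesis by (simp add: is_boundary_function_iff[OF F])
qed

section \<open>The inner product in terms of entrywise boundary values\<close>

lemma trace_adjoint_mult:
  fixes A B :: "complex^'m^'p"
  shows "trace (adjoint_matrix A ** B) = (\<Sum>i\<in>UNIV. \<Sum>j\<in>UNIV. cnj (A $ i $ j) * B $ i $ j)"
  unfolding trace_def adjoint_matrix_def matrix_matrix_mult_def
  by (subst sum.swap) (simp add: map_matrix_def transpose_def)

text \<open>\<open>boundary_function\<close> is a choice about which only \<open>bdry\<close> is
  known. Since boundary values agree almost everywhere, any convenient representatives may stand in
  for the chosen ones.\<close>

lemma h2_inner_eq:
  fixes F G :: "complex \<Rightarrow> complex^'m^'p"
  assumes F: "F \<in> hardy2" and G: "G \<in> hardy2"
    and f: "\<And>i j. bdry (\<lambda>s. F s $ i $ j) (f i j)" and g: "\<And>i j. bdry (\<lambda>s. G s $ i $ j) (g i j)"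
  shows "h2_inner F G = (\<Sum>i\<in>UNIV. \<Sum>j\<in>UNIV. (LINT \<omega>|lborel. cnj (f i j \<omega>) * g i j \<omega>)) / (2 * pi)"
proof -
  obtain M N where M: "\<And>i j. hardy_bound (\<lambda>s. F s $ i $ j) M" and N: "\<And>i j. hardy_bound (\<lambda>s. G s $ i $ j) N"
    using hardy2_entry[OF assms(1)] hardy2_entry[OF assms(2)] by metis
  let ?f = "\<lambda>i j \<omega>. boundary_function F \<omega> $ i $ j" and ?g = "\<lambda>i j \<omega>. boundary_function G \<omega> $ i $ j"
  have L: "L2 (?f i j)" "L2 (?g i j)" "L2 (f i j)" "L2 (g i j)" for i j
    using boundary_function_bdry[OF F] boundary_function_bdry[OF G] f g by (blast intro: bdry_L2[OF M] bdry_L2[OF N])+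
  have "(LINT \<omega>|lborel. trace (adjoint_matrix (boundary_function F \<omega>) ** boundary_function G \<omega>)) =
    (\<Sum>i\<in>UNIV. \<Sum>j\<in>UNIV. (LINT \<omega>|lborel. cnj (?f i j \<omega>) * ?g i j \<omega>))"
    unfolding trace_adjoint_mult
    by (subst Bochner_Integration.integral_sum; (intro Bochner_Integration.integrable_sum L2_mult_integrable L2_cnj L)?)+ simp
  also have "\<dots> = (\<Sum>i\<in>UNIV. \<Sum>j\<in>UNIV. (LINT \<omega>|lborel. cnj (f i j \<omega>) * g i j \<omega>))"
  proof (intro sum.cong refl integral_cong_AE)
    fix i j
    show "AE \<omega> in lborel. cnj (?f i j \<omega>) * ?g i j \<omega> = cnj (f i j \<omega>) * g i j \<omega>"
      using bdry_unique[OF M boundary_function_bdry[OF F] f, of i j] bdry_unique[OF N boundary_function_bdry[OF G] g, of i j]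
      by eventually_elim simp
    show "(\<lambda>\<omega>. cnj (?f i j \<omega>) * ?g i j \<omega>) \<in> borel_measurable lborel" "(\<lambda>\<omega>. cnj (f i j \<omega>) * g i j \<omega>) \<in> borel_measurable lborel"
      by (intro borel_measurable_integrable L2_mult_integrable L2_cnj L)+
  qed
  finally show ?thesis by (simp add: h2_inner_def)
qed

text \<open>The function chosen for \<open>K\<close> need not be the combination of those chosen for
  \<open>G\<close> and \<open>G'\<close>, so linearity has to go through \<open>h2_inner_eq\<close>
  with the combined representative.\<close>

lemma h2_inner_lincomb:
  fixes F G G' K :: "complex \<Rightarrow> complex^'m^'p"
  assumes F: "F \<in> hardy2" and G: "G \<in> hardy2" "G' \<in> hardy2"
    and K: "\<And>s i j. s \<in> right_half_plane \<Longrightarrow> K s $ i $ j = a * G s $ i $ j + b * G' s $ i $ j"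
  shows "h2_inner F K = a * h2_inner F G + b * h2_inner F G'"
proof -
  have Kh: "K \<in> hardy2" using G K by (rule hardy2_lincomb)
  obtain M N N' where M: "\<And>i j. hardy_bound (\<lambda>s. F s $ i $ j) M" and N: "\<And>i j. hardy_bound (\<lambda>s. G s $ i $ j) N"
     and N': "\<And>i j. hardy_bound (\<lambda>s. G' s $ i $ j) N'"
    using hardy2_entry[OF F] hardy2_entry[OF G(1)] hardy2_entry[OF G(2)] by metis
  let ?f = "\<lambda>i j \<omega>. boundary_function F \<omega> $ i $ j" and ?g = "\<lambda>i j \<omega>. boundary_function G \<omega> $ i $ j"
    and ?g' = "\<lambda>i j \<omega>. boundary_function G' \<omega> $ i $ j"
  note b = boundary_function_bdry[OF F] boundary_function_bdry[OF G(1)] boundary_function_bdry[OF G(2)]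
  have L: "L2 (?f i j)" "L2 (?g i j)" "L2 (?g' i j)" for i j
    using b by (blast intro: bdry_L2[OF M] bdry_L2[OF N] bdry_L2[OF N'])+
  have kb: "bdry (\<lambda>s. K s $ i $ j) (\<lambda>\<omega>. a * ?g i j \<omega> + b * ?g' i j \<omega>)" for i j
    by (rule bdry_cong[OF _ bdry_lincomb[OF N N' b(2,3)]]) (simp add: K)
  have "(LINT \<omega>|lborel. cnj (?f i j \<omega>) * (a * ?g i j \<omega> + b * ?g' i j \<omega>)) =
      a * (LINT \<omega>|lborel. cnj (?f i j \<omega>) * ?g i j \<omega>) + b * (LINT \<omega>|lborel. cnj (?f i j \<omega>) * ?g' i j \<omega>)" for i j
  proof -
    have "(LINT \<omega>|lborel. cnj (?f i j \<omega>) * (a * ?g i j \<omega> + b * ?g' i j \<omega>)) =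
       (LINT \<omega>|lborel. a * (cnj (?f i j \<omega>) * ?g i j \<omega>) + b * (cnj (?f i j \<omega>) * ?g' i j \<omega>))"
      by (intro Bochner_Integration.integral_cong refl) (simp add: algebra_simps)
    also have "\<dots> = a * (LINT \<omega>|lborel. cnj (?f i j \<omega>) * ?g i j \<omega>) + b * (LINT \<omega>|lborel. cnj (?f i j \<omega>) * ?g' i j \<omega>)"
      by (subst Bochner_Integration.integral_add) (auto intro!: L2_mult_integrable L2_cnj L integrable_mult_right)
    finally show ?thesis .
  qed
  then show ?thesis
    unfolding h2_inner_eq[OF F Kh b(1) kb] h2_inner_eq[OF F G(1) b(1) b(2)] h2_inner_eq[OF F G(2) b(1) b(3)]
    by (simp add: sum.distrib sum_distrib_left add_divide_distrib)
qed

lemma h2_norm_eq: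
  fixes F :: "complex \<Rightarrow> complex^'m^'p"
  assumes F: "F \<in> hardy2" and f: "\<And>i j. bdry (\<lambda>s. F s $ i $ j) (f i j)"
  shows "h2_norm F = sqrt ((\<Sum>i\<in>UNIV. \<Sum>j\<in>UNIV. l2sq (f i j)) / (2 * pi))"
proof -
  have "(LINT \<omega>|lborel. cnj (f i j \<omega>) * f i j \<omega>) = complex_of_real (l2sq (f i j))" for i j
  proof -
    have "(LINT \<omega>|lborel. cnj (f i j \<omega>) * f i j \<omega>) = (LINT \<omega>|lborel. complex_of_real ((cmod (f i j \<omega>))\<^sup>2))"
      by (intro Bochner_Integration.integral_cong refl) (metis complex_norm_square mult.commute)
    then show ?thesis by (simp only: l2sq_def integral_complex_of_real)
  qed
  then have "h2_inner F F = complex_of_real ((\<Sum>i\<in>UNIV. \<Sum>j\<in>UNIV. l2sq (f i j)) / (2 * pi))"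
    unfolding h2_inner_eq[OF F F f f] by simp
  then show ?thesis by (simp only: h2_norm_def Re_complex_of_real)
qed

text \<open>Boundedness of point evaluation, from the Cauchy formula and Cauchy-Schwarz with the
  norm of the kernel. It serves twice: norm derivatives become pointwise ones, and elements of the
  space decay along the positive real axis.\<close>

lemma entry_le_h2_norm:
  fixes F :: "complex \<Rightarrow> complex^'m^'p"
  assumes F: "F \<in> hardy2" and s: "s \<in> right_half_plane"
  shows "cmod (F s $ i $ j) \<le> h2_norm F / sqrt (2 * Re s)"
proof -
  obtain M where M: "\<And>i j. hardy_bound (\<lambda>s. F s $ i $ j) M" using hardy2_entry[OF F] by metis
  let ?f = "\<lambda>i j \<omega>. boundary_function F \<omega> $ i $ j"
  note b = boundary_function_bdry[OF F]
  have L: "L2 (?f i j)" using b by (blast intro: bdry_L2[OF M])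
  have s0: "Re s > 0" using s by (simp add: right_half_plane_def)
  have "(2 * pi * cmod (F s $ i $ j))\<^sup>2 = (norm (- 2 * pi * (F s $ i $ j)))\<^sup>2" by (simp add: norm_mult)
  also have "\<dots> = (norm (LINT \<omega>|lborel. pole_fun s 0 \<omega> * ?f i j \<omega>))\<^sup>2"
    using Cauchy_boundary[OF M b s0, of i j] by simp
  also have "\<dots> \<le> l2sq (pole_fun s 0) * l2sq (?f i j)"
    using s0 by (intro L2_Cauchy_Schwarz pole_fun_L2 L) simp
  also have "\<dots> \<le> (pi / Re s) * (2 * pi * (h2_norm F)\<^sup>2)"
  proof (rule mult_mono)
    show "l2sq (pole_fun s 0) \<le> pi / Re s" using pole_fun_L2(2)[of 0 s] s0 by simp
    have "l2sq (?f i j) \<le> (\<Sum>j\<in>UNIV. l2sq (?f i j))" by (rule member_le_sum) auto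
    also have "\<dots> \<le> (\<Sum>i\<in>UNIV. \<Sum>j\<in>UNIV. l2sq (?f i j))"
      by (rule member_le_sum[of i UNIV "\<lambda>i. \<Sum>j\<in>UNIV. l2sq (?f i j)"]) (auto intro: sum_nonneg)
    also have "\<dots> = 2 * pi * (h2_norm F)\<^sup>2"
      unfolding h2_norm_eq[OF F b] by (subst real_sqrt_pow2) (auto intro!: divide_nonneg_nonneg sum_nonneg)
    finally show "l2sq (?f i j) \<le> 2 * pi * (h2_norm F)\<^sup>2" .
  qed (use s0 in auto)
  also have "\<dots> = (2 * pi * (h2_norm F / sqrt (2 * Re s)))\<^sup>2"
    using s0 by (simp add: power_mult_distrib power_divide power2_eq_square field_simps)
  finally have "2 * pi * cmod (F s $ i $ j) \<le> 2 * pi * (h2_norm F / sqrt (2 * Re s))"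
  proof (rule power2_le_imp_le)
    have "h2_norm F \<ge> 0" unfolding h2_norm_eq[OF F b] by (intro real_sqrt_ge_zero divide_nonneg_nonneg sum_nonneg) auto
    then show "0 \<le> 2 * pi * (h2_norm F / sqrt (2 * Re s))" using s0 by simp
  qed
  moreover have "2 * pi > 0" by simp
  ultimately show ?thesis by (rule mult_left_le_imp_le)
qed

definition pole_matrix :: "(complex^'m^'p) \<Rightarrow> complex \<Rightarrow> nat \<Rightarrow> complex \<Rightarrow> complex^'m^'p" where
  "pole_matrix K \<mu> n s = (\<chi> i j. K $ i $ j * (1 / (s - \<mu>)) ^ n)"

text \<open>The Frobenius inner product of \<open>A\<close> and \<open>K\<close>, linear in
  \<open>K\<close>; the linear argument is written first because \<open>K\<close> is the coefficient
  of a pole and \<open>A\<close> a value of the Hardy function.\<close>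

definition entry_pairing :: "complex^'m^'p \<Rightarrow> complex^'m^'p \<Rightarrow> complex" where
  "entry_pairing K A = (\<Sum>i\<in>UNIV. \<Sum>j\<in>UNIV. K $ i $ j * cnj (A $ i $ j))"

lemma pole_matrix_hardy2:
  assumes "Re \<mu> < 0"
  shows "pole_matrix K \<mu> (Suc n) \<in> hardy2"
    and "bdry (\<lambda>s. pole_matrix K \<mu> (Suc n) s $ i $ j) (\<lambda>\<omega>. K $ i $ j * (pole_fun \<mu> 0 \<omega>) ^ Suc n)"
proof -
  have *: "(\<lambda>s. pole_matrix K \<mu> (Suc n) s $ i $ j) = (\<lambda>s. K $ i $ j * (1 / (s - \<mu>)) ^ Suc n + 0 * (1 / (s - \<mu>)) ^ Suc n)" for i j
    by (simp add: pole_matrix_def)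
  show "pole_matrix K \<mu> (Suc n) \<in> hardy2"
    by (rule hardy2I, subst *, rule hardy_bound_lincomb[OF pole_power_hardy[OF assms] pole_power_hardy[OF assms]])
  show "bdry (\<lambda>s. pole_matrix K \<mu> (Suc n) s $ i $ j) (\<lambda>\<omega>. K $ i $ j * (pole_fun \<mu> 0 \<omega>) ^ Suc n)"
    using bdry_lincomb[OF pole_power_hardy[OF assms, of n] pole_power_hardy[OF assms, of n] pole_power_bdry[OF assms] pole_power_bdry[OF assms], of "K $ i $ j" 0]
    unfolding * by simp
qed

text \<open>The origin of the points \<open>- cnj \<mu>\<close>: on the imaginary axis, conjugating
  the kernel reflects its pole in that axis, at the price of a sign.\<close>

lemma cnj_pole_fun: "cnj (pole_fun \<mu> 0 \<omega>) = - pole_fun (- cnj \<mu>) 0 \<omega>"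
proof -
  have "cnj (Complex 0 \<omega> - \<mu>) = - (Complex 0 \<omega> - (- cnj \<mu>))" by (simp add: complex_eq_iff)
  then show ?thesis unfolding pole_fun_def
    by (metis complex_cnj_divide complex_cnj_one minus_divide_right)
qed

lemma cnj_integral: "(LINT \<omega>|M. cnj (f \<omega>)) = cnj (LINT \<omega>|M. f \<omega>)" for f :: "'a \<Rightarrow> complex"
  by simp

text \<open>Each integral is the conjugate of a Cauchy integral at the mirror image of \<mu>. For
  the simple pole the sign of \<open>cnj_pole_fun\<close> cancels that of
  \<open>Cauchy_boundary\<close>; for the double pole the former is squared away and one minus sign
  remains.\<close>

lemma h2_inner_pole_matrix:
  fixes F :: "complex \<Rightarrow> complex^'m^'p"
  assumes F: "F \<in> hardy2" and mu: "Re \<mu> < 0"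
  shows "h2_inner F (pole_matrix K \<mu> 1) = entry_pairing K (F (- cnj \<mu>))"
    and "h2_inner F (pole_matrix K \<mu> 2) = - entry_pairing K (matrix_deriv F (- cnj \<mu>))"
proof -
  obtain M where M: "\<And>i j. hardy_bound (\<lambda>s. F s $ i $ j) M" using hardy2_entry[OF F] by metis
  let ?f = "\<lambda>i j \<omega>. boundary_function F \<omega> $ i $ j"
  note b = boundary_function_bdry[OF F]
  have s0: "Re (- cnj \<mu>) > 0" using mu by simp
  have 1: "(LINT \<omega>|lborel. cnj (?f i j \<omega>) * (K $ i $ j * pole_fun \<mu> 0 \<omega>)) = 2 * pi * (K $ i $ j * cnj (F (- cnj \<mu>) $ i $ j))" for i j
  proof -
    have "(LINT \<omega>|lborel. cnj (?f i j \<omega>) * (K $ i $ j * pole_fun \<mu> 0 \<omega>)) = (LINT \<omega>|lborel. K $ i $ j * - cnj (pole_fun (- cnj \<mu>) 0 \<omega> * ?f i j \<omega>))"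
      by (intro Bochner_Integration.integral_cong refl) (simp add: cnj_pole_fun)
    also have "\<dots> = K $ i $ j * - cnj (LINT \<omega>|lborel. pole_fun (- cnj \<mu>) 0 \<omega> * ?f i j \<omega>)"
      by (simp only: integral_mult_right_zero integral_minus cnj_integral)
    also have "\<dots> = 2 * pi * (K $ i $ j * cnj (F (- cnj \<mu>) $ i $ j))"
      by (subst Cauchy_boundary[OF M b s0]) simp
    finally show ?thesis .
  qed
  have 2: "(LINT \<omega>|lborel. cnj (?f i j \<omega>) * (K $ i $ j * (pole_fun \<mu> 0 \<omega>)\<^sup>2)) = 2 * pi * - (K $ i $ j * cnj (matrix_deriv F (- cnj \<mu>) $ i $ j))" for i j
  proof -
    have "(LINT \<omega>|lborel. cnj (?f i j \<omega>) * (K $ i $ j * (pole_fun \<mu> 0 \<omega>)\<^sup>2)) = (LINT \<omega>|lborel. K $ i $ j * cnj ((pole_fun (- cnj \<mu>) 0 \<omega>)\<^sup>2 * ?f i j \<omega>))"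
      by (intro Bochner_Integration.integral_cong refl) (simp add: cnj_pole_fun)
    also have "\<dots> = K $ i $ j * cnj (LINT \<omega>|lborel. (pole_fun (- cnj \<mu>) 0 \<omega>)\<^sup>2 * ?f i j \<omega>)"
      by (simp only: integral_mult_right_zero cnj_integral)
    also have "\<dots> = 2 * pi * - (K $ i $ j * cnj (matrix_deriv F (- cnj \<mu>) $ i $ j))"
      by (subst Cauchy_boundary_deriv[OF M b s0]) (simp add: matrix_deriv_def)
    finally show ?thesis .
  qed
  show "h2_inner F (pole_matrix K \<mu> 1) = entry_pairing K (F (- cnj \<mu>))"
    using h2_inner_eq[OF F pole_matrix_hardy2(1)[OF mu, of K 0] b pole_matrix_hardy2(2)[OF mu, of K 0]]
    by (simp add: 1 entry_pairing_def flip: sum_distrib_left)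
  show "h2_inner F (pole_matrix K \<mu> 2) = - entry_pairing K (matrix_deriv F (- cnj \<mu>))"
    using h2_inner_eq[OF F pole_matrix_hardy2(1)[OF mu, of K 1] b pole_matrix_hardy2(2)[OF mu, of K 1], unfolded Suc_1]
    by (simp add: 2 entry_pairing_def sum_negf flip: sum_distrib_left)
qed

section \<open>Derivatives of rank-deficient families\<close>

text \<open>There are \<open>r\<close> equations for \<open>r + 1\<close> unknowns; padding with a
  zero row gives a square matrix, in whose determinant every permutation product meets that
  row.\<close>

lemma nontrivial_kernel:
  fixes y :: "nat \<Rightarrow> nat \<Rightarrow> complex"
  obtains z where "\<And>l. l < r \<Longrightarrow> (\<Sum>j\<le>r. y l j * z j) = 0" "\<exists>j\<le>r. z j \<noteq> 0"
proof -
  define A where "A = Matrix.mat (Suc r) (Suc r) (\<lambda>(l, j). if l < r then y l j else 0)"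
  have A: "A \<in> carrier_mat (Suc r) (Suc r)" by (simp add: A_def)
  have "Determinant.det A = (\<Sum>p | p permutes {0..<Suc r}. of_int (sign p) * (\<Prod>i = 0..<Suc r. A $$ (i, p i)))"
    unfolding Determinant.det_def by (simp add: A_def)
  also have "\<dots> = 0"
  proof (intro sum.neutral ballI)
    fix p assume "p \<in> {p. p permutes {0..<Suc r}}"
    then have "p r \<in> {0..<Suc r}" using permutes_in_image[of p "{0..<Suc r}" r] by auto
    then have "A $$ (r, p r) = 0" by (simp add: A_def)
    then have "(\<Prod>i = 0..<Suc r. A $$ (i, p i)) = 0" by (intro prod_zero) auto
    then show "of_int (sign p) * (\<Prod>i = 0..<Suc r. A $$ (i, p i)) = 0" by simp
  qed
  finally obtain v where v: "v \<in> carrier_vec (Suc r)" "v \<noteq> 0\<^sub>v (Suc r)" "A *\<^sub>v v = 0\<^sub>v (Suc r)"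
    using det_0_iff_vec_prod_zero_field[OF A] by auto
  show ?thesis
  proof (rule that[of "vec_index v"])
    fix l assume l: "l < r"

    have "vec_index (A *\<^sub>v v) l = (\<Sum>j<Suc r. y l j * vec_index v j)"
      using l v(1) by (simp add: A_def scalar_prod_def lessThan_atLeast0)
    then show "(\<Sum>j\<le>r. y l j * vec_index v j) = 0" using v(3) l by (simp add: lessThan_Suc_atMost)
  next
    show "\<exists>j\<le>r. vec_index v j \<noteq> 0"
    proof (rule ccontr)
      assume "\<not> ?thesis"
      then have "v = 0\<^sub>v (Suc r)" using v(1) by (intro eq_vecI) auto
      with v(2) show False by simp
    qed
  qed
qed

text \<open>
  If \<open>L n\<close> has rank at most \<open>r\<close> and tends to \<open>diag (0, 1, \<dots>, 1)\<close>, then a normalised kernel vector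
  of \<open>L n\<close> tends to the first unit vector up to a phase, so row \<open>0\<close> of \<open>(L n - L0) / h n\<close>
  annihilates that unit vector in the limit.
\<close>

lemma rank_tangent:
  fixes L :: "nat \<Rightarrow> nat \<Rightarrow> nat \<Rightarrow> complex" and h :: "nat \<Rightarrow> complex"
  assumes rank: "\<And>n. \<exists>x y. \<forall>i\<le>r. \<forall>j\<le>r. L n i j = (\<Sum>l<r. x i l * y l j)"
    and L0: "\<And>i j. i \<le> r \<Longrightarrow> j \<le> r \<Longrightarrow> L0 i j = (if i = j \<and> i \<noteq> 0 then 1 else 0)"
    and h: "h \<longlonglongrightarrow> 0" "\<And>n. h n \<noteq> 0"
    and lim: "\<And>i j. i \<le> r \<Longrightarrow> j \<le> r \<Longrightarrow> (\<lambda>n. (L n i j - L0 i j) / h n) \<longlonglongrightarrow> L' i j"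
  shows "L' 0 0 = 0"
proof -
  have "\<forall>n. \<exists>z. (\<forall>i\<le>r. (\<Sum>j\<le>r. L n i j * z j) = 0) \<and> (\<Sum>j\<le>r. cmod (z j)) = 1"
  proof
    fix n
    obtain x y where xy: "\<forall>i\<le>r. \<forall>j\<le>r. L n i j = (\<Sum>l<r. x i l * y l j)" using rank by blast
    obtain z where z: "\<And>l. l < r \<Longrightarrow> (\<Sum>j\<le>r. y l j * z j) = 0" "\<exists>j\<le>r. z j \<noteq> 0"
      by (rule nontrivial_kernel[of r y]) blast
    define S where "S = (\<Sum>j\<le>r. cmod (z j))"
    obtain j where "j \<le> r" "z j \<noteq> 0" using z(2) by blast
    then have S: "S > 0" unfolding S_def by (intro sum_pos2[of _ j]) auto
    have "(\<Sum>j\<le>r. L n i j * (z j / of_real S)) = 0" if "i \<le> r" for i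
    proof -
      have "(\<Sum>j\<le>r. L n i j * (z j / of_real S)) = (\<Sum>j\<le>r. \<Sum>l<r. x i l * (y l j * z j)) / of_real S"
        unfolding sum_divide_distrib
        using xy that by (intro sum.cong refl) (simp add: sum_distrib_right mult.assoc flip: sum_divide_distrib)
      also have "(\<Sum>j\<le>r. \<Sum>l<r. x i l * (y l j * z j)) = (\<Sum>l<r. x i l * (\<Sum>j\<le>r. y l j * z j))"
        by (subst sum.swap) (simp add: sum_distrib_left)
      also have "\<dots> = 0" using z(1) by (intro sum.neutral) simp
      finally show ?thesis by simp
    qed
    moreover have "(\<Sum>j\<le>r. cmod (z j / of_real S)) = 1"
    proof -
      have "(\<Sum>j\<le>r. cmod (z j / of_real S)) = (\<Sum>j\<le>r. cmod (z j) / S)"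
        using S by (intro sum.cong refl) (simp add: norm_divide)
      also have "\<dots> = S / S" unfolding S_def by (rule sum_divide_distrib[symmetric])
      finally show ?thesis using S by simp
    qed
    ultimately show "\<exists>z. (\<forall>i\<le>r. (\<Sum>j\<le>r. L n i j * z j) = 0) \<and> (\<Sum>j\<le>r. cmod (z j)) = 1"
      by (intro exI[of _ "\<lambda>j. z j / of_real S"] conjI allI impI)
  qed
  from choice[OF this] obtain z where
    zz: "\<forall>n. (\<forall>i\<le>r. (\<Sum>j\<le>r. L n i j * z n j) = 0) \<and> (\<Sum>j\<le>r. cmod (z n j)) = 1" ..
  have z: "\<And>n i. i \<le> r \<Longrightarrow> (\<Sum>j\<le>r. L n i j * z n j) = 0" "\<And>n. (\<Sum>j\<le>r. cmod (z n j)) = 1"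
    using zz by auto
  have zle: "cmod (z n j) \<le> 1" if "j \<le> r" for n j
    using member_le_sum[of j "{..r}" "\<lambda>j. cmod (z n j)"] z(2)[of n] that by auto
  have Llim: "(\<lambda>n. L n i j - L0 i j) \<longlonglongrightarrow> 0" if "i \<le> r" "j \<le> r" for i j
    using tendsto_mult[OF lim[OF that] h(1)] h(2) by simp
  have key: "(\<Sum>j\<le>r. (L n i j - L0 i j) * z n j) = - (if i = 0 then 0 else z n i)" if "i \<le> r" for n i
  proof -
    have "(\<Sum>j\<le>r. (L n i j - L0 i j) * z n j) = (\<Sum>j\<le>r. L n i j * z n j) - (\<Sum>j\<le>r. L0 i j * z n j)"
      by (simp add: left_diff_distrib sum_subtractf)
    also have "(\<Sum>j\<le>r. L0 i j * z n j) = (\<Sum>j\<le>r. if j = i then (if i = 0 then 0 else z n i) else 0)"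
      using that by (intro sum.cong refl) (auto simp: L0)
    finally show ?thesis using that z(1) by simp
  qed
  \<comment> \<open>Row \<open>i\<close> of \<open>L0\<close> reads off the coordinate
    \<open>i\<close>, so the kernel equation makes this coordinate as small as the entries of
    \<open>L n - L0\<close>.\<close>
  have zi: "(\<lambda>n. z n i) \<longlonglongrightarrow> 0" if "i \<le> r" "i \<noteq> 0" for i
  proof (rule Lim_null_comparison)
    show "(\<lambda>n. \<Sum>j\<le>r. cmod (L n i j - L0 i j)) \<longlonglongrightarrow> 0"
      using that by (intro tendsto_null_sum tendsto_norm_zero Llim) auto
    show "\<forall>\<^sub>F n in sequentially. cmod (z n i) \<le> (\<Sum>j\<le>r. cmod (L n i j - L0 i j))"
    proof (intro always_eventually allI)
      fix n
      have "cmod (z n i) = cmod (\<Sum>j\<le>r. (L n i j - L0 i j) * z n j)" using key[of i n] that by simp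
      also have "\<dots> \<le> (\<Sum>j\<le>r. cmod (L n i j - L0 i j) * cmod (z n j))"
        by (intro order.trans[OF norm_sum]) (simp add: norm_mult)
      also have "\<dots> \<le> (\<Sum>j\<le>r. cmod (L n i j - L0 i j) * 1)"
        using zle by (intro sum_mono mult_left_mono) auto
      finally show "cmod (z n i) \<le> (\<Sum>j\<le>r. cmod (L n i j - L0 i j))" by simp
    qed
  qed
  have split0: "(\<Sum>j\<le>r. f j) = f 0 + (\<Sum>j\<in>{..r}-{0}. f j)" for f :: "nat \<Rightarrow> 'b::comm_monoid_add"
    by (rule sum.remove) auto
  have "(\<lambda>n. 1 - (\<Sum>j\<in>{..r}-{0}. cmod (z n j))) \<longlonglongrightarrow> 1 - 0"
    using zi by (intro tendsto_intros tendsto_null_sum tendsto_norm_zero) auto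
  then have z0: "(\<lambda>n. cmod (z n 0)) \<longlonglongrightarrow> 1"
  proof -
    have "1 - (\<Sum>j\<in>{..r}-{0}. cmod (z n j)) = cmod (z n 0)" for n
      using z(2)[of n] split0[of "\<lambda>j. cmod (z n j)"] by linarith
    then show ?thesis using \<open>(\<lambda>n. 1 - (\<Sum>j\<in>{..r}-{0}. cmod (z n j))) \<longlonglongrightarrow> 1 - 0\<close> by simp
  qed
  define Q where "Q n j = (L n 0 j - L0 0 j) / h n" for n j
  \<comment> \<open>Only the modulus of \<open>z n 0\<close> is known to converge, so the row
    equation is taken in absolute values before passing to the limit.\<close>
  have Qeq: "cmod (Q n 0) * cmod (z n 0) = cmod (\<Sum>j\<in>{..r}-{0}. Q n j * z n j)" for n
  proof -
    have "(\<Sum>j\<le>r. Q n j * z n j) = (\<Sum>j\<le>r. (L n 0 j - L0 0 j) * z n j) / h n"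
      by (simp add: Q_def sum_divide_distrib)
    also have "\<dots> = 0" using key[of 0 n] by simp
    finally have "Q n 0 * z n 0 + (\<Sum>j\<in>{..r}-{0}. Q n j * z n j) = 0"
      unfolding split0[of "\<lambda>j. Q n j * z n j"] .
    then have "Q n 0 * z n 0 = - (\<Sum>j\<in>{..r}-{0}. Q n j * z n j)" by (simp only: add_eq_0_iff2)
    then show ?thesis by (simp only: norm_mult[symmetric] norm_minus_cancel)
  qed
  have 1: "(\<lambda>n. cmod (Q n 0) * cmod (z n 0)) \<longlonglongrightarrow> cmod (L' 0 0) * 1"
    unfolding Q_def by (intro tendsto_intros lim z0) auto
  have "(\<lambda>n. \<Sum>j\<in>{..r}-{0}. Q n j * z n j) \<longlonglongrightarrow> (\<Sum>j\<in>{..r}-{0}. L' 0 j * 0)"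
    unfolding Q_def by (intro tendsto_sum tendsto_mult lim zi) auto
  then have "(\<lambda>n. cmod (\<Sum>j\<in>{..r}-{0}. Q n j * z n j)) \<longlonglongrightarrow> 0"
    by (intro tendsto_norm_zero) simp
  with 1 have "cmod (L' 0 0) * 1 = 0" unfolding Qeq by (rule LIMSEQ_unique)
  then show ?thesis by simp
qed

section \<open>Transfer functions\<close>

lemma resolvent_inverse:
  assumes A: "A \<in> carrier_mat n n" and s: "\<not> eigenvalue A s"
  shows "resolvent A s \<in> carrier_mat n n"
    "(s \<cdot>\<^sub>m 1\<^sub>m n - A) * resolvent A s = 1\<^sub>m n" "resolvent A s * (s \<cdot>\<^sub>m 1\<^sub>m n - A) = 1\<^sub>m n"
proof -
  let ?P = "s \<cdot>\<^sub>m 1\<^sub>m n - A"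
  have P: "?P \<in> carrier_mat n n" using A by (rule minus_carrier_mat)
  have "?P = - char_matrix A s"
    using A by (intro eq_matI) (auto simp: char_matrix_def)
  then have "Determinant.det ?P \<noteq> 0"
    using eigenvalue_det[OF A, of s] s A det_0_negate[of "char_matrix A s" n] by (simp add: char_matrix_def)
  then have U: "?P \<in> Units (ring_mat TYPE(complex) n undefined)"
    by (rule det_non_zero_imp_unit[OF P])
  obtain R where R: "mat_inverse ?P = Some R"
    using mat_inverse(1)[OF P, of undefined] U by (cases "mat_inverse ?P") auto
  then have "resolvent A s = R" using A by (simp add: resolvent_def)
  then show "resolvent A s \<in> carrier_mat n n" "?P * resolvent A s = 1\<^sub>m n" "resolvent A s * ?P = 1\<^sub>m n"
    using mat_inverse(2)[OF P R] by auto
qed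

text \<open>The scalar \<open>d\<close> covers both uses: \<open>d = 1\<close> for an explicit
  inverse, and the value of the characteristic polynomial for the evaluated adjugate.\<close>

lemma resolvent_unique:
  assumes A: "A \<in> carrier_mat n n" and s: "\<not> eigenvalue A s"
    and X: "X \<in> carrier_mat n n" "(s \<cdot>\<^sub>m 1\<^sub>m n - A) * X = d \<cdot>\<^sub>m 1\<^sub>m n"
  shows "X = d \<cdot>\<^sub>m resolvent A s"
proof -
  note R = resolvent_inverse[OF A s]
  have P: "s \<cdot>\<^sub>m 1\<^sub>m n - A \<in> carrier_mat n n" using A by (rule minus_carrier_mat)
  have "X = (resolvent A s * (s \<cdot>\<^sub>m 1\<^sub>m n - A)) * X" using X by (simp add: R)
  also have "\<dots> = resolvent A s * (d \<cdot>\<^sub>m 1\<^sub>m n)" unfolding assoc_mult_mat[OF R(1) P X(1)] X(2) ..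
  also have "\<dots> = d \<cdot>\<^sub>m resolvent A s"
    using R(1) mult_smult_distrib[OF R(1) one_carrier_mat, of d] by simp
  finally show ?thesis .
qed

lemma resolvent_identity:
  assumes A: "A \<in> carrier_mat n n" and s: "\<not> eigenvalue A s" and w: "\<not> eigenvalue A w" and kl: "k < n" "l < n"
  shows "resolvent A s $$ (k, l) - resolvent A w $$ (k, l) =
    (w - s) * (\<Sum>q<n. resolvent A s $$ (k, q) * resolvent A w $$ (q, l))"
proof -
  note Rs = resolvent_inverse[OF A s] and Rw = resolvent_inverse[OF A w]
  let ?Ps = "s \<cdot>\<^sub>m 1\<^sub>m n - A" and ?Pw = "w \<cdot>\<^sub>m 1\<^sub>m n - A"
  have P: "?Ps \<in> carrier_mat n n" "?Pw \<in> carrier_mat n n" using A by (auto intro: minus_carrier_mat)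
  have eq: "?Pw = ?Ps + (w - s) \<cdot>\<^sub>m 1\<^sub>m n" using A by (intro eq_matI) (auto simp: algebra_simps)
  have "resolvent A s = resolvent A s * (?Pw * resolvent A w)" using Rs Rw by simp
  also have "\<dots> = (resolvent A s * ?Pw) * resolvent A w" by (rule assoc_mult_mat[symmetric, OF Rs(1) P(2) Rw(1)])
  also have "resolvent A s * ?Pw = 1\<^sub>m n + (w - s) \<cdot>\<^sub>m resolvent A s"
    unfolding eq using Rs P by (subst mult_add_distrib_mat) (auto simp: mult_smult_distrib)
  also have "\<dots> * resolvent A w = resolvent A w + (w - s) \<cdot>\<^sub>m (resolvent A s * resolvent A w)"
    using Rs(1) Rw(1) by (subst add_mult_distrib_mat) (auto simp: mult_smult_assoc_mat)
  finally have "resolvent A s $$ (k, l) = (resolvent A w + (w - s) \<cdot>\<^sub>m (resolvent A s * resolvent A w)) $$ (k, l)" by simp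
  also have "\<dots> = resolvent A w $$ (k, l) + (w - s) * (\<Sum>q<n. resolvent A s $$ (k, q) * resolvent A w $$ (q, l))"
    using Rs(1) Rw(1) kl by (simp add: scalar_prod_def lessThan_atLeast0)
  finally show ?thesis by simp
qed

text \<open>The resolvent identity splits the divided difference into a factor in \<open>s\<close>
  and a factor in \<open>w\<close>, summed over the state space. This is where the rank bound on the
  Loewner kernel comes from.\<close>

lemma transfer_function_divided_difference:
  fixes B :: "nat \<Rightarrow> complex^'m" and C :: "nat \<Rightarrow> complex^'p"
  assumes A: "A \<in> carrier_mat n n" and s: "\<not> eigenvalue A s" and w: "\<not> eigenvalue A w"
  shows "transfer_function A B C s $ i $ j - transfer_function A B C w $ i $ j =
    (w - s) * (\<Sum>q<n. (\<Sum>k<n. C k $ i * resolvent A s $$ (k, q)) * (\<Sum>l<n. resolvent A w $$ (q, l) * B l $ j))"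
proof -
  have dim: "dim_row A = n" using A by simp
  have "transfer_function A B C s $ i $ j - transfer_function A B C w $ i $ j =
    (\<Sum>k<n. \<Sum>l<n. C k $ i * (resolvent A s $$ (k, l) - resolvent A w $$ (k, l)) * B l $ j)"
    unfolding transfer_function_def dim by (simp add: sum_subtractf algebra_simps)
  also have "\<dots> = (\<Sum>k<n. \<Sum>l<n. C k $ i * ((w - s) * (\<Sum>q<n. resolvent A s $$ (k, q) * resolvent A w $$ (q, l))) * B l $ j)"
    by (intro sum.cong refl) (simp add: resolvent_identity[OF A s w])
  also have "\<dots> = (w - s) * (\<Sum>k<n. \<Sum>l<n. \<Sum>q<n. (C k $ i * resolvent A s $$ (k, q)) * (resolvent A w $$ (q, l) * B l $ j))"
    by (simp add: sum_distrib_left sum_distrib_right mult_ac)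
  also have "(\<Sum>k<n. \<Sum>l<n. \<Sum>q<n. (C k $ i * resolvent A s $$ (k, q)) * (resolvent A w $$ (q, l) * B l $ j)) =
     (\<Sum>k<n. \<Sum>q<n. \<Sum>l<n. (C k $ i * resolvent A s $$ (k, q)) * (resolvent A w $$ (q, l) * B l $ j))"
    by (rule sum.cong[OF refl], rule sum.swap)
  also have "\<dots> =
     (\<Sum>q<n. \<Sum>k<n. \<Sum>l<n. (C k $ i * resolvent A s $$ (k, q)) * (resolvent A w $$ (q, l) * B l $ j))"
    by (rule sum.swap)
  also have "\<dots> = (\<Sum>q<n. (\<Sum>k<n. C k $ i * resolvent A s $$ (k, q)) * (\<Sum>l<n. resolvent A w $$ (q, l) * B l $ j))"
    by (simp add: sum_product)
  finally show ?thesis .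
qed

lemma eval_poly_hom: "semiring_hom (\<lambda>p. poly p (x :: complex))"
  by unfold_locales auto

text \<open>Cramer's rule over the polynomial ring: the adjugate of the characteristic matrix,
  evaluated at \<open>s\<close>, is the resolvent multiplied by the characteristic
  polynomial.\<close>

lemma transfer_function_rational:
  fixes B :: "nat \<Rightarrow> complex^'m" and C :: "nat \<Rightarrow> complex^'p"
  assumes A: "A \<in> carrier_mat n n"
  obtains N where "\<And>s i j. \<not> eigenvalue A s \<Longrightarrow> transfer_function A B C s $ i $ j * poly (char_poly A) s = poly (N i j) s"
proof -
  define X where "X = adj_mat (char_poly_matrix A)"
  have cpm: "char_poly_matrix A \<in> carrier_mat n n" using A by simp
  have X: "X \<in> carrier_mat n n" unfolding X_def using adj_mat(1)[OF cpm] .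
  define N where "N i j = (\<Sum>k<n. \<Sum>l<n. [:C k $ i:] * X $$ (k, l) * [:B l $ j:])" for i j
  have dim: "dim_row A = n" using A by simp
  show ?thesis
  proof (rule that[of N])
    fix s i j assume s: "\<not> eigenvalue A s"

    let ?e = "map_mat (\<lambda>p. poly p s)"
    have "?e (char_poly_matrix A) * ?e X = ?e (char_poly_matrix A * X)"
      by (rule semiring_hom.mat_hom_mult[OF eval_poly_hom cpm X, symmetric])
    also have "char_poly_matrix A * X = char_poly A \<cdot>\<^sub>m 1\<^sub>m n"
      unfolding X_def char_poly_def by (rule adj_mat(2)[OF cpm])
    also have "?e (char_poly A \<cdot>\<^sub>m 1\<^sub>m n) = poly (char_poly A) s \<cdot>\<^sub>m 1\<^sub>m n"
      by (intro eq_matI) auto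
    also have "?e (char_poly_matrix A) = s \<cdot>\<^sub>m 1\<^sub>m n - A"
      using A by (intro eq_matI) (auto simp: char_poly_matrix_def)
    finally have eX: "?e X = poly (char_poly A) s \<cdot>\<^sub>m resolvent A s"
      using X by (intro resolvent_unique[OF A s]) auto
    have ent: "poly (X $$ (k, l)) s = poly (char_poly A) s * resolvent A s $$ (k, l)" if "k < n" "l < n" for k l
    proof -
      have "poly (X $$ (k, l)) s = ?e X $$ (k, l)" using X that by simp
      also have "\<dots> = poly (char_poly A) s * resolvent A s $$ (k, l)"
        unfolding eX using resolvent_inverse(1)[OF A s] that by simp
      finally show ?thesis .
    qed
    show "transfer_function A B C s $ i $ j * poly (char_poly A) s = poly (N i j) s"
      unfolding transfer_function_def N_def dim
      by (simp add: poly_sum ent sum_distrib_left mult_ac)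
  qed
qed

lemma char_poly_nonzero: "A \<in> carrier_mat n n \<Longrightarrow> char_poly (A :: complex mat) \<noteq> 0"
  using degree_monic_char_poly[of A n] by auto

lemma finite_eigenvalues: "A \<in> carrier_mat n n \<Longrightarrow> finite {s :: complex. eigenvalue A s}"
  using poly_roots_finite[OF char_poly_nonzero] eigenvalue_root_char_poly[of A n] by simp

lemma card_eigenvalues_le:
  assumes "A \<in> carrier_mat n n"
  shows "card {s :: complex. eigenvalue A s} \<le> n"
  using card_poly_roots_bound[OF char_poly_nonzero[OF assms]] degree_monic_char_poly[OF assms] eigenvalue_root_char_poly[OF assms]
  by simp

text \<open>The cross-multiplied numerators differ by a polynomial with infinitely many zeros. This
  lifts agreement on the half-plane to the agreement of rational functions in which minimality is
  phrased.\<close>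

lemma transfer_function_identity:
  fixes B B' :: "nat \<Rightarrow> complex^'m" and C C' :: "nat \<Rightarrow> complex^'p"
  assumes A: "A \<in> carrier_mat n n" and A': "A' \<in> carrier_mat n' n'" and U: "infinite U"
    and eq: "\<And>s. s \<in> U \<Longrightarrow> \<not> eigenvalue A s \<Longrightarrow> \<not> eigenvalue A' s \<Longrightarrow> transfer_function A' B' C' s = transfer_function A B C s"
    and s: "\<not> eigenvalue A s" "\<not> eigenvalue A' s"
  shows "transfer_function A' B' C' s = transfer_function A B C s"
proof -
  obtain N where N: "\<And>s i j. \<not> eigenvalue A s \<Longrightarrow> transfer_function A B C s $ i $ j * poly (char_poly A) s = poly (N i j) s"
    using transfer_function_rational[OF A] by metis
  obtain N' where N': "\<And>s i j. \<not> eigenvalue A' s \<Longrightarrow> transfer_function A' B' C' s $ i $ j * poly (char_poly A') s = poly (N' i j) s"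
    using transfer_function_rational[OF A'] by metis
  have nz: "poly (char_poly A) s \<noteq> 0" "poly (char_poly A') s \<noteq> 0"
    using s eigenvalue_root_char_poly[OF A] eigenvalue_root_char_poly[OF A'] by auto
  have "transfer_function A' B' C' s $ i $ j = transfer_function A B C s $ i $ j" for i j
  proof -
    define D where "D = N i j * char_poly A' - N' i j * char_poly A"
    have "D = 0"
    proof (rule ccontr)
      assume "D \<noteq> 0"
      then have "finite {x. poly D x = 0}" by (rule poly_roots_finite)
      moreover have "U - {s. eigenvalue A s} - {s. eigenvalue A' s} \<subseteq> {x. poly D x = 0}"
      proof
        fix x assume x: "x \<in> U - {s. eigenvalue A s} - {s. eigenvalue A' s}"
        then show "x \<in> {x. poly D x = 0}"
          using eq[of x] by (simp add: D_def flip: N N')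
      qed
      ultimately have "finite (U - {s. eigenvalue A s} - {s. eigenvalue A' s})" by (rule finite_subset[rotated])
      then show False using U finite_eigenvalues[OF A] finite_eigenvalues[OF A'] by simp
    qed
    then have "poly (N i j) s * poly (char_poly A') s = poly (N' i j) s * poly (char_poly A) s"
      by (simp add: D_def flip: poly_mult)
    then show ?thesis using nz by (simp flip: N[OF s(1)] N'[OF s(2)])
  qed
  then show ?thesis by (simp add: Finite_Cartesian_Product.vec_eq_iff)
qed

lemma transfer_function_no_pole:
  fixes B :: "nat \<Rightarrow> complex^'m" and C :: "nat \<Rightarrow> complex^'p"
  assumes A: "A \<in> carrier_mat n n" and mu: "\<not> eigenvalue A \<mu>"
  shows "((\<lambda>s. (s - \<mu>) * transfer_function A B C s $ i $ j) \<longlongrightarrow> 0) (at \<mu>)"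
proof -
  obtain N where N: "\<And>s i j. \<not> eigenvalue A s \<Longrightarrow> transfer_function A B C s $ i $ j * poly (char_poly A) s = poly (N i j) s"
    using transfer_function_rational[OF A] by metis
  have nz: "poly (char_poly A) s \<noteq> 0" if "\<not> eigenvalue A s" for s
    using that eigenvalue_root_char_poly[OF A] by auto
  have "((\<lambda>s. (s - \<mu>) * (poly (N i j) s / poly (char_poly A) s)) \<longlongrightarrow> (\<mu> - \<mu>) * (poly (N i j) \<mu> / poly (char_poly A) \<mu>)) (at \<mu>)"
    using nz[OF mu] by (intro tendsto_intros poly_isCont[unfolded isCont_def]) auto
  then have lim: "((\<lambda>s. (s - \<mu>) * (poly (N i j) s / poly (char_poly A) s)) \<longlongrightarrow> 0) (at \<mu>)" by simp
  have "open (- {s. eigenvalue A s})" using finite_eigenvalues[OF A] by (intro open_Compl finite_imp_closed)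
  then have "\<forall>\<^sub>F s in at \<mu>. s \<in> - {s. eigenvalue A s}" using mu by (intro eventually_at_in_open') auto
  then have "\<forall>\<^sub>F s in at \<mu>. (s - \<mu>) * (poly (N i j) s / poly (char_poly A) s) = (s - \<mu>) * transfer_function A B C s $ i $ j"
    by eventually_elim (simp add: nz flip: N)
  then show ?thesis using lim by (rule Lim_transform_eventually[rotated])
qed

section \<open>Diagonal realizations and pole-residue forms\<close>

definition diag_mat_of :: "nat \<Rightarrow> (nat \<Rightarrow> complex) \<Rightarrow> complex mat" where
  "diag_mat_of n d = Matrix.mat n n (\<lambda>(i, j). if i = j then d i else 0)"

lemma diag_mat_of_carrier_mat [simp]: "diag_mat_of n d \<in> carrier_mat n n"
  by (simp add: diag_mat_of_def)

lemma diag_mat_of_eigenvalue: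
  assumes "eigenvalue (diag_mat_of n d) s" shows "\<exists>i<n. s = d i"
proof (rule ccontr)
  assume no: "\<not> ?thesis"
  obtain v where v: "v \<in> carrier_vec n" "v \<noteq> 0\<^sub>v n" "diag_mat_of n d *\<^sub>v v = s \<cdot>\<^sub>v v"
    using assms by (auto simp: eigenvalue_def eigenvector_def diag_mat_of_def)
  have "vec_index v i = 0" if i: "i < n" for i
  proof -
    have "vec_index (diag_mat_of n d *\<^sub>v v) i = (\<Sum>j = 0..<n. (if i = j then d i else 0) * vec_index v j)"
      using i v(1) by (simp add: diag_mat_of_def scalar_prod_def)
    also have "\<dots> = (\<Sum>j = 0..<n. if j = i then d i * vec_index v i else 0)"
      by (intro sum.cong refl) auto
    also have "\<dots> = d i * vec_index v i" using i by simp
    finally have "vec_index (diag_mat_of n d *\<^sub>v v) i = d i * vec_index v i" .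
    moreover have "vec_index (diag_mat_of n d *\<^sub>v v) i = s * vec_index v i" unfolding v(3) using v(1) i by simp
    ultimately show ?thesis using no i by (metis mult_right_cancel)
  qed
  then have "v = 0\<^sub>v n" using v(1) by (intro eq_vecI) auto
  with v(2) show False by simp
qed

lemma transfer_function_diag:
  fixes B :: "nat \<Rightarrow> complex^'m" and C :: "nat \<Rightarrow> complex^'p"
  assumes s: "\<And>i. i < n \<Longrightarrow> s \<noteq> d i"
  shows "transfer_function (diag_mat_of n d) B C s $ a $ b = (\<Sum>k<n. C k $ a * B k $ b / (s - d k))"
proof -
  have ne: "\<not> eigenvalue (diag_mat_of n d) s" using diag_mat_of_eigenvalue s by blast
  define X where "X = diag_mat_of n (\<lambda>i. 1 / (s - d i))"
  have "(s \<cdot>\<^sub>m 1\<^sub>m n - diag_mat_of n d) * X = 1 \<cdot>\<^sub>m 1\<^sub>m n"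
  proof (rule eq_matI)
    fix i j assume "i < dim_row (1 \<cdot>\<^sub>m 1\<^sub>m n :: complex mat)" "j < dim_col (1 \<cdot>\<^sub>m 1\<^sub>m n :: complex mat)"
    then have ij: "i < n" "j < n" by auto
    have "((s \<cdot>\<^sub>m 1\<^sub>m n - diag_mat_of n d) * X) $$ (i, j) =
      (\<Sum>k = 0..<n. (if i = k then s - d i else 0) * (if k = j then 1 / (s - d k) else 0))"
      using ij by (auto simp: X_def diag_mat_of_def scalar_prod_def intro!: sum.cong)
    also have "\<dots> = (\<Sum>k = 0..<n. if k = i then (s - d i) * (if i = j then 1 / (s - d i) else 0) else 0)"
      by (intro sum.cong refl) auto
    also have "\<dots> = (1 \<cdot>\<^sub>m 1\<^sub>m n) $$ (i, j)" using ij s[of i] by (cases "i = j") simp_all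
    finally show "((s \<cdot>\<^sub>m 1\<^sub>m n - diag_mat_of n d) * X) $$ (i, j) = (1 \<cdot>\<^sub>m 1\<^sub>m n) $$ (i, j)" .
  qed (auto simp: X_def diag_mat_of_def)
  then have "X = 1 \<cdot>\<^sub>m resolvent (diag_mat_of n d) s"
    by (intro resolvent_unique[OF _ ne]) (auto simp: X_def)
  then have R: "resolvent (diag_mat_of n d) s = X" by (intro eq_matI) auto
  have dim: "dim_row (diag_mat_of n d) = n" by (simp add: diag_mat_of_def)
  have "transfer_function (diag_mat_of n d) B C s $ a $ b = (\<Sum>k<n. \<Sum>l<n. if l = k then C k $ a * B k $ b / (s - d k) else 0)"
    unfolding transfer_function_def dim R vec_lambda_beta
    by (intro sum.cong refl) (auto simp: X_def diag_mat_of_def)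
  then show ?thesis by simp
qed

lemma pole_residue_limit:
  fixes b :: "nat \<Rightarrow> complex^'m" and c :: "nat \<Rightarrow> complex^'p"
  assumes inj: "inj_on lam {1..r}" and i: "i \<in> {1..r}"
  shows "((\<lambda>s. (s - lam i) * pole_residue r c b lam s $ a $ e) \<longlongrightarrow> c i $ a * cnj (b i $ e)) (at (lam i))"
proof -
  have ne: "lam i - lam j \<noteq> 0" if "j \<in> {1..r} - {i}" for j
    using inj_onD[OF inj, of i j] i that by auto
  have rem: "pole_residue r c b lam s $ a $ e =
    c i $ a * cnj (b i $ e) / (s - lam i) + (\<Sum>j\<in>{1..r} - {i}. c j $ a * cnj (b j $ e) / (s - lam j))" for s
    unfolding pole_residue_def vec_lambda_beta by (rule sum.remove[OF _ i]) simp
  have "((\<lambda>s. c i $ a * cnj (b i $ e) + (s - lam i) * (\<Sum>j\<in>{1..r} - {i}. c j $ a * cnj (b j $ e) / (s - lam j))) \<longlongrightarrow>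
     c i $ a * cnj (b i $ e) + (lam i - lam i) * (\<Sum>j\<in>{1..r} - {i}. c j $ a * cnj (b j $ e) / (lam i - lam j))) (at (lam i))"
    by (intro tendsto_intros ne)
  moreover have "\<forall>\<^sub>F s in at (lam i). c i $ a * cnj (b i $ e) + (s - lam i) * (\<Sum>j\<in>{1..r} - {i}. c j $ a * cnj (b j $ e) / (s - lam j)) =
     (s - lam i) * pole_residue r c b lam s $ a $ e"
    unfolding eventually_at_filter
    by (intro always_eventually allI impI)
       (simp only: rem distrib_left times_divide_eq_right right_minus_eq not_False_eq_True nonzero_mult_div_cancel_left)
  ultimately have "((\<lambda>s. (s - lam i) * pole_residue r c b lam s $ a $ e) \<longlongrightarrow>
     c i $ a * cnj (b i $ e) + (lam i - lam i) * (\<Sum>j\<in>{1..r} - {i}. c j $ a * cnj (b j $ e) / (lam i - lam j))) (at (lam i))"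
    by (rule Lim_transform_eventually)
  then show ?thesis by simp
qed

text \<open>\<open>Suc\<close> translates between poles numbered from 1 and states numbered from 0.
  The input rows are conjugated because the residues involve the adjoint of
  \<open>b\<close>.\<close>

lemma diag_realization:
  assumes "\<And>i. i \<in> {1..r} \<Longrightarrow> s \<noteq> lam i"
  shows "transfer_function (diag_mat_of r (\<lambda>k. lam (Suc k))) (\<lambda>k. cnj_vec (b (Suc k))) (\<lambda>k. c (Suc k)) s = pole_residue r c b lam s"
  using assms
  by (simp add: Finite_Cartesian_Product.vec_eq_iff transfer_function_diag pole_residue_def cnj_vec_def sum.atLeast1_atMost_eq)

text \<open>A realization of order \<open>k < r\<close> has at most \<open>k\<close> eigenvalues, so
  it misses one of the \<open>r\<close> distinct poles. Near that pole its transfer function is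
  bounded, whereas the pole-residue form has the residue \<open>c i * cnj (b i)\<close>, with some
  nonzero entry.\<close>

lemma pole_residue_stable:
  fixes b :: "nat \<Rightarrow> complex^'m" and c :: "nat \<Rightarrow> complex^'p"
  assumes inj: "inj_on lam {1..r}" and lam: "\<And>i. i \<in> {1..r} \<Longrightarrow> Re (lam i) < 0"
    and nz: "\<And>i. i \<in> {1..r} \<Longrightarrow> c i \<noteq> 0 \<and> b i \<noteq> 0"
    and F: "\<And>s. s \<in> right_half_plane \<Longrightarrow> F s = pole_residue r c b lam s"
  shows "F \<in> stable_systems r"
proof -
  define A where "A = diag_mat_of r (\<lambda>k. lam (Suc k))"
  define B where "B = (\<lambda>k. cnj_vec (b (Suc k)))"
  define C where "C = (\<lambda>k. c (Suc k))"
  have A: "A \<in> carrier_mat r r" by (simp add: A_def)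
  have eig: "\<exists>i\<in>{1..r}. s = lam i" if ev: "eigenvalue A s" for s
  proof -
    obtain k where "k < r" "s = lam (Suc k)" using diag_mat_of_eigenvalue[OF ev[unfolded A_def]] by blast
    then show ?thesis by (intro bexI[of _ "Suc k"]) auto
  qed
  have T: "transfer_function A B C s = pole_residue r c b lam s" if "\<And>i. i \<in> {1..r} \<Longrightarrow> s \<noteq> lam i" for s
    unfolding A_def B_def C_def by (rule diag_realization[OF that])
  have "hurwitz A" unfolding hurwitz_def using eig lam by blast
  moreover have "minimal_realization r A B C"
    unfolding minimal_realization_def
  proof (intro conjI A notI)
    assume "\<exists>k<r. \<exists>A'\<in>carrier_mat k k. \<exists>B' C'. \<forall>s. \<not> eigenvalue A s \<and> \<not> eigenvalue A' s \<longrightarrow> transfer_function A' B' C' s = transfer_function A B C s"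
    then obtain k A' B' C' where k: "k < r" and A': "A' \<in> carrier_mat k k"
      and eq': "\<forall>s. \<not> eigenvalue A s \<and> \<not> eigenvalue A' s \<longrightarrow> transfer_function A' B' C' s = transfer_function A B C s"
      by (elim exE conjE bexE)
    have eq: "transfer_function A' B' C' s = transfer_function A B C s" if "\<not> eigenvalue A s" "\<not> eigenvalue A' s" for s
      using eq' that by simp
    have "\<not> lam ` {1..r} \<subseteq> {s. eigenvalue A' s}"
    proof
      assume "lam ` {1..r} \<subseteq> {s. eigenvalue A' s}"
      then have "card (lam ` {1..r}) \<le> k"
        using card_mono[OF finite_eigenvalues[OF A']] card_eigenvalues_le[OF A'] by (meson order.trans)
      then show False using card_image[OF inj] k by simp
    qed
    then obtain i where i: "i \<in> {1..r}" "\<not> eigenvalue A' (lam i)" by blast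
    obtain a e where ae: "c i $ a \<noteq> 0" "b i $ e \<noteq> 0"
      using nz[OF i(1)] by (auto simp: Finite_Cartesian_Product.vec_eq_iff)
    have "finite ({s. eigenvalue A' s} \<union> (lam ` {1..r} - {lam i}))" using finite_eigenvalues[OF A'] by auto
    then have "open (- ({s. eigenvalue A' s} \<union> (lam ` {1..r} - {lam i})))" by (intro open_Compl finite_imp_closed)
    then have "\<forall>\<^sub>F s in at (lam i). s \<in> - ({s. eigenvalue A' s} \<union> (lam ` {1..r} - {lam i})) - {lam i}"
      using i by (intro eventually_at_in_open) auto
    then have "\<forall>\<^sub>F s in at (lam i). (s - lam i) * transfer_function A' B' C' s $ a $ e = (s - lam i) * pole_residue r c b lam s $ a $ e"
    proof eventually_elim
      case (elim s)
      then have sl: "\<And>i. i \<in> {1..r} \<Longrightarrow> s \<noteq> lam i" by auto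
      then have "\<not> eigenvalue A s" using eig by blast
      then show ?case using eq[of s] elim T[OF sl] by simp
    qed
    with transfer_function_no_pole[OF A' i(2)]
    have "((\<lambda>s. (s - lam i) * pole_residue r c b lam s $ a $ e) \<longlongrightarrow> 0) (at (lam i))"
      by (rule Lim_transform_eventually)
    with pole_residue_limit[OF inj i(1)] have "c i $ a * cnj (b i $ e) = 0"
      by (rule tendsto_unique[OF at_neq_bot])
    then show False using ae by simp
  qed
  moreover have "F s = transfer_function A B C s" if "s \<in> right_half_plane" for s
  proof -
    have "Re s > 0" using that by (simp add: right_half_plane_def)
    then have "s \<noteq> lam i" if "i \<in> {1..r}" for i using lam[OF that] by auto
    then show ?thesis using T F that by simp
  qed
  ultimately show ?thesis unfolding stable_systems_def mem_Collect_eq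
    by (intro exI[of _ A] exI[of _ B] exI[of _ C] conjI A ballI)
qed

lemma infinite_right_half_plane: "infinite right_half_plane"
proof
  assume "finite right_half_plane"
  then have "finite (Re ` right_half_plane)" by simp
  moreover have "{0<..} \<subseteq> Re ` right_half_plane"
    by (auto simp: right_half_plane_def image_iff intro!: exI[of _ "of_real _"])
  ultimately show False using infinite_Ioi finite_subset by blast
qed

text \<open>If \<open>c i\<close> or \<open>b i\<close> vanished, the remaining terms, enumerated by
  \<open>e\<close>, would form a diagonal realization of order \<open>r - 1\<close>. With a nonzero
  residue, \<open>lam i\<close> is a genuine singularity, and outside the open left half-plane a
  Hurwitz realization has none.\<close>

lemma stable_pole_residue_nondegenerate:
  fixes b :: "nat \<Rightarrow> complex^'m" and c :: "nat \<Rightarrow> complex^'p"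
  assumes F: "F \<in> stable_systems r" and eq: "\<And>s. s \<in> right_half_plane \<Longrightarrow> F s = pole_residue r c b lam s"
    and inj: "inj_on lam {1..r}" and i: "i \<in> {1..r}"
  shows "c i \<noteq> 0" "b i \<noteq> 0" "Re (lam i) < 0"
proof -
  obtain A B C where A: "A \<in> carrier_mat r r" and hur: "hurwitz A" and min: "minimal_realization r A B C"
    and T: "\<forall>s\<in>right_half_plane. F s = transfer_function A B C s"
    using F unfolding stable_systems_def mem_Collect_eq by (elim exE conjE)
  have "\<not> (c i = 0 \<or> b i = 0)"
  proof
    assume deg: "c i = 0 \<or> b i = 0"
    have "finite ({1..r} - {i})" by simp
    then obtain e where "bij_betw e {0..<card ({1..r} - {i})} ({1..r} - {i})"
      using ex_bij_betw_nat_finite by blast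
    moreover have "{0..<card ({1..r} - {i})} = {..<r - 1}" using i by (simp add: lessThan_atLeast0)
    ultimately have e: "bij_betw e {..<r - 1} ({1..r} - {i})" by simp
    define A' where "A' = diag_mat_of (r - 1) (lam \<circ> e)"
    define B' where "B' = (\<lambda>k. cnj_vec (b (e k)))"
    define C' where "C' = (\<lambda>k. c (e k))"
    have A': "A' \<in> carrier_mat (r - 1) (r - 1)" by (simp add: A'_def)
    have T': "transfer_function A' B' C' s = F s" if s: "s \<in> right_half_plane - lam ` {1..r}" for s
    proof -
      have "\<And>k. k < r - 1 \<Longrightarrow> s \<noteq> (lam \<circ> e) k" using s bij_betwE[OF e] by auto

      then have tf: "transfer_function A' B' C' s $ p $ q = (\<Sum>k<r - 1. C' k $ p * B' k $ q / (s - (lam \<circ> e) k))" for p q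
        unfolding A'_def by (rule transfer_function_diag)
      have "transfer_function A' B' C' s $ p $ q = pole_residue r c b lam s $ p $ q" for p q
      proof -
        have "transfer_function A' B' C' s $ p $ q = (\<Sum>k<r - 1. c (e k) $ p * cnj (b (e k) $ q) / (s - lam (e k)))"
          unfolding tf by (simp add: B'_def C'_def cnj_vec_def)
        also have "\<dots> = (\<Sum>j\<in>{1..r} - {i}. c j $ p * cnj (b j $ q) / (s - lam j))"
          by (rule sum.reindex_bij_betw[OF e])
        also have "\<dots> = (\<Sum>j\<in>{1..r}. c j $ p * cnj (b j $ q) / (s - lam j))"
          using deg by (intro sum.mono_neutral_left) auto
        finally show ?thesis by (simp add: pole_residue_def)
      qed
      then show ?thesis using s eq by (simp add: Finite_Cartesian_Product.vec_eq_iff)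
    qed
    have inf: "infinite (right_half_plane - lam ` {1..r})" using infinite_right_half_plane by simp
    have eqs: "\<forall>s. \<not> eigenvalue A s \<and> \<not> eigenvalue A' s \<longrightarrow> transfer_function A' B' C' s = transfer_function A B C s"
    proof (intro allI impI)
      fix s assume "\<not> eigenvalue A s \<and> \<not> eigenvalue A' s"
      then have s: "\<not> eigenvalue A s" "\<not> eigenvalue A' s" by auto
      show "transfer_function A' B' C' s = transfer_function A B C s"
        by (rule transfer_function_identity[OF A A' inf _ s]) (simp add: T T')
    qed
    have "\<exists>B' C'. \<forall>s. \<not> eigenvalue A s \<and> \<not> eigenvalue A' s \<longrightarrow> transfer_function A' B' C' s = transfer_function A B C s"
      by (rule exI[of _ B'], rule exI[of _ C'], rule eqs)
    then have red: "\<exists>A'\<in>carrier_mat (r - 1) (r - 1). \<exists>B' C'. \<forall>s. \<not> eigenvalue A s \<and> \<not> eigenvalue A' s \<longrightarrow> transfer_function A' B' C' s = transfer_function A B C s"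
      by (rule bexI[OF _ A'])
    have "r - 1 < r" using i by auto
    with red have "\<exists>k<r. \<exists>A'\<in>carrier_mat k k. \<exists>B' C'. \<forall>s. \<not> eigenvalue A s \<and> \<not> eigenvalue A' s \<longrightarrow> transfer_function A' B' C' s = transfer_function A B C s"
      by (intro exI[of _ "r - 1"] conjI)
    with min show False unfolding minimal_realization_def by (elim conjE notE)
  qed
  then show nz: "c i \<noteq> 0" "b i \<noteq> 0" by auto
  show "Re (lam i) < 0"
  proof (rule ccontr)
    assume re: "\<not> Re (lam i) < 0"
    then have "\<not> eigenvalue A (lam i)" using hur by (auto simp: hurwitz_def)
    obtain a e where ae: "c i $ a \<noteq> 0" "b i $ e \<noteq> 0"
      using nz by (auto simp: Finite_Cartesian_Product.vec_eq_iff)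
    \<comment> \<open>The two expressions agree on the open half-plane only, and
      \<open>lam i\<close> may lie on its boundary, so the limits are taken from inside.\<close>
    let ?at = "at (lam i) within right_half_plane"
    have nb: "?at \<noteq> bot"
    proof -
      have "lam i \<in> closure (right_half_plane - {lam i})"
      proof (rule closure_sequential[THEN iffD2], intro exI[of _ "\<lambda>n. lam i + of_real (1 / real (Suc n))"] conjI allI)
        show "(\<lambda>n. lam i + of_real (1 / real (Suc n))) \<longlonglongrightarrow> lam i"
          using tendsto_add[OF tendsto_const tendsto_of_real[OF LIMSEQ_Suc[OF lim_1_over_n]], of "lam i"] by simp
        show "lam i + of_real (1 / real (Suc n)) \<in> right_half_plane - {lam i}" for n
        proof -
          have "1 / real (Suc n) > 0" by simp
          then show ?thesis using re by (simp add: right_half_plane_def add_nonneg_pos del: of_real_divide of_nat_Suc)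
        qed
      qed
      then show ?thesis by (simp only: trivial_limit_within islimpt_in_closure not_not not_False_eq_True)
    qed
    have "((\<lambda>s. (s - lam i) * transfer_function A B C s $ a $ e) \<longlongrightarrow> 0) ?at"
      by (rule tendsto_within_subset[OF transfer_function_no_pole[OF A]]) (use \<open>\<not> eigenvalue A (lam i)\<close> in auto)
    moreover have "\<forall>\<^sub>F s in ?at. (s - lam i) * transfer_function A B C s $ a $ e = (s - lam i) * pole_residue r c b lam s $ a $ e"
      unfolding eventually_at_filter using T eq by (intro always_eventually) simp
    ultimately have "((\<lambda>s. (s - lam i) * pole_residue r c b lam s $ a $ e) \<longlongrightarrow> 0) ?at"
      by (rule Lim_transform_eventually)
    moreover have "((\<lambda>s. (s - lam i) * pole_residue r c b lam s $ a $ e) \<longlongrightarrow> c i $ a * cnj (b i $ e)) ?at"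
      by (rule tendsto_within_subset[OF pole_residue_limit[OF inj i]]) auto
    ultimately have "0 = c i $ a * cnj (b i $ e)" by (rule tendsto_unique[OF nb])
    then show False using ae by simp
  qed
qed

section \<open>Partial fractions with double poles\<close>

lemma prod_linear_degree: "finite A \<Longrightarrow> degree (\<Prod>a\<in>A. [:- f a, 1:]) = card A" for f :: "'b \<Rightarrow> complex"
  by (subst degree_prod_eq_sum_degree) auto

text \<open>Lagrange interpolation of \<open>p\<close> at the nodes, divided by the node
  polynomial.\<close>

lemma lagrange_partial_fraction:
  fixes p :: "complex poly"
  assumes N: "finite N" and deg: "degree p < card N" and x: "x \<notin> N"
  shows "poly p x / (\<Prod>w\<in>N. (x - w)) = (\<Sum>w\<in>N. poly p w / (\<Prod>v\<in>N-{w}. (w - v)) / (x - w))"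
proof -
  define l where "l w = Polynomial.smult (poly p w / (\<Prod>v\<in>N-{w}. (w - v))) (\<Prod>v\<in>N-{w}. [:- v, 1:])" for w
  have pl: "poly (l w) z = poly p w / (\<Prod>v\<in>N-{w}. (w - v)) * (\<Prod>v\<in>N-{w}. (z - v))" for w z
    by (simp add: l_def poly_prod)
  have nz: "(\<Prod>v\<in>N-{w}. (w - v)) \<noteq> 0" if "w \<in> N" for w
    using N by (subst prod_zero_iff) auto
  have "p = (\<Sum>w\<in>N. l w)"
  proof (rule poly_eqI_degree[of N])
    fix z assume z: "z \<in> N"
    have "poly (\<Sum>w\<in>N. l w) z = (\<Sum>w\<in>N. if w = z then poly p z else 0)"
      unfolding poly_sum
    proof (rule sum.cong[OF refl])
      fix w assume w: "w \<in> N"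
      show "poly (l w) z = (if w = z then poly p z else 0)"
      proof (cases "w = z")
        case True then show ?thesis using nz[OF w] by (simp add: pl)
      next
        case False
        then have "(\<Prod>v\<in>N-{w}. (z - v)) = 0" using N z by (intro prod_zero) auto
        then show ?thesis using False by (simp add: pl)
      qed
    qed
    then show "poly p z = poly (\<Sum>w\<in>N. l w) z" using z N by simp
  next
    show "degree p < card N" by fact
    have "degree (l w) \<le> card N - 1" if "w \<in> N" for w
    proof -
      have "degree (l w) \<le> degree (\<Prod>v\<in>N-{w}. [:- v, 1:])" unfolding l_def by (rule degree_smult_le)
      also have "\<dots> = card N - 1" using N that prod_linear_degree[of "N - {w}" "\<lambda>v. v"] by simp
      finally show ?thesis .
    qed
    then have "degree (\<Sum>w\<in>N. l w) \<le> card N - 1" by (intro degree_sum_le N)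
    then show "degree (\<Sum>w\<in>N. l w) < card N" using deg by linarith
  qed
  then have "poly p x = (\<Sum>w\<in>N. poly (l w) x)" by (metis poly_sum)
  then have "poly p x / (\<Prod>w\<in>N. (x - w)) = (\<Sum>w\<in>N. poly (l w) x / (\<Prod>w\<in>N. (x - w)))"
    by (simp add: sum_divide_distrib)
  also have "\<dots> = (\<Sum>w\<in>N. poly p w / (\<Prod>v\<in>N-{w}. (w - v)) / (x - w))"
  proof (rule sum.cong[OF refl])
    fix w assume w: "w \<in> N"
    have "(\<Prod>v\<in>N. (x - v)) = (x - w) * (\<Prod>v\<in>N-{w}. (x - v))" by (rule prod.remove[OF N w])
    moreover have "(\<Prod>v\<in>N-{w}. (x - v)) \<noteq> 0" using N x by (subst prod_zero_iff) auto
    ultimately show "poly (l w) x / (\<Prod>w\<in>N. (x - w)) = poly p w / (\<Prod>v\<in>N-{w}. (w - v)) / (x - w)"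
      unfolding pl by simp
  qed
  finally show ?thesis .
qed

text \<open>The residue of \<open>p(x) / \<Prod>(x - w)\<close> at a node. Used as weights, these
  residues turn a sum of Cauchy kernels over the nodes into a value of \<open>p\<close>, so zeros of
  \<open>p\<close> prescribe which poles are not seen. The value 0 off \<open>N\<close> allows
  summation over larger node sets.\<close>

definition lagrange_weight :: "complex set \<Rightarrow> complex poly \<Rightarrow> complex \<Rightarrow> complex" where
  "lagrange_weight N p w = (if w \<in> N then poly p w / (\<Prod>v\<in>N-{w}. (w - v)) else 0)"

lemma lagrange_weight_sum:
  assumes "finite N" "degree p < card N" "x \<notin> N"
  shows "(\<Sum>w\<in>N. lagrange_weight N p w / (w - x)) = - (poly p x / (\<Prod>w\<in>N. (x - w)))"
proof -
  have "(\<Sum>w\<in>N. lagrange_weight N p w / (w - x)) = (\<Sum>w\<in>N. - (poly p w / (\<Prod>v\<in>N-{w}. (w - v)) / (x - w)))"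
    by (intro sum.cong refl) (metis lagrange_weight_def minus_diff_eq minus_divide_right)
  then show ?thesis by (simp add: lagrange_partial_fraction[OF assms] sum_negf)
qed

text \<open>A zero of the polynomial at \<open>x\<close> cancels one of the two factors
  \<open>w - x\<close>, which leads back to the first-order sum for the cofactor.\<close>

lemma lagrange_weight_sum_sq:
  assumes "finite N" "degree ([:-x, 1:] * q) < card N" "x \<notin> N"
  shows "(\<Sum>w\<in>N. lagrange_weight N ([:-x, 1:] * q) w / (w - x)\<^sup>2) = - (poly q x / (\<Prod>w\<in>N. (x - w)))"
proof -
  have "degree q < card N"
  proof (cases "q = 0")
    case False
    then have "degree ([:-x, 1:] * q) = degree [:-x, 1:] + degree q" by (intro degree_mult_eq) auto
    then show ?thesis using assms(2) by simp
  qed (use assms(2) in simp)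
  moreover have "(\<Sum>w\<in>N. lagrange_weight N ([:-x, 1:] * q) w / (w - x)\<^sup>2) = (\<Sum>w\<in>N. lagrange_weight N q w / (w - x))"
  proof (rule sum.cong[OF refl])
    fix w assume "w \<in> N"
    then have "w - x \<noteq> 0" using assms(3) by auto
    moreover have "poly ([:-x, 1:] * q) w = (w - x) * poly q w" by (simp add: algebra_simps)
    ultimately show "lagrange_weight N ([:-x, 1:] * q) w / (w - x)\<^sup>2 = lagrange_weight N q w / (w - x)"
      unfolding lagrange_weight_def by (simp add: power2_eq_square)
  qed
  ultimately show ?thesis using lagrange_weight_sum[OF assms(1) _ assms(3), of q] by simp
qed

text \<open>A dual basis at the pole \<open>lam i\<close>: \<open>p\<close> detects the coefficient
  of the simple pole there and \<open>q\<close> that of the double pole, while both ignore the other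
  poles up to second order. The forbidden set \<open>X\<close> makes it possible to keep several
  node sets disjoint.\<close>

lemma dual_weights:
  fixes lam :: "nat \<Rightarrow> complex"
  assumes I: "finite I" "i \<in> I" and inj: "inj_on lam I" and lam: "\<forall>j\<in>I. Re (lam j) < 0" and X: "finite X"
  shows "\<exists>N p q. finite N \<and> N \<subseteq> right_half_plane - X \<and> (\<forall>w. w \<notin> N \<longrightarrow> p w = 0) \<and>
    (\<forall>j\<in>I. (\<Sum>w\<in>N. p w / (w - lam j)) = (if j = i then 1 else 0)) \<and>
    (\<forall>j\<in>I. (\<Sum>w\<in>N. p w / (w - lam j)\<^sup>2) = 0) \<and>
    (\<forall>j\<in>I. (\<Sum>w\<in>N. q w / (w - lam j)) = 0) \<and>
    (\<forall>j\<in>I. (\<Sum>w\<in>N. q w / (w - lam j)\<^sup>2) = (if j = i then 1 else 0))"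
proof -
  have "infinite (right_half_plane - X)" using infinite_right_half_plane X by simp
  then obtain N where N: "finite N" "card N = 2 * card I" "N \<subseteq> right_half_plane - X"
    by (meson infinite_arbitrarily_large)
  have out: "lam j \<notin> N" if "j \<in> I" for j using N(3) lam that by (fastforce simp: right_half_plane_def)
  define om where "om x = (\<Prod>w\<in>N. (x - w))" for x :: complex
  have om: "om (lam j) \<noteq> 0" if "j \<in> I" for j
    unfolding om_def using N(1) out[OF that] by (subst prod_zero_iff) auto
  \<comment> \<open>Double zeros at all other poles kill both sums there. The degree is
    \<open>2 * card I - 2\<close>, so even after one more linear factor it stays below the
    \<open>2 * card I\<close> nodes.\<close>
  define e where "e = (\<Prod>j\<in>I-{i}. [:- lam j, 1:]\<^sup>2)"
  have card: "card I > 0" using I by (auto simp: card_gt_0_iff)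
  have ei: "poly e (lam i) \<noteq> 0"
    unfolding e_def poly_prod using inj I by (subst prod_zero_iff) (auto simp: inj_on_def)
  have dege: "degree e = 2 * (card I - 1)"
    unfolding e_def by (subst degree_prod_eq_sum_degree) (auto simp: degree_power_eq I)
  have e0: "e \<noteq> 0" using ei by auto
  have deg1: "degree e < card N" using dege card N(2) by simp
  have deg2: "degree ([:- lam i, 1:] * e) < card N"
    using dege card N(2) e0 by (subst degree_mult_eq) auto
  have fac: "\<exists>g. e = [:- lam j, 1:] * ([:- lam j, 1:] * g)" if "j \<in> I" "j \<noteq> i" for j
  proof -
    have "e = [:- lam j, 1:]\<^sup>2 * (\<Prod>k\<in>I-{i}-{j}. [:- lam k, 1:]\<^sup>2)"
      unfolding e_def using that I by (intro prod.remove) auto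
    then show ?thesis by (metis mult.assoc power2_eq_square)
  qed
  define e' where "e' = [:- lam i, 1:] * e"
  have e1: "(\<Sum>w\<in>N. lagrange_weight N e w / (w - lam j)) = (if j = i then - (poly e (lam i) / om (lam i)) else 0)" if j: "j \<in> I" for j
  proof (cases "j = i")
    case False
    obtain g where "e = [:- lam j, 1:] * ([:- lam j, 1:] * g)" using fac[OF j False] by blast
    then have "poly e (lam j) = 0" by simp
    then show ?thesis using lagrange_weight_sum[OF N(1) deg1 out[OF j]] False by simp
  qed (use lagrange_weight_sum[OF N(1) deg1 out[OF j]] in \<open>simp add: om_def\<close>)
  have e2: "(\<Sum>w\<in>N. lagrange_weight N e w / (w - lam j)\<^sup>2) = 0" if j: "j \<in> I" "j \<noteq> i" for j
  proof -
    obtain g where g: "e = [:- lam j, 1:] * ([:- lam j, 1:] * g)" using fac[OF j] by blast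
    show ?thesis
      using lagrange_weight_sum_sq[of N "lam j" "[:- lam j, 1:] * g"] N(1) deg1 out[OF j(1)] unfolding g by simp
  qed
  have e'1: "(\<Sum>w\<in>N. lagrange_weight N e' w / (w - lam j)) = 0" if j: "j \<in> I" for j
  proof -
    have "poly e' (lam j) = 0"
    proof (cases "j = i")
      case False
      obtain g where "e = [:- lam j, 1:] * ([:- lam j, 1:] * g)" using fac[OF j False] by blast
      then show ?thesis by (simp add: e'_def)
    qed (simp add: e'_def)
    then show ?thesis using lagrange_weight_sum[OF N(1) deg2 out[OF j]] by (simp add: e'_def)
  qed
  have e'2: "(\<Sum>w\<in>N. lagrange_weight N e' w / (w - lam j)\<^sup>2) = (if j = i then - (poly e (lam i) / om (lam i)) else 0)" if j: "j \<in> I" for j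
  proof (cases "j = i")
    case True
    then show ?thesis using lagrange_weight_sum_sq[OF N(1) deg2 out[OF I(2)]] by (simp add: e'_def om_def)
  next
    case False
    obtain g where g: "e = [:- lam j, 1:] * ([:- lam j, 1:] * g)" using fac[OF j False] by blast
    have "e' = [:- lam j, 1:] * ([:- lam j, 1:] * ([:- lam i, 1:] * g))" unfolding e'_def g by (simp only: mult_ac)
    then show ?thesis
      using lagrange_weight_sum_sq[of N "lam j" "[:- lam j, 1:] * ([:- lam i, 1:] * g)"] N(1) deg2 out[OF j] False
      by (simp only: e'_def[symmetric]) simp
  qed
  \<comment> \<open>\<open>k\<close> is the common nonzero value of the first-order sum of
    \<open>e\<close> and the second-order sum of \<open>e'\<close> at \<open>lam i\<close>. The
    second-order sum \<open>t\<close> of \<open>e\<close> there is unwanted and is removed from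
    \<open>p\<close> by subtracting a multiple of \<open>q\<close>.\<close>
  define k where "k = - (poly e (lam i) / om (lam i))"
  have k: "k \<noteq> 0" using ei om[OF I(2)] by (simp add: k_def)
  define t where "t = (\<Sum>w\<in>N. lagrange_weight N e w / (w - lam i)\<^sup>2)"
  define q where "q w = lagrange_weight N e' w / k" for w
  define p where "p w = lagrange_weight N e w / k - t / k * q w" for w
  have q: "(\<Sum>w\<in>N. q w / z w) = (\<Sum>w\<in>N. lagrange_weight N e' w / z w) / k" for z :: "complex \<Rightarrow> complex"
    by (simp add: q_def sum_divide_distrib mult.commute)
  have q1: "(\<Sum>w\<in>N. q w / (w - lam j)) = 0" if "j \<in> I" for j
    by (simp add: q e'1[OF that])
  have q2: "(\<Sum>w\<in>N. q w / (w - lam j)\<^sup>2) = (if j = i then 1 else 0)" if "j \<in> I" for j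
    unfolding q e'2[OF that] using k by (simp add: k_def[symmetric])
  have p: "(\<Sum>w\<in>N. p w / z w) = (\<Sum>w\<in>N. lagrange_weight N e w / z w) / k - t / k * (\<Sum>w\<in>N. q w / z w)" for z :: "complex \<Rightarrow> complex"
    by (simp add: p_def sum_divide_distrib sum_distrib_left sum_subtractf[symmetric] diff_divide_distrib mult.commute)
  show ?thesis
  proof (rule exI[of _ N], rule exI[of _ p], rule exI[of _ q], intro conjI ballI allI impI N(1) N(3))
    show "p w = 0" if "w \<notin> N" for w using that by (simp add: p_def q_def lagrange_weight_def)
  next
    fix j assume j: "j \<in> I"
    show "(\<Sum>w\<in>N. q w / (w - lam j)) = 0" by (rule q1[OF j])
    show "(\<Sum>w\<in>N. q w / (w - lam j)\<^sup>2) = (if j = i then 1 else 0)" by (rule q2[OF j])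
    show "(\<Sum>w\<in>N. p w / (w - lam j)) = (if j = i then 1 else 0)"
      unfolding p e1[OF j] q1[OF j] using k by (simp add: k_def[symmetric])
    show "(\<Sum>w\<in>N. p w / (w - lam j)\<^sup>2) = 0"
      unfolding p q2[OF j] using e2[OF j] by (cases "j = i") (simp_all add: t_def)
  qed
qed

text \<open>For a new pole, subtracting \<open>b D\<close> and then \<open>a D\<close> makes the
  numerator divisible by \<open>s - lam i\<close> twice; the quotient belongs to the induction
  hypothesis.\<close>

lemma partial_fractions:
  fixes lam :: "nat \<Rightarrow> complex"
  assumes "finite I" "inj_on lam I"
  shows "\<exists>K R S. \<forall>s. (\<forall>j\<in>I. s \<noteq> lam j) \<longrightarrow>
    poly M s / (\<Prod>j\<in>I. (s - lam j)\<^sup>2) = poly K s + (\<Sum>j\<in>I. R j / (s - lam j) + S j / (s - lam j)\<^sup>2)"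
  using assms
proof (induction I arbitrary: M rule: finite_induct)
  case empty
  show ?case by (intro exI[of _ M]) auto
next
  case (insert i I)
  define D where "D = (\<Prod>j\<in>I. [:- lam j, 1:]\<^sup>2)"
  have Dp: "poly D s = (\<Prod>j\<in>I. (s - lam j)\<^sup>2)" for s by (simp add: D_def poly_prod)
  have D0: "poly D (lam i) \<noteq> 0"
    unfolding Dp using insert by (subst prod_zero_iff) (auto simp: inj_on_def)
  define b where "b = poly M (lam i) / poly D (lam i)"
  have "poly (M - Polynomial.smult b D) (lam i) = 0" using D0 by (simp add: b_def)
  then obtain M1 where M1: "M - Polynomial.smult b D = [:- lam i, 1:] * M1" unfolding poly_eq_0_iff_dvd by (elim dvdE)
  define a where "a = poly M1 (lam i) / poly D (lam i)"
  have "poly (M1 - Polynomial.smult a D) (lam i) = 0" using D0 by (simp add: a_def)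
  then obtain M2 where M2: "M1 - Polynomial.smult a D = [:- lam i, 1:] * M2" unfolding poly_eq_0_iff_dvd by (elim dvdE)
  have inj: "inj_on lam I" using insert by auto
  obtain K R S where KRS: "\<forall>s. (\<forall>j\<in>I. s \<noteq> lam j) \<longrightarrow>
    poly M2 s / (\<Prod>j\<in>I. (s - lam j)\<^sup>2) = poly K s + (\<Sum>j\<in>I. R j / (s - lam j) + S j / (s - lam j)\<^sup>2)"
    using insert.IH[OF inj, of M2] by (elim exE)
  show ?case
  proof (intro exI allI impI)
    fix s assume s: "\<forall>j\<in>insert i I. s \<noteq> lam j"
    define y where "y = s - lam i"
    have y: "y \<noteq> 0" using s by (simp add: y_def)
    have Ds: "poly D s \<noteq> 0" unfolding Dp using insert(1) s by (subst prod_zero_iff) auto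
    have 1: "poly M s = b * poly D s + y * poly M1 s"
      using arg_cong[OF M1, of "\<lambda>p. poly p s"] by (simp add: y_def algebra_simps)
    have 2: "poly M1 s = a * poly D s + y * poly M2 s"
      using arg_cong[OF M2, of "\<lambda>p. poly p s"] by (simp add: y_def algebra_simps)
    have "poly M s / (y\<^sup>2 * poly D s) = a / y + b / y\<^sup>2 + poly M2 s / poly D s"
      unfolding 1 2 using y Ds by (simp add: field_simps power2_eq_square)
    also have "poly M2 s / poly D s = poly K s + (\<Sum>j\<in>I. R j / (s - lam j) + S j / (s - lam j)\<^sup>2)"
      using KRS s unfolding Dp by simp
    finally show "poly M s / (\<Prod>j\<in>insert i I. (s - lam j)\<^sup>2) =
      poly K s + (\<Sum>j\<in>insert i I. (R(i := a)) j / (s - lam j) + (S(i := b)) j / (s - lam j)\<^sup>2)"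
      using insert(1,2) by (simp add: Dp y_def sum.insert_if add_ac cong: sum.cong_simp)
        (intro sum.cong refl, auto)
  qed
qed

text \<open>With \<beta> fixed, \<open>g\<close> is annihilated by every finite weight that
  annihilates the kernels \<open>1 / (s - lam i)\<close>, hence is a combination of these finitely
  many kernels. Solving the definition of \<open>g\<close> for \<open>f\<close> then shows that
  \<open>f\<close> times the square of \<open>d\<close> is a polynomial.\<close>

lemma double_difference_form:
  fixes lam :: "nat \<Rightarrow> complex" and f :: "complex \<Rightarrow> complex"
  assumes I: "finite I" and inj: "inj_on lam I" and lam: "\<And>j. j \<in> I \<Longrightarrow> Re (lam j) < 0"
    and cont: "continuous_on right_half_plane f"
    and dd: "\<And>N' N \<alpha> \<beta>. finite N' \<Longrightarrow> finite N \<Longrightarrow> N' \<subseteq> right_half_plane \<Longrightarrow> N \<subseteq> right_half_plane \<Longrightarrow> N' \<inter> N = {} \<Longrightarrow>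
      (\<And>i. i \<in> I \<Longrightarrow> (\<Sum>s\<in>N'. \<alpha> s / (s - lam i)) = 0) \<Longrightarrow> (\<And>i. i \<in> I \<Longrightarrow> (\<Sum>w\<in>N. \<beta> w / (w - lam i)) = 0) \<Longrightarrow>
      (\<Sum>s\<in>N'. \<alpha> s * (\<Sum>w\<in>N. \<beta> w * (f s - f w) / (s - w))) = 0"
  shows "\<exists>K R S. \<forall>s\<in>right_half_plane. f s = poly K s + (\<Sum>j\<in>I. R j / (s - lam j) + S j / (s - lam j)\<^sup>2)"
proof -
  have lam': "\<forall>j\<in>I. Re (lam j) < 0" using lam by blast
  have lout: "s - lam j \<noteq> 0" if "j \<in> I" "s \<in> right_half_plane" for s j
    using lam[OF that(1)] that(2) by (auto simp: right_half_plane_def)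
  obtain N where N: "finite N" "card N = Suc (card I)" "N \<subseteq> right_half_plane"
    using infinite_arbitrarily_large[OF infinite_right_half_plane] by metis
  have lN: "lam j \<notin> N" if "j \<in> I" for j using N(3) lam[OF that] by (auto simp: right_half_plane_def)
  define d where "d = (\<Prod>j\<in>I. [:- lam j, 1:])"
  have dp: "poly d s = (\<Prod>j\<in>I. (s - lam j))" for s by (simp add: d_def poly_prod)
  have degd: "degree d < card N" using prod_linear_degree[OF I, of lam] N(2) by (simp add: d_def)
  have d0: "poly d (lam j) = 0" if "j \<in> I" for j unfolding dp using I that by (intro prod_zero) auto
  \<comment> \<open>Since \<open>d\<close> vanishes at every pole, these weights annihilate all
    kernels; one node more than poles gives room for its degree. Their own Cauchy sum
    \<open>poly d s / om s\<close> is nonzero off the poles and nodes, which is what allows division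
    later.\<close>
  define \<beta> where "\<beta> = lagrange_weight N d"
  have kb: "(\<Sum>w\<in>N. \<beta> w / (w - lam i)) = 0" if "i \<in> I" for i
    unfolding \<beta>_def using lagrange_weight_sum[OF N(1) degd lN[OF that]] d0[OF that] by simp
  define om where "om s = (\<Prod>w\<in>N. (s - w))" for s
  have om: "om s \<noteq> 0" if "s \<notin> N" for s unfolding om_def using N(1) that by (subst prod_zero_iff) auto
  have bsum: "(\<Sum>w\<in>N. \<beta> w / (s - w)) = poly d s / om s" if "s \<notin> N" for s
  proof -
    have "(\<Sum>w\<in>N. \<beta> w / (s - w)) = - (\<Sum>w\<in>N. \<beta> w / (w - s))"
      unfolding sum_negf[symmetric] by (intro sum.cong refl) (metis minus_diff_eq minus_divide_right)
    then show ?thesis unfolding \<beta>_def lagrange_weight_sum[OF N(1) degd that] om_def by simp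
  qed
  define g where "g s = (\<Sum>w\<in>N. \<beta> w * (f s - f w) / (s - w))" for s
  have "\<forall>j. \<exists>n. j \<in> I \<longrightarrow> finite (fst n) \<and> fst n \<subseteq> right_half_plane - N \<and> (\<forall>w. w \<notin> fst n \<longrightarrow> snd n w = 0) \<and>
    (\<forall>i\<in>I. (\<Sum>w\<in>fst n. snd n w / (w - lam i)) = (if i = j then 1 else 0))"
  proof
    fix j
    show "\<exists>n. j \<in> I \<longrightarrow> finite (fst n) \<and> fst n \<subseteq> right_half_plane - N \<and> (\<forall>w. w \<notin> fst n \<longrightarrow> snd n w = 0) \<and>
      (\<forall>i\<in>I. (\<Sum>w\<in>fst n. snd n w / (w - lam i)) = (if i = j then 1 else 0))"
    proof (cases "j \<in> I")
      case True
      obtain n p where "finite n" "n \<subseteq> right_half_plane - N" "\<forall>w. w \<notin> n \<longrightarrow> p w = 0"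
        "\<forall>i\<in>I. (\<Sum>w\<in>n. p w / (w - lam i)) = (if i = j then 1 else 0)"
        using dual_weights[OF I True inj lam' N(1)] by (elim exE conjE)
      then show ?thesis by (intro exI[of _ "(n, p)"]) simp
    qed simp
  qed
  from choice[OF this] obtain n where n: "\<forall>j. j \<in> I \<longrightarrow> finite (fst (n j)) \<and> fst (n j) \<subseteq> right_half_plane - N \<and> (\<forall>w. w \<notin> fst (n j) \<longrightarrow> snd (n j) w = 0) \<and>
    (\<forall>i\<in>I. (\<Sum>w\<in>fst (n j). snd (n j) w / (w - lam i)) = (if i = j then 1 else 0))" ..
  define Z where "Z = (\<Union>j\<in>I. fst (n j))"
  define a where "a j = snd (n j)" for j
  have Z: "finite Z" "Z \<subseteq> right_half_plane - N" using n I by (auto simp: Z_def)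
  have aZ: "(\<Sum>w\<in>insert s Z. a j w * h w) = (\<Sum>w\<in>fst (n j). a j w * h w)" if "j \<in> I" for j s h
    using n that Z by (intro sum.mono_neutral_right) (auto simp: Z_def a_def)
  define \<zeta> where "\<zeta> j = (\<Sum>w\<in>fst (n j). a j w * g w)" for j
  have geq: "g s = (\<Sum>j\<in>I. \<zeta> j / (s - lam j))" if s: "s \<in> right_half_plane" "s \<notin> N" for s
  proof -
    \<comment> \<open>Evaluation at \<open>s\<close> minus its expansion in the dual weights: an
      annihilator of the kernels by construction, whose vanishing on \<open>g\<close> is the desired
      expansion.\<close>
    define \<alpha> where "\<alpha> t = (if t = s then 1 else 0) - (\<Sum>j\<in>I. a j t / (s - lam j))" for t
    have red: "(\<Sum>t\<in>insert s Z. \<alpha> t * h t) = h s - (\<Sum>j\<in>I. (\<Sum>t\<in>fst (n j). a j t * h t) / (s - lam j))" for h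
    proof -
      have "(\<Sum>t\<in>insert s Z. \<alpha> t * h t) = (\<Sum>t\<in>insert s Z. (if t = s then h s else 0)) - (\<Sum>t\<in>insert s Z. \<Sum>j\<in>I. a j t * h t / (s - lam j))"
        unfolding \<alpha>_def sum_subtractf[symmetric]
        by (intro sum.cong refl) (simp add: left_diff_distrib sum_distrib_right)
      also have "(\<Sum>t\<in>insert s Z. (if t = s then h s else 0)) = h s" using Z(1) by simp
      also have "(\<Sum>t\<in>insert s Z. \<Sum>j\<in>I. a j t * h t / (s - lam j)) = (\<Sum>j\<in>I. (\<Sum>t\<in>insert s Z. a j t * h t) / (s - lam j))"
        by (subst sum.swap) (simp add: sum_divide_distrib)
      also have "\<dots> = (\<Sum>j\<in>I. (\<Sum>t\<in>fst (n j). a j t * h t) / (s - lam j))"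
        by (intro sum.cong refl) (simp only: aZ)
      finally show ?thesis .
    qed
    have ka: "(\<Sum>t\<in>insert s Z. \<alpha> t / (t - lam i)) = 0" if i: "i \<in> I" for i
    proof -
      have "(\<Sum>t\<in>insert s Z. \<alpha> t / (t - lam i)) = (\<Sum>t\<in>insert s Z. \<alpha> t * (1 / (t - lam i)))" by simp
      also have "\<dots> = 1 / (s - lam i) - (\<Sum>j\<in>I. (\<Sum>t\<in>fst (n j). a j t * (1 / (t - lam i))) / (s - lam j))" by (rule red)
      also have "(\<Sum>j\<in>I. (\<Sum>t\<in>fst (n j). a j t * (1 / (t - lam i))) / (s - lam j)) = (\<Sum>j\<in>I. if j = i then 1 / (s - lam i) else 0)"
        using n i by (intro sum.cong refl) (auto simp: a_def)
      also have "\<dots> = 1 / (s - lam i)" using i I by simp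
      finally show ?thesis by simp
    qed
    have "(\<Sum>t\<in>insert s Z. \<alpha> t * g t) = 0"
      unfolding g_def by (rule dd) (use Z N s ka kb in auto)
    then have "g s - (\<Sum>j\<in>I. \<zeta> j / (s - lam j)) = 0" unfolding red \<zeta>_def .
    then show ?thesis by simp
  qed
  \<comment> \<open>The expansion of \<open>f s * (poly d s / om s)\<close> multiplied by
    \<open>om s * poly d s\<close>, with each denominator cancelled against the factor it
    divides.\<close>
  define M where "M = (\<Sum>w\<in>N. Polynomial.smult (\<beta> w * f w) (d * (\<Prod>v\<in>N-{w}. [:- v, 1:]))) +
     (\<Sum>j\<in>I. Polynomial.smult (\<zeta> j) ((\<Prod>v\<in>N. [:- v, 1:]) * (\<Prod>k\<in>I-{j}. [:- lam k, 1:])))"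
  have Mp: "f s * (poly d s)\<^sup>2 = poly M s" if s: "s \<in> right_half_plane" "s \<notin> N" for s
  proof -
    have "g s = f s * (\<Sum>w\<in>N. \<beta> w / (s - w)) - (\<Sum>w\<in>N. \<beta> w * f w / (s - w))"
      unfolding g_def sum_distrib_left sum_subtractf[symmetric]
      by (intro sum.cong refl) (simp add: diff_divide_distrib algebra_simps)
    then have eq: "f s * (poly d s / om s) = (\<Sum>w\<in>N. \<beta> w * f w / (s - w)) + (\<Sum>j\<in>I. \<zeta> j / (s - lam j))"
      using geq[OF s] bsum[OF s(2)] by simp
    have "f s * (poly d s)\<^sup>2 = f s * (poly d s / om s) * (om s * poly d s)"
      using om[OF s(2)] by (simp add: power2_eq_square)
    also have "\<dots> = (\<Sum>w\<in>N. \<beta> w * f w / (s - w) * (om s * poly d s)) + (\<Sum>j\<in>I. \<zeta> j / (s - lam j) * (om s * poly d s))"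
      unfolding eq by (simp add: distrib_right sum_distrib_right)
    also have "(\<Sum>w\<in>N. \<beta> w * f w / (s - w) * (om s * poly d s)) = (\<Sum>w\<in>N. \<beta> w * f w * (poly d s * (\<Prod>v\<in>N-{w}. (s - v))))"
    proof (rule sum.cong[OF refl])
      fix w assume w: "w \<in> N"
      have "om s = (s - w) * (\<Prod>v\<in>N-{w}. (s - v))" unfolding om_def by (rule prod.remove[OF N(1) w])
      moreover have "s - w \<noteq> 0" using w s by auto
      ultimately show "\<beta> w * f w / (s - w) * (om s * poly d s) = \<beta> w * f w * (poly d s * (\<Prod>v\<in>N-{w}. (s - v)))" by simp
    qed
    also have "(\<Sum>j\<in>I. \<zeta> j / (s - lam j) * (om s * poly d s)) = (\<Sum>j\<in>I. \<zeta> j * (om s * (\<Prod>k\<in>I-{j}. (s - lam k))))"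
    proof (rule sum.cong[OF refl])
      fix j assume j: "j \<in> I"
      have "poly d s = (s - lam j) * (\<Prod>k\<in>I-{j}. (s - lam k))" unfolding dp by (rule prod.remove[OF I j])
      then show "\<zeta> j / (s - lam j) * (om s * poly d s) = \<zeta> j * (om s * (\<Prod>k\<in>I-{j}. (s - lam k)))"
        using lout[OF j s(1)] by simp
    qed
    finally show ?thesis by (simp add: M_def poly_sum poly_prod om_def)
  qed
  \<comment> \<open>The nodes excluded so far are recovered by continuity of
    \<open>f\<close>.\<close>
  have Mp': "f s * (poly d s)\<^sup>2 = poly M s" if s: "s \<in> right_half_plane" for s
  proof -
    have "isCont f s" using cont s by (simp add: continuous_on_eq_continuous_at)
    then have 1: "((\<lambda>z. f z * (poly d z)\<^sup>2) \<longlongrightarrow> f s * (poly d s)\<^sup>2) (at s)"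
      by (intro tendsto_intros poly_isCont[unfolded isCont_def]) (simp add: isCont_def)
    have 2: "((\<lambda>z. poly M z) \<longlongrightarrow> poly M s) (at s)" using poly_isCont[of s M] by (simp add: isCont_def)
    have 3: "\<forall>\<^sub>F z in at s. f z * (poly d z)\<^sup>2 = poly M z"
    proof -
      have "open (right_half_plane - (N - {s}))" using N(1) by (intro open_Diff finite_imp_closed) auto
      then have "\<forall>\<^sub>F z in at s. z \<in> (right_half_plane - (N - {s})) - {s}"
        using s by (intro eventually_at_in_open) auto
      then show ?thesis by eventually_elim (rule Mp; auto)
    qed
    show ?thesis by (rule tendsto_unique[OF at_neq_bot Lim_transform_eventually[OF 1 3] 2])
  qed
  obtain K R S where KRS: "\<forall>s. (\<forall>j\<in>I. s \<noteq> lam j) \<longrightarrow>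
    poly M s / (\<Prod>j\<in>I. (s - lam j)\<^sup>2) = poly K s + (\<Sum>j\<in>I. R j / (s - lam j) + S j / (s - lam j)\<^sup>2)"
    using partial_fractions[OF I inj, of M] by (elim exE)
  show ?thesis
  proof (intro exI ballI)
    fix s assume s: "s \<in> right_half_plane"
    have nz: "poly d s \<noteq> 0" unfolding dp using I lout[OF _ s] by (subst prod_zero_iff) auto
    have "f s = poly M s / (\<Prod>j\<in>I. (s - lam j)\<^sup>2)"
      using Mp'[OF s] nz by (simp add: dp prod_power_distrib[symmetric] eq_divide_eq flip: dp)
    also have "\<dots> = poly K s + (\<Sum>j\<in>I. R j / (s - lam j) + S j / (s - lam j)\<^sup>2)"
      using KRS lout[OF _ s] by auto
    finally show "f s = poly K s + (\<Sum>j\<in>I. R j / (s - lam j) + S j / (s - lam j)\<^sup>2)" .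
  qed
qed

lemma poly_tendsto_0_imp_0:
  fixes K :: "complex poly"
  assumes "((\<lambda>x. poly K (of_real x)) \<longlongrightarrow> 0) at_top"
  shows "K = 0"
proof (rule ccontr)
  assume K: "K \<noteq> 0"
  show False
  proof (cases "degree K = 0")
    case True
    then obtain k where k: "K = [:k:]" by (meson degree_eq_zeroE)
    then have "((\<lambda>x::real. k) \<longlongrightarrow> 0) at_top" using assms by simp
    then show False using K k by (simp add: tendsto_const_iff)
  next
    case False
    obtain k p where kp: "K = pCons k p" by (cases K)
    then have "p \<noteq> 0" using False by auto
    then obtain q where q: "\<And>z. q \<le> cmod z \<Longrightarrow> 1 \<le> cmod (poly K z)"
      using poly_infinity[of p 1 k] unfolding kp by blast
    have "((\<lambda>x. cmod (poly K (of_real x))) \<longlongrightarrow> 0) at_top" using assms by (rule tendsto_norm_zero)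
    moreover have "\<forall>\<^sub>F x in at_top. 1 \<le> cmod (poly K (of_real x))"
      using eventually_ge_at_top[of "max q 0"] by eventually_elim (rule q, simp)
    ultimately have "(1::real) \<le> 0" by (rule tendsto_lowerbound) simp
    then show False by simp
  qed
qed

text \<open>Test weights are built so that at \<open>lam i\<close> they produce prescribed
  first-order vectors \<open>x1\<close>, \<open>y1\<close> and second-order vectors
  \<open>x2\<close>, \<open>y2\<close>, and nothing at the other poles. The annihilation conditions
  see only the first order, so \<open>x2\<close> and \<open>y2\<close> remain free.\<close>

lemma double_difference_conditions:
  fixes lam :: "nat \<Rightarrow> complex" and V :: "complex \<Rightarrow> complex^'m^'p" and c :: "nat \<Rightarrow> complex^'p" and b :: "nat \<Rightarrow> complex^'m"
  assumes I: "finite I" "i \<in> I" and inj: "inj_on lam I" and lam: "\<And>j. j \<in> I \<Longrightarrow> Re (lam j) < 0"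
    and V: "\<And>s a e. s \<in> right_half_plane \<Longrightarrow> V s $ a $ e = (\<Sum>j\<in>I. R j $ a $ e / (s - lam j) + S j $ a $ e / (s - lam j)\<^sup>2)"
    and dd: "\<And>N' N u v. finite N' \<Longrightarrow> finite N \<Longrightarrow> N' \<subseteq> right_half_plane \<Longrightarrow> N \<subseteq> right_half_plane \<Longrightarrow> N' \<inter> N = {} \<Longrightarrow>
      (\<And>i. i \<in> I \<Longrightarrow> (\<Sum>s\<in>N'. (\<Sum>a\<in>UNIV. u s $ a * c i $ a) / (s - lam i)) = 0) \<Longrightarrow>
      (\<And>i. i \<in> I \<Longrightarrow> (\<Sum>w\<in>N. (\<Sum>e\<in>UNIV. cnj (b i $ e) * v w $ e) / (w - lam i)) = 0) \<Longrightarrow>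
      (\<Sum>a\<in>UNIV. \<Sum>e\<in>UNIV. \<Sum>s\<in>N'. \<Sum>w\<in>N. u s $ a * v w $ e * (V s $ a $ e - V w $ a $ e) / (s - w)) = 0"
    and x1: "(\<Sum>a\<in>UNIV. x1 $ a * c i $ a) = 0" and y1: "(\<Sum>e\<in>UNIV. cnj (b i $ e) * y1 $ e) = 0"
  shows "(\<Sum>a\<in>UNIV. \<Sum>e\<in>UNIV. x1 $ a * R i $ a $ e * y1 $ e + x2 $ a * S i $ a $ e * y1 $ e + x1 $ a * S i $ a $ e * y2 $ e) = 0"
proof -
  have lam': "\<forall>j\<in>I. Re (lam j) < 0" using lam by blast
  have lout: "s - lam j \<noteq> 0" if "j \<in> I" "s \<in> right_half_plane" for s j
    using lam[OF that(1)] that(2) by (auto simp: right_half_plane_def)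
  obtain N' p' q' where N': "finite N'" "N' \<subseteq> right_half_plane - {}"
    "\<forall>j\<in>I. (\<Sum>w\<in>N'. p' w / (w - lam j)) = (if j = i then 1 else 0)"
    "\<forall>j\<in>I. (\<Sum>w\<in>N'. p' w / (w - lam j)\<^sup>2) = 0"
    "\<forall>j\<in>I. (\<Sum>w\<in>N'. q' w / (w - lam j)) = 0"
    "\<forall>j\<in>I. (\<Sum>w\<in>N'. q' w / (w - lam j)\<^sup>2) = (if j = i then 1 else 0)"
    using dual_weights[OF I inj lam' finite.emptyI] by (elim exE conjE)
  obtain N p q where N: "finite N" "N \<subseteq> right_half_plane - N'"
    "\<forall>j\<in>I. (\<Sum>w\<in>N. p w / (w - lam j)) = (if j = i then 1 else 0)"
    "\<forall>j\<in>I. (\<Sum>w\<in>N. p w / (w - lam j)\<^sup>2) = 0"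
    "\<forall>j\<in>I. (\<Sum>w\<in>N. q w / (w - lam j)) = 0"
    "\<forall>j\<in>I. (\<Sum>w\<in>N. q w / (w - lam j)\<^sup>2) = (if j = i then 1 else 0)"
    using dual_weights[OF I inj lam' N'(1)] by (elim exE conjE)
  define u where "u s = (\<chi> a. p' s * x1 $ a + q' s * x2 $ a)" for s
  define v where "v w = (\<chi> e. p w * y1 $ e + q w * y2 $ e)" for w
  have U: "(\<Sum>s\<in>N'. u s $ a / (s - lam j)) = (if j = i then x1 $ a else 0)" "(\<Sum>s\<in>N'. u s $ a / (s - lam j)\<^sup>2) = (if j = i then x2 $ a else 0)" if "j \<in> I" for a j
  proof -
    have *: "(\<Sum>s\<in>N'. u s $ a / z s) = x1 $ a * (\<Sum>s\<in>N'. p' s / z s) + x2 $ a * (\<Sum>s\<in>N'. q' s / z s)" for z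
      unfolding sum_distrib_left sum.distrib[symmetric] by (intro sum.cong refl) (simp add: u_def add_divide_distrib mult.commute)
    show "(\<Sum>s\<in>N'. u s $ a / (s - lam j)) = (if j = i then x1 $ a else 0)" "(\<Sum>s\<in>N'. u s $ a / (s - lam j)\<^sup>2) = (if j = i then x2 $ a else 0)"
      unfolding * using N'(3-6) that by simp_all
  qed
  have W: "(\<Sum>w\<in>N. v w $ e / (w - lam j)) = (if j = i then y1 $ e else 0)" "(\<Sum>w\<in>N. v w $ e / (w - lam j)\<^sup>2) = (if j = i then y2 $ e else 0)" if "j \<in> I" for e j
  proof -
    have *: "(\<Sum>w\<in>N. v w $ e / z w) = y1 $ e * (\<Sum>w\<in>N. p w / z w) + y2 $ e * (\<Sum>w\<in>N. q w / z w)" for z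
      unfolding sum_distrib_left sum.distrib[symmetric] by (intro sum.cong refl) (simp add: v_def add_divide_distrib mult.commute)
    show "(\<Sum>w\<in>N. v w $ e / (w - lam j)) = (if j = i then y1 $ e else 0)" "(\<Sum>w\<in>N. v w $ e / (w - lam j)\<^sup>2) = (if j = i then y2 $ e else 0)"
      unfolding * using N(3-6) that by simp_all
  qed
  have ku: "(\<Sum>s\<in>N'. (\<Sum>a\<in>UNIV. u s $ a * c j $ a) / (s - lam j)) = 0" if j: "j \<in> I" for j
  proof -
    have "(\<Sum>s\<in>N'. (\<Sum>a\<in>UNIV. u s $ a * c j $ a) / (s - lam j)) = (\<Sum>s\<in>N'. \<Sum>a\<in>UNIV. u s $ a / (s - lam j) * c j $ a)"
      by (simp add: sum_divide_distrib)
    also have "\<dots> = (\<Sum>a\<in>UNIV. (\<Sum>s\<in>N'. u s $ a / (s - lam j)) * c j $ a)"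
      by (subst sum.swap) (simp only: sum_distrib_right)
    also have "\<dots> = 0" unfolding U(1)[OF j] using x1 by (cases "j = i") simp_all
    finally show ?thesis .
  qed
  have kv: "(\<Sum>w\<in>N. (\<Sum>e\<in>UNIV. cnj (b j $ e) * v w $ e) / (w - lam j)) = 0" if j: "j \<in> I" for j
  proof -
    have "(\<Sum>w\<in>N. (\<Sum>e\<in>UNIV. cnj (b j $ e) * v w $ e) / (w - lam j)) = (\<Sum>w\<in>N. \<Sum>e\<in>UNIV. cnj (b j $ e) * (v w $ e / (w - lam j)))"
      by (simp add: sum_divide_distrib)
    also have "\<dots> = (\<Sum>e\<in>UNIV. cnj (b j $ e) * (\<Sum>w\<in>N. v w $ e / (w - lam j)))"
      by (subst sum.swap) (simp only: sum_distrib_left)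
    also have "\<dots> = 0" unfolding W(1)[OF j] using y1 by (cases "j = i") simp_all
    finally show ?thesis .
  qed
  have "(\<Sum>a\<in>UNIV. \<Sum>e\<in>UNIV. \<Sum>s\<in>N'. \<Sum>w\<in>N. u s $ a * v w $ e * (V s $ a $ e - V w $ a $ e) / (s - w)) = 0"
    by (rule dd) (use N N' ku kv in auto)
  moreover have "(\<Sum>s\<in>N'. \<Sum>w\<in>N. u s $ a * v w $ e * (V s $ a $ e - V w $ a $ e) / (s - w)) =
     - (x1 $ a * R i $ a $ e * y1 $ e + x2 $ a * S i $ a $ e * y1 $ e + x1 $ a * S i $ a $ e * y2 $ e)" for a e
  proof -
    \<comment> \<open>The divided difference of one pole term. The simple pole contributes a product
      of two first-order kernels; the double pole contributes the two mixed products of first and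
      second order.\<close>
    define T where "T s w j = - (R j $ a $ e * ((u s $ a / (s - lam j)) * (v w $ e / (w - lam j))) +
         S j $ a $ e * ((u s $ a / (s - lam j)\<^sup>2) * (v w $ e / (w - lam j)) + (u s $ a / (s - lam j)) * (v w $ e / (w - lam j)\<^sup>2)))" for s w j
    have "(\<Sum>s\<in>N'. \<Sum>w\<in>N. u s $ a * v w $ e * (V s $ a $ e - V w $ a $ e) / (s - w)) = (\<Sum>s\<in>N'. \<Sum>w\<in>N. \<Sum>j\<in>I. T s w j)"
    proof (intro sum.cong refl)
      fix s w assume sw: "s \<in> N'" "w \<in> N"
      then have R': "s \<in> right_half_plane" "w \<in> right_half_plane" and ne: "s - w \<noteq> 0" using N(2) N'(2) by auto
      have "u s $ a * v w $ e * (V s $ a $ e - V w $ a $ e) / (s - w) =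
        (\<Sum>j\<in>I. u s $ a * v w $ e * ((R j $ a $ e / (s - lam j) + S j $ a $ e / (s - lam j)\<^sup>2) - (R j $ a $ e / (w - lam j) + S j $ a $ e / (w - lam j)\<^sup>2)) / (s - w))"
        unfolding V[OF R'(1)] V[OF R'(2)] sum_subtractf[symmetric] sum_distrib_left sum_divide_distrib ..
      also have "\<dots> = (\<Sum>j\<in>I. T s w j)"
      proof (rule sum.cong[OF refl])
        fix j assume j: "j \<in> I"
        define y z where "y = s - lam j" and "z = w - lam j"
        have yz: "y \<noteq> 0" "z \<noteq> 0" "s - w = y - z" "y - z \<noteq> 0" using lout[OF j] R' ne by (auto simp: y_def z_def)
        have "(\<rho> / y + \<sigma> / y\<^sup>2 - (\<rho> / z + \<sigma> / z\<^sup>2)) / (y - z) = - (\<rho> / (y * z) + \<sigma> * (1 / (y\<^sup>2 * z) + 1 / (y * z\<^sup>2)))" for \<rho> \<sigma>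
          using yz(1,2,4) by (simp add: divide_simps) (simp add: algebra_simps power2_eq_square power3_eq_cube)
        from this[of "R j $ a $ e" "S j $ a $ e"]
        show "u s $ a * v w $ e * ((R j $ a $ e / (s - lam j) + S j $ a $ e / (s - lam j)\<^sup>2) - (R j $ a $ e / (w - lam j) + S j $ a $ e / (w - lam j)\<^sup>2)) / (s - w) = T s w j"
          unfolding T_def y_def[symmetric] z_def[symmetric] yz(3)
          by (simp only: times_divide_eq_right[symmetric]) (simp add: algebra_simps)
      qed
      finally show "u s $ a * v w $ e * (V s $ a $ e - V w $ a $ e) / (s - w) = (\<Sum>j\<in>I. T s w j)" .
    qed
    also have "\<dots> = (\<Sum>s\<in>N'. \<Sum>j\<in>I. \<Sum>w\<in>N. T s w j)" by (rule sum.cong[OF refl], rule sum.swap)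
    also have "\<dots> = (\<Sum>j\<in>I. \<Sum>s\<in>N'. \<Sum>w\<in>N. T s w j)" by (rule sum.swap)
    also have "\<dots> = (\<Sum>j\<in>I. if j = i then - (x1 $ a * R i $ a $ e * y1 $ e + x2 $ a * S i $ a $ e * y1 $ e + x1 $ a * S i $ a $ e * y2 $ e) else 0)"
    proof (rule sum.cong[OF refl])
      fix j assume j: "j \<in> I"
      have pr: "(\<Sum>s\<in>N'. \<Sum>w\<in>N. f s * g w) = (\<Sum>s\<in>N'. f s) * (\<Sum>w\<in>N. g w)" for f g :: "complex \<Rightarrow> complex"
        by (simp add: sum_product)
      have "(\<Sum>s\<in>N'. \<Sum>w\<in>N. T s w j) = - (R j $ a $ e * ((\<Sum>s\<in>N'. u s $ a / (s - lam j)) * (\<Sum>w\<in>N. v w $ e / (w - lam j))) +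
         S j $ a $ e * ((\<Sum>s\<in>N'. u s $ a / (s - lam j)\<^sup>2) * (\<Sum>w\<in>N. v w $ e / (w - lam j)) + (\<Sum>s\<in>N'. u s $ a / (s - lam j)) * (\<Sum>w\<in>N. v w $ e / (w - lam j)\<^sup>2)))"
        unfolding pr[symmetric] T_def by (simp only: sum_negf sum.distrib distrib_left sum_distrib_left)
      also have "\<dots> = (if j = i then - (x1 $ a * R i $ a $ e * y1 $ e + x2 $ a * S i $ a $ e * y1 $ e + x1 $ a * S i $ a $ e * y2 $ e) else 0)"
        unfolding U[OF j] W[OF j] by (cases "j = i") (simp_all add: algebra_simps)
      finally show "(\<Sum>s\<in>N'. \<Sum>w\<in>N. T s w j) = (if j = i then - (x1 $ a * R i $ a $ e * y1 $ e + x2 $ a * S i $ a $ e * y1 $ e + x1 $ a * S i $ a $ e * y2 $ e) else 0)" .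
    qed
    also have "\<dots> = - (x1 $ a * R i $ a $ e * y1 $ e + x2 $ a * S i $ a $ e * y1 $ e + x1 $ a * S i $ a $ e * y2 $ e)"
      using I by simp
    finally show ?thesis .
  qed
  ultimately show ?thesis by (simp only: sum_negf neg_equal_0_iff_equal)
qed

section \<open>Loewner kernels and tangent vectors\<close>

text \<open>The block Loewner matrix on the node sets \<open>N'\<close> and \<open>N\<close>, as a
  bilinear form in vector-valued weights. Wherever its kernel is factored the node sets are
  disjoint, so no denominator vanishes.\<close>

definition loewner :: "(complex \<Rightarrow> complex^'m^'p) \<Rightarrow> complex set \<Rightarrow> complex set \<Rightarrow> (complex \<Rightarrow> complex^'p) \<Rightarrow> (complex \<Rightarrow> complex^'m) \<Rightarrow> complex" where
  "loewner F N' N u v = (\<Sum>a\<in>UNIV. \<Sum>e\<in>UNIV. \<Sum>s\<in>N'. \<Sum>w\<in>N. u s $ a * v w $ e * (F s $ a $ e - F w $ a $ e) / (s - w))"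

lemma loewner_factor:
  fixes F :: "complex \<Rightarrow> complex^'m^'p"
  assumes "\<And>s w a e. s \<in> N' \<Longrightarrow> w \<in> N \<Longrightarrow> (F s $ a $ e - F w $ a $ e) / (s - w) = (\<Sum>q\<in>Q. f q s a * g q w e)"
  shows "loewner F N' N u v = (\<Sum>q\<in>Q. (\<Sum>s\<in>N'. \<Sum>a\<in>UNIV. u s $ a * f q s a) * (\<Sum>w\<in>N. \<Sum>e\<in>UNIV. v w $ e * g q w e))"
proof -
  have "loewner F N' N u v = (\<Sum>a\<in>UNIV. \<Sum>e\<in>UNIV. \<Sum>s\<in>N'. \<Sum>w\<in>N. \<Sum>q\<in>Q. (u s $ a * f q s a) * (v w $ e * g q w e))"
    unfolding loewner_def
  proof (intro sum.cong refl)
    fix a e s w assume "s \<in> N'" "w \<in> N"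
    then have "u s $ a * v w $ e * (F s $ a $ e - F w $ a $ e) / (s - w) = u s $ a * v w $ e * (\<Sum>q\<in>Q. f q s a * g q w e)"
      using assms by (simp flip: times_divide_eq_right)
    also have "\<dots> = (\<Sum>q\<in>Q. (u s $ a * f q s a) * (v w $ e * g q w e))"
      unfolding sum_distrib_left by (intro sum.cong refl) simp
    finally show "u s $ a * v w $ e * (F s $ a $ e - F w $ a $ e) / (s - w) = (\<Sum>q\<in>Q. (u s $ a * f q s a) * (v w $ e * g q w e))" .
  qed
  also have "\<dots> = (\<Sum>a\<in>UNIV. \<Sum>e\<in>UNIV. \<Sum>q\<in>Q. (\<Sum>s\<in>N'. u s $ a * f q s a) * (\<Sum>w\<in>N. v w $ e * g q w e))"
  proof (intro sum.cong refl)
    fix a e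
    have "(\<Sum>s\<in>N'. \<Sum>w\<in>N. \<Sum>q\<in>Q. (u s $ a * f q s a) * (v w $ e * g q w e)) = (\<Sum>s\<in>N'. \<Sum>q\<in>Q. \<Sum>w\<in>N. (u s $ a * f q s a) * (v w $ e * g q w e))"
      by (rule sum.cong[OF refl], rule sum.swap)
    also have "\<dots> = (\<Sum>q\<in>Q. \<Sum>s\<in>N'. \<Sum>w\<in>N. (u s $ a * f q s a) * (v w $ e * g q w e))" by (rule sum.swap)
    finally show "(\<Sum>s\<in>N'. \<Sum>w\<in>N. \<Sum>q\<in>Q. (u s $ a * f q s a) * (v w $ e * g q w e)) =
      (\<Sum>q\<in>Q. (\<Sum>s\<in>N'. u s $ a * f q s a) * (\<Sum>w\<in>N. v w $ e * g q w e))" by (simp only: sum_product)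
  qed
  also have "\<dots> = (\<Sum>a\<in>UNIV. \<Sum>q\<in>Q. \<Sum>e\<in>UNIV. (\<Sum>s\<in>N'. u s $ a * f q s a) * (\<Sum>w\<in>N. v w $ e * g q w e))"
    by (rule sum.cong[OF refl], rule sum.swap)
  also have "\<dots> = (\<Sum>q\<in>Q. \<Sum>a\<in>UNIV. \<Sum>e\<in>UNIV. (\<Sum>s\<in>N'. u s $ a * f q s a) * (\<Sum>w\<in>N. v w $ e * g q w e))"
    by (rule sum.swap)
  also have "\<dots> = (\<Sum>q\<in>Q. (\<Sum>a\<in>UNIV. \<Sum>s\<in>N'. u s $ a * f q s a) * (\<Sum>e\<in>UNIV. \<Sum>w\<in>N. v w $ e * g q w e))"
    by (simp only: sum_product)
  also have "\<dots> = (\<Sum>q\<in>Q. (\<Sum>s\<in>N'. \<Sum>a\<in>UNIV. u s $ a * f q s a) * (\<Sum>w\<in>N. \<Sum>e\<in>UNIV. v w $ e * g q w e))"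
    by (simp only: sum.swap[of _ UNIV N'] sum.swap[of _ UNIV N])
  finally show ?thesis .
qed

lemma loewner_restrict:
  assumes "finite Z'" "finite Z" "N' \<subseteq> Z'" "N \<subseteq> Z" "\<And>s. s \<in> Z' - N' \<Longrightarrow> u s = 0" "\<And>w. w \<in> Z - N \<Longrightarrow> v w = 0"
  shows "loewner F Z' Z u v = loewner F N' N u v"
proof -
  have "(\<Sum>s\<in>Z'. \<Sum>w\<in>Z. u s $ a * v w $ e * (F s $ a $ e - F w $ a $ e) / (s - w)) =
    (\<Sum>s\<in>N'. \<Sum>w\<in>N. u s $ a * v w $ e * (F s $ a $ e - F w $ a $ e) / (s - w))" for a e
  proof -
    have "(\<Sum>w\<in>Z. u s $ a * v w $ e * (F s $ a $ e - F w $ a $ e) / (s - w)) = (\<Sum>w\<in>N. u s $ a * v w $ e * (F s $ a $ e - F w $ a $ e) / (s - w))" for s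
      using assms by (intro sum.mono_neutral_right) auto
    moreover have "(\<Sum>s\<in>Z'. \<Sum>w\<in>N. u s $ a * v w $ e * (F s $ a $ e - F w $ a $ e) / (s - w)) = (\<Sum>s\<in>N'. \<Sum>w\<in>N. u s $ a * v w $ e * (F s $ a $ e - F w $ a $ e) / (s - w))"
      using assms by (intro sum.mono_neutral_right) auto
    ultimately show ?thesis by simp
  qed
  then show ?thesis unfolding loewner_def by simp
qed

text \<open>The form is linear in the function and uses finitely many of its values, so pointwise
  differentiability is enough.\<close>

lemma loewner_tendsto:
  fixes G :: "nat \<Rightarrow> complex \<Rightarrow> complex^'m^'p"
  assumes "\<And>s a e. s \<in> N' \<union> N \<Longrightarrow> (\<lambda>n. (G n s $ a $ e - F s $ a $ e) / h n) \<longlonglongrightarrow> V s $ a $ e"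
  shows "(\<lambda>n. (loewner (G n) N' N u v - loewner F N' N u v) / h n) \<longlonglongrightarrow> loewner V N' N u v"
proof -
  have eq: "(loewner (G n) N' N u v - loewner F N' N u v) / h n = (\<Sum>a\<in>UNIV. \<Sum>e\<in>UNIV. \<Sum>s\<in>N'. \<Sum>w\<in>N.
     u s $ a * v w $ e * ((G n s $ a $ e - F s $ a $ e) / h n - (G n w $ a $ e - F w $ a $ e) / h n) / (s - w))" for n
    unfolding loewner_def sum_subtractf[symmetric] sum_divide_distrib
    by (intro sum.cong refl) (simp add: divide_inverse algebra_simps)
  show ?thesis
    unfolding eq unfolding loewner_def divide_inverse[of _ "_ - _"]
    by (intro tendsto_sum tendsto_mult tendsto_const tendsto_diff assms; simp)
qed

lemma loewner_stable_system:
  fixes F :: "complex \<Rightarrow> complex^'m^'p"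
  assumes F: "F \<in> stable_systems r" and N: "N' \<subseteq> right_half_plane" "N \<subseteq> right_half_plane" "N' \<inter> N = {}"
  shows "\<exists>x y. \<forall>i j. loewner F N' N (U i) (W j) = (\<Sum>l<r. x i l * y l j)"
proof -
  obtain A B C where A: "A \<in> carrier_mat r r" and hur: "hurwitz A" and "minimal_realization r A B C"
    and T: "\<forall>s\<in>right_half_plane. F s = transfer_function A B C s"
    using F unfolding stable_systems_def mem_Collect_eq by (elim exE conjE)
  have ne: "\<not> eigenvalue A s" if "s \<in> right_half_plane" for s
    using hur that unfolding hurwitz_def right_half_plane_def by fastforce
  define f where "f q s a = - (\<Sum>k<r. C k $ a * resolvent A s $$ (k, q))" for q s a
  define g where "g q w e = (\<Sum>l<r. resolvent A w $$ (q, l) * B l $ e)" for q w e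
  have fac: "(F s $ a $ e - F w $ a $ e) / (s - w) = (\<Sum>q\<in>{..<r}. f q s a * g q w e)" if sw: "s \<in> N'" "w \<in> N" for s w a e
  proof -
    have R: "s \<in> right_half_plane" "w \<in> right_half_plane" and nz: "s - w \<noteq> 0" using sw N by auto
    have "F s $ a $ e - F w $ a $ e = (w - s) * (\<Sum>q<r. (- f q s a) * g q w e)"
      using T R transfer_function_divided_difference[OF A ne[OF R(1)] ne[OF R(2)], of B C a e] by (simp add: f_def g_def)
    also have "\<dots> = (s - w) * (\<Sum>q<r. f q s a * g q w e)" by (simp add: sum_negf algebra_simps)
    finally show ?thesis using nz by simp
  qed
  show ?thesis
  proof (intro exI allI)
    fix i j
    show "loewner F N' N (U i) (W j) = (\<Sum>l<r. (\<lambda>i l. \<Sum>s\<in>N'. \<Sum>a\<in>UNIV. U i s $ a * f l s a) i l * (\<lambda>l j. \<Sum>w\<in>N. \<Sum>e\<in>UNIV. W j w $ e * g l w e) l j)"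
      by (simp only: loewner_factor[where f = f and g = g and Q = "{..<r}", OF fac])
  qed
qed

text \<open>Each pole contributes one rank-one term. Weights for which all the sums in
  \<open>s\<close>, or all the sums in \<open>w\<close>, vanish are therefore left or right null
  vectors of the kernel.\<close>

lemma loewner_pole_residue:
  fixes F :: "complex \<Rightarrow> complex^'m^'p"
  assumes F: "\<And>s. s \<in> right_half_plane \<Longrightarrow> F s = pole_residue r c b lam s" and lam: "\<forall>j\<in>{1..r}. Re (lam j) < 0"
    and N: "N' \<subseteq> right_half_plane" "N \<subseteq> right_half_plane" "N' \<inter> N = {}"
  shows "loewner F N' N u v = - (\<Sum>j\<in>{1..r}. (\<Sum>s\<in>N'. (\<Sum>a\<in>UNIV. u s $ a * c j $ a) / (s - lam j)) * (\<Sum>w\<in>N. (\<Sum>e\<in>UNIV. cnj (b j $ e) * v w $ e) / (w - lam j)))"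
proof -
  define f where "f j s a = - (c j $ a / (s - lam j))" for j s a
  define g where "g j w e = cnj (b j $ e) / (w - lam j)" for j w e
  have fac: "(F s $ a $ e - F w $ a $ e) / (s - w) = (\<Sum>j\<in>{1..r}. f j s a * g j w e)" if sw: "s \<in> N'" "w \<in> N" for s w a e
  proof -
    have R: "s \<in> right_half_plane" "w \<in> right_half_plane" and nz: "s - w \<noteq> 0" using sw N by auto
    have "(F s $ a $ e - F w $ a $ e) / (s - w) = (\<Sum>j\<in>{1..r}. (c j $ a * cnj (b j $ e) / (s - lam j) - c j $ a * cnj (b j $ e) / (w - lam j)) / (s - w))"
      unfolding F[OF R(1)] F[OF R(2)] pole_residue_def vec_lambda_beta sum_subtractf[symmetric] sum_divide_distrib ..
    also have "\<dots> = (\<Sum>j\<in>{1..r}. f j s a * g j w e)"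
    proof (rule sum.cong[OF refl])
      fix j assume j: "j \<in> {1..r}"
      then have "Re (lam j) < 0" using lam by blast
      define y z where "y = s - lam j" and "z = w - lam j"
      have yz: "y \<noteq> 0" "z \<noteq> 0" "s - w = y - z" "y - z \<noteq> 0"
        using \<open>Re (lam j) < 0\<close> R nz by (auto simp: y_def z_def right_half_plane_def)
      have "(k / y - k / z) / (y - z) = - (k / (y * z))" for k
        using yz by (simp add: divide_simps) (simp add: algebra_simps)
      then show "(c j $ a * cnj (b j $ e) / (s - lam j) - c j $ a * cnj (b j $ e) / (w - lam j)) / (s - w) = f j s a * g j w e"
        unfolding f_def g_def y_def[symmetric] z_def[symmetric] yz(3) by simp
    qed
    finally show ?thesis .
  qed
  have 1: "(\<Sum>s\<in>N'. \<Sum>a\<in>UNIV. u s $ a * f j s a) = - (\<Sum>s\<in>N'. (\<Sum>a\<in>UNIV. u s $ a * c j $ a) / (s - lam j))" for j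
    by (simp add: f_def sum_negf sum_divide_distrib)
  have 2: "(\<Sum>w\<in>N. \<Sum>e\<in>UNIV. v w $ e * g j w e) = (\<Sum>w\<in>N. (\<Sum>e\<in>UNIV. cnj (b j $ e) * v w $ e) / (w - lam j))" for j
    by (simp add: g_def sum_divide_distrib mult.commute)
  show ?thesis
    by (simp only: loewner_factor[where f = f and g = g and Q = "{1..r}", OF fac] 1 2 mult_minus_left sum_negf)
qed

lemma normalised_vector:
  fixes x :: "complex^'n"
  assumes "x \<noteq> 0"
  shows "\<exists>y::complex^'n. (\<Sum>a\<in>UNIV. y $ a * x $ a) = 1"
proof -
  obtain k where k: "x $ k \<noteq> 0" using assms by (auto simp: Finite_Cartesian_Product.vec_eq_iff)
  have "(\<Sum>a\<in>UNIV. (\<chi> a. if a = k then 1 / x $ k else 0) $ a * x $ a) = (\<Sum>a\<in>UNIV. if a = k then 1 else 0)"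
    using k by (intro sum.cong refl) auto
  then have "(\<Sum>a\<in>UNIV. (\<chi> a. if a = k then 1 / x $ k else 0) $ a * x $ a) = 1" by simp
  then show ?thesis by (rule exI)
qed

text \<open>Scalar dual weights for \<open>lam i\<close> multiplied by a vector that pairs to 1 with
  \<open>c i\<close>. At every other pole the scalar weight already gives 0, whatever the pairing
  with \<open>c j\<close>.\<close>

lemma dual_vectors:
  fixes c :: "nat \<Rightarrow> complex^'n" and lam :: "nat \<Rightarrow> complex"
  assumes I: "finite I" and inj: "inj_on lam I" and lam: "\<forall>j\<in>I. Re (lam j) < 0" and X: "finite X"
    and c: "\<forall>j\<in>I. c j \<noteq> 0"
  shows "\<exists>Z u. finite Z \<and> Z \<subseteq> right_half_plane - X \<and> (\<forall>i s. s \<notin> Z \<longrightarrow> u i s = 0) \<and>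
    (\<forall>i\<in>I. \<forall>j\<in>I. (\<Sum>s\<in>Z. (\<Sum>a\<in>UNIV. u i s $ a * c j $ a) / (s - lam j)) = (if i = j then 1 else 0))"
proof -
  have "\<forall>i. \<exists>n. i \<in> I \<longrightarrow> finite (fst n) \<and> fst n \<subseteq> right_half_plane - X \<and> (\<forall>s. s \<notin> fst n \<longrightarrow> snd n s = 0) \<and>
    (\<forall>j\<in>I. (\<Sum>s\<in>fst n. (\<Sum>a\<in>UNIV. snd n s $ a * c j $ a) / (s - lam j)) = (if i = j then 1 else 0))"
  proof
    fix i
    show "\<exists>n. i \<in> I \<longrightarrow> finite (fst n) \<and> fst n \<subseteq> right_half_plane - X \<and> (\<forall>s. s \<notin> fst n \<longrightarrow> snd n s = 0) \<and>
      (\<forall>j\<in>I. (\<Sum>s\<in>fst n. (\<Sum>a\<in>UNIV. snd n s $ a * c j $ a) / (s - lam j)) = (if i = j then 1 else 0))"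
    proof (cases "i \<in> I")
      case True
      obtain N p where N: "finite N" "N \<subseteq> right_half_plane - X" "\<forall>w. w \<notin> N \<longrightarrow> p w = 0"
        "\<forall>j\<in>I. (\<Sum>w\<in>N. p w / (w - lam j)) = (if j = i then 1 else 0)"
        using dual_weights[OF I True inj lam X] by (elim exE conjE)
      obtain y :: "complex^'n" where y: "(\<Sum>a\<in>UNIV. y $ a * c i $ a) = 1"
        using normalised_vector[of "c i"] bspec[OF c True] by (elim meta_impE exE)
      have "(\<Sum>s\<in>N. (\<Sum>a\<in>UNIV. (\<chi> a. p s * y $ a) $ a * c j $ a) / (s - lam j)) = (if i = j then 1 else 0)" if j: "j \<in> I" for j
      proof -
        have "(\<Sum>s\<in>N. (\<Sum>a\<in>UNIV. (\<chi> a. p s * y $ a) $ a * c j $ a) / (s - lam j)) = (\<Sum>s\<in>N. p s / (s - lam j) * (\<Sum>a\<in>UNIV. y $ a * c j $ a))"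
          by (intro sum.cong refl) (simp add: sum_distrib_left mult.assoc sum_divide_distrib)
        also have "\<dots> = (\<Sum>s\<in>N. p s / (s - lam j)) * (\<Sum>a\<in>UNIV. y $ a * c j $ a)" by (simp only: sum_distrib_right)
        also have "\<dots> = (if i = j then 1 else 0)" using N(4) j y by auto
        finally show ?thesis .
      qed
      moreover have "(\<chi> a. p s * y $ a) = 0" if "s \<notin> N" for s
        using N(3) that by (simp add: Finite_Cartesian_Product.vec_eq_iff)
      ultimately show ?thesis using N(1,2) by (intro exI[of _ "(N, \<lambda>s. \<chi> a. p s * y $ a)"]) simp
    qed simp
  qed
  from choice[OF this] obtain n where n: "\<forall>i. i \<in> I \<longrightarrow> finite (fst (n i)) \<and> fst (n i) \<subseteq> right_half_plane - X \<and> (\<forall>s. s \<notin> fst (n i) \<longrightarrow> snd (n i) s = 0) \<and>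
    (\<forall>j\<in>I. (\<Sum>s\<in>fst (n i). (\<Sum>a\<in>UNIV. snd (n i) s $ a * c j $ a) / (s - lam j)) = (if i = j then 1 else 0))" ..
  define Z where "Z = (\<Union>i\<in>I. fst (n i))"
  define u where "u i s = (if i \<in> I then snd (n i) s else 0)" for i s
  have Z: "finite Z" "Z \<subseteq> right_half_plane - X" using n I by (auto simp: Z_def)
  have u0: "u i s = 0" if "s \<notin> Z" for i s using n that by (auto simp: u_def Z_def)
  have "(\<Sum>s\<in>Z. (\<Sum>a\<in>UNIV. u i s $ a * c j $ a) / (s - lam j)) = (if i = j then 1 else 0)" if ij: "i \<in> I" "j \<in> I" for i j
  proof -
    have "(\<Sum>s\<in>Z. (\<Sum>a\<in>UNIV. u i s $ a * c j $ a) / (s - lam j)) = (\<Sum>s\<in>fst (n i). (\<Sum>a\<in>UNIV. u i s $ a * c j $ a) / (s - lam j))"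
      using n ij Z by (intro sum.mono_neutral_right) (auto simp: u_def Z_def)
    also have "\<dots> = (if i = j then 1 else 0)" using n ij by (simp add: u_def)
    finally show ?thesis .
  qed
  then show ?thesis using Z u0 by (intro exI[of _ Z] exI[of _ u] conjI) auto
qed

text \<open>The null vectors \<open>u\<close> and \<open>v\<close> are placed at index 0 and dual
  vectors for the \<open>r\<close> poles at indices 1 to \<open>r\<close>. The resulting matrix of
  size \<open>r + 1\<close> is \<open>diag (0, 1, ..., 1)\<close> for \<open>F\<close> and has rank
  at most \<open>r\<close> for each \<open>G n\<close>, so \<open>rank_tangent\<close> yields the
  entry at index 0.\<close>

lemma loewner_velocity:
  fixes F V :: "complex \<Rightarrow> complex^'m^'p" and G :: "nat \<Rightarrow> complex \<Rightarrow> complex^'m^'p"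
  assumes F: "\<And>s. s \<in> right_half_plane \<Longrightarrow> F s = pole_residue r c b lam s"
    and lam: "\<forall>j\<in>{1..r}. Re (lam j) < 0" and inj: "inj_on lam {1..r}"
    and cb: "\<And>j. j \<in> {1..r} \<Longrightarrow> c j \<noteq> 0 \<and> b j \<noteq> 0"
    and G: "\<And>n. G n \<in> stable_systems r" and h: "h \<longlonglongrightarrow> 0" "\<And>n. h n \<noteq> 0"
    and V: "\<And>s a e. s \<in> right_half_plane \<Longrightarrow> (\<lambda>n. (G n s $ a $ e - F s $ a $ e) / h n) \<longlonglongrightarrow> V s $ a $ e"
    and N: "finite N'" "finite N" "N' \<subseteq> right_half_plane" "N \<subseteq> right_half_plane" "N' \<inter> N = {}"
    and u: "\<And>i. i \<in> {1..r} \<Longrightarrow> (\<Sum>s\<in>N'. (\<Sum>a\<in>UNIV. u s $ a * c i $ a) / (s - lam i)) = 0"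
    and v: "\<And>i. i \<in> {1..r} \<Longrightarrow> (\<Sum>w\<in>N. (\<Sum>e\<in>UNIV. cnj (b i $ e) * v w $ e) / (w - lam i)) = 0"
  shows "loewner V N' N u v = 0"
proof -
  let ?I = "{1..r}"
  have cb': "\<forall>j\<in>?I. c j \<noteq> 0" "\<forall>j\<in>?I. cnj_vec (b j) \<noteq> 0"
    using cb by (auto simp: cnj_vec_def Finite_Cartesian_Product.vec_eq_iff)
  obtain Z' u' where Z': "finite Z'" "Z' \<subseteq> right_half_plane - N" "\<forall>i s. s \<notin> Z' \<longrightarrow> u' i s = 0"
    "\<forall>i\<in>?I. \<forall>j\<in>?I. (\<Sum>s\<in>Z'. (\<Sum>a\<in>UNIV. u' i s $ a * c j $ a) / (s - lam j)) = (if i = j then 1 else 0)"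
    using dual_vectors[OF finite_atLeastAtMost inj lam N(2) cb'(1)] by (elim exE conjE)
  have "finite (N' \<union> Z')" using N Z' by simp
  from dual_vectors[OF finite_atLeastAtMost inj lam this cb'(2)]
  obtain Z v' where Z: "finite Z" "Z \<subseteq> right_half_plane - (N' \<union> Z')" "\<forall>i s. s \<notin> Z \<longrightarrow> v' i s = 0"
    "\<forall>i\<in>?I. \<forall>j\<in>?I. (\<Sum>s\<in>Z. (\<Sum>a\<in>UNIV. v' i s $ a * cnj_vec (b j) $ a) / (s - lam j)) = (if i = j then 1 else 0)"
    by (elim exE conjE)
  define P where "P = N' \<union> Z'"
  define Q where "Q = N \<union> Z"
  have PQ: "finite P" "finite Q" "P \<subseteq> right_half_plane" "Q \<subseteq> right_half_plane" "P \<inter> Q = {}"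
    using N Z Z' by (auto simp: P_def Q_def)
  \<comment> \<open>Both weights are cut off to their own node sets, since \<open>u\<close> and
    \<open>v\<close> are arbitrary elsewhere while the sums now run over \<open>P\<close> and
    \<open>Q\<close>. The sign of \<open>v'\<close> in \<open>W\<close> compensates the minus sign
    of \<open>loewner_pole_residue\<close> and makes the diagonal entries +1.\<close>
  define U where "U i s = (if i = 0 then (if s \<in> N' then u s else 0) else u' i s)" for i :: nat and s
  define W where "W i w = (if i = 0 then (if w \<in> N then v w else 0) else - v' i w)" for i :: nat and w
  define X where "X i j = (\<Sum>s\<in>P. (\<Sum>a\<in>UNIV. U i s $ a * c j $ a) / (s - lam j))" for i j
  define Y where "Y i j = (\<Sum>w\<in>Q. (\<Sum>e\<in>UNIV. cnj (b j $ e) * W i w $ e) / (w - lam j))" for i j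
  have X: "X i j = (if i = j then 1 else 0)" if "i \<le> r" "j \<in> ?I" for i j
  proof (cases "i = 0")
    case True
    have "X i j = (\<Sum>s\<in>N'. (\<Sum>a\<in>UNIV. U i s $ a * c j $ a) / (s - lam j))"
      unfolding X_def using PQ True by (intro sum.mono_neutral_right) (auto simp: P_def U_def)
    also have "\<dots> = (\<Sum>s\<in>N'. (\<Sum>a\<in>UNIV. u s $ a * c j $ a) / (s - lam j))" using True by (simp add: U_def)
    finally show ?thesis using u[OF that(2)] True that by auto
  next
    case False
    have "X i j = (\<Sum>s\<in>Z'. (\<Sum>a\<in>UNIV. U i s $ a * c j $ a) / (s - lam j))"
      unfolding X_def using PQ False Z' by (intro sum.mono_neutral_right) (auto simp: P_def U_def)
    also have "\<dots> = (\<Sum>s\<in>Z'. (\<Sum>a\<in>UNIV. u' i s $ a * c j $ a) / (s - lam j))" using False by (simp add: U_def)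
    finally show ?thesis using Z'(4) False that by simp
  qed
  have Y: "Y i j = (if i = j then - 1 else 0)" if "i \<le> r" "j \<in> ?I" for i j
  proof (cases "i = 0")
    case True
    have "Y i j = (\<Sum>w\<in>N. (\<Sum>e\<in>UNIV. cnj (b j $ e) * W i w $ e) / (w - lam j))"
      unfolding Y_def using PQ True by (intro sum.mono_neutral_right) (auto simp: Q_def W_def)
    also have "\<dots> = (\<Sum>w\<in>N. (\<Sum>e\<in>UNIV. cnj (b j $ e) * v w $ e) / (w - lam j))" using True by (simp add: W_def)
    finally show ?thesis using v[OF that(2)] True that by auto
  next
    case False
    have "Y i j = (\<Sum>w\<in>Z. (\<Sum>e\<in>UNIV. cnj (b j $ e) * W i w $ e) / (w - lam j))"
      unfolding Y_def using PQ False Z by (intro sum.mono_neutral_right) (auto simp: Q_def W_def)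
    also have "\<dots> = - (\<Sum>w\<in>Z. (\<Sum>e\<in>UNIV. v' i w $ e * cnj_vec (b j) $ e) / (w - lam j))"
      using False by (simp add: W_def cnj_vec_def sum_negf mult.commute)
    finally show ?thesis using Z(4) False that by simp
  qed
  define L0 where "L0 i j = loewner F P Q (U i) (W j)" for i j
  have L0: "L0 i j = (if i = j \<and> i \<noteq> 0 then 1 else 0)" if "i \<le> r" "j \<le> r" for i j
  proof -
    have "L0 i j = - (\<Sum>k\<in>?I. X i k * Y j k)"
      unfolding L0_def X_def Y_def by (rule loewner_pole_residue[OF F lam PQ(3-5)])
    also have "(\<Sum>k\<in>?I. X i k * Y j k) = (\<Sum>k\<in>?I. if k = i then (if i = j then - 1 else 0) else 0)"
      using that by (intro sum.cong refl) (auto simp: X Y)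
    also have "- \<dots> = (if i = j \<and> i \<noteq> 0 then 1 else 0)" using that by (auto simp: sum.delta)
    finally show ?thesis .
  qed
  have "loewner V P Q (U 0) (W 0) = 0"
  proof (rule rank_tangent[where L = "\<lambda>n i j. loewner (G n) P Q (U i) (W j)" and ?L0.0 = L0 and h = h and r = r
        and L' = "\<lambda>i j. loewner V P Q (U i) (W j)"])
    fix n
    obtain x y where "\<forall>i j. loewner (G n) P Q (U i) (W j) = (\<Sum>l<r. x i l * y l j)"
      using loewner_stable_system[OF G PQ(3-5), of n U W] by (elim exE)
    then show "\<exists>x y. \<forall>i\<le>r. \<forall>j\<le>r. loewner (G n) P Q (U i) (W j) = (\<Sum>l<r. x i l * y l j)"
      by (intro exI[of _ x] exI[of _ y]) simp
  next
    fix i j assume "i \<le> r" "j \<le> r"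
    show "(\<lambda>n. (loewner (G n) P Q (U i) (W j) - L0 i j) / h n) \<longlonglongrightarrow> loewner V P Q (U i) (W j)"
      unfolding L0_def using PQ by (intro loewner_tendsto V) auto
  qed (rule L0 h; assumption)+
  also have "loewner V P Q (U 0) (W 0) = loewner V N' N (U 0) (W 0)"
    using PQ by (intro loewner_restrict) (auto simp: P_def Q_def U_def W_def)
  also have "\<dots> = loewner V N' N u v"
    unfolding loewner_def by (intro sum.cong refl) (simp add: U_def W_def)
  finally show ?thesis .
qed

section \<open>Pairings with sums of poles, and the shape of velocities\<close>

lemma h2_zero:
  fixes F :: "complex \<Rightarrow> complex^'m^'p"
  assumes "\<And>s. s \<in> right_half_plane \<Longrightarrow> F s = 0"
  shows "F \<in> hardy2" "h2_norm F = 0" "bdry (\<lambda>s. F s $ i $ j) (\<lambda>_. 0)"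
proof -
  have h: "hardy_bound (\<lambda>s. F s $ i $ j) 0" for i j
    unfolding hardy_bound_def using assms by (simp add: holomorphic_cong[where g = "\<lambda>_. 0" and t = right_half_plane])
  then show F: "F \<in> hardy2" by (rule hardy2I)
  have "bdry (\<lambda>s. 0 :: complex) (\<lambda>_. 0)" by (simp add: bdry_def)
  then show b: "bdry (\<lambda>s. F s $ i $ j) (\<lambda>_. 0)" for i j
    by (rule bdry_cong[rotated]) (simp add: assms)
  show "h2_norm F = 0" unfolding h2_norm_eq[OF F b] by (simp add: l2sq_def)
qed

lemma h2_inner_pole_sum:
  fixes F V :: "complex \<Rightarrow> complex^'m^'p"
  assumes F: "F \<in> hardy2" and J: "finite J" "\<forall>j\<in>J. Re (lam j) < 0"
    and V: "\<And>s a e. s \<in> right_half_plane \<Longrightarrow> V s $ a $ e = (\<Sum>j\<in>J. R j $ a $ e / (s - lam j) + S j $ a $ e / (s - lam j)\<^sup>2)"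
  shows "V \<in> hardy2 \<and> h2_inner F V = (\<Sum>j\<in>J. entry_pairing (R j) (F (- cnj (lam j))) - entry_pairing (S j) (matrix_deriv F (- cnj (lam j))))"
  using J V
proof (induction J arbitrary: V rule: finite_induct)
  case empty
  have z: "V s = 0" if "s \<in> right_half_plane" for s using empty(2)[OF that] by (simp add: Finite_Cartesian_Product.vec_eq_iff)
  have "h2_inner F V = 0 * h2_inner F F + 0 * h2_inner F F"
    by (rule h2_inner_lincomb[OF F F F]) (simp add: z)
  then show ?case using h2_zero(1)[of V] z by simp
next
  case (insert j J)
  define V0 :: "complex \<Rightarrow> complex^'m^'p" where "V0 s = (\<chi> a e. \<Sum>j\<in>J. R j $ a $ e / (s - lam j) + S j $ a $ e / (s - lam j)\<^sup>2)" for s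
  have IH: "V0 \<in> hardy2 \<and> h2_inner F V0 = (\<Sum>j\<in>J. entry_pairing (R j) (F (- cnj (lam j))) - entry_pairing (S j) (matrix_deriv F (- cnj (lam j))))"
    by (rule insert.IH) (use insert.prems in \<open>auto simp: V0_def\<close>)
  have lj: "Re (lam j) < 0" using insert.prems by simp
  define P where "P = pole_matrix (R j) (lam j) 1"
  define Q where "Q = pole_matrix (S j) (lam j) 2"
  have PQ: "P \<in> hardy2" "Q \<in> hardy2"
    using pole_matrix_hardy2(1)[OF lj, of _ 0] pole_matrix_hardy2(1)[OF lj, of _ 1] by (simp_all add: P_def Q_def numeral_2_eq_2)
  define PQs where "PQs s = P s + Q s" for s
  have e1: "PQs s $ a $ e = 1 * P s $ a $ e + 1 * Q s $ a $ e" for s a e by (simp add: PQs_def)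
  have PQh: "PQs \<in> hardy2" by (rule hardy2_lincomb[OF PQ e1])
  have e2: "V s $ a $ e = 1 * V0 s $ a $ e + 1 * PQs s $ a $ e" if "s \<in> right_half_plane" for s a e
    using insert(1,2) insert.prems(2)[OF that, of a e]
    by (simp add: V0_def PQs_def P_def Q_def pole_matrix_def power_divide)
  have "V \<in> hardy2" by (rule hardy2_lincomb[OF conjunct1[OF IH] PQh e2])
  moreover have "h2_inner F V = 1 * h2_inner F V0 + 1 * h2_inner F PQs"
    by (rule h2_inner_lincomb[OF F conjunct1[OF IH] PQh e2])
  moreover have "h2_inner F PQs = 1 * h2_inner F P + 1 * h2_inner F Q"
    by (rule h2_inner_lincomb[OF F PQ e1])
  ultimately show ?case
    using insert(1,2) IH h2_inner_pole_matrix[OF F lj] by (simp add: P_def Q_def)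
qed

text \<open>The remainder \<open>W (h n)\<close> is shown to lie in the Hardy space, where
  \<open>entry_le_h2_norm\<close> turns the decay of its norm into decay at each point
  \<open>s\<close>.\<close>

lemma velocity_pointwise:
  fixes \<gamma> :: "real \<Rightarrow> complex \<Rightarrow> complex^'m^'p"
  assumes der: "h2_curve_derivative \<gamma> V 0" and eps: "\<epsilon> > 0" and \<gamma>: "\<forall>t\<in>{-\<epsilon><..<\<epsilon>}. \<gamma> t \<in> hardy2" and V: "V \<in> hardy2"
    and h: "h \<longlonglongrightarrow> 0" "\<And>n. h n \<noteq> 0" "\<And>n. h n \<in> {-\<epsilon><..<\<epsilon>}" and s: "s \<in> right_half_plane"
  shows "(\<lambda>n. (\<gamma> (h n) s $ a $ e - \<gamma> 0 s $ a $ e) / of_real (h n)) \<longlonglongrightarrow> V s $ a $ e"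
proof -
  define W where "W t s = (1 / t) *\<^sub>R (\<gamma> (0 + t) s - \<gamma> 0 s) - V s" for t s
  have g0: "\<gamma> 0 \<in> hardy2" using \<gamma> eps by auto
  have W: "W (h n) \<in> hardy2" for n
  proof -
    define U where "U s = (1 / h n) *\<^sub>R (\<gamma> (h n) s - \<gamma> 0 s)" for s
    have gh: "\<gamma> (h n) \<in> hardy2" using \<gamma> h(3) by blast
    have "U s $ a $ e = of_real (1 / h n) * \<gamma> (h n) s $ a $ e + of_real (- 1 / h n) * \<gamma> 0 s $ a $ e" for s a e
      unfolding U_def by (simp add: scaleR_conv_of_real[where 'a = complex] algebra_simps)
    then have "U \<in> hardy2" by (intro hardy2_lincomb[OF gh g0])
    then show ?thesis using V by (rule hardy2_lincomb[where a = 1 and b = "- 1"]) (simp add: W_def U_def)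
  qed
  have hl: "filterlim h (at 0) sequentially" unfolding filterlim_at using h by auto
  have "((\<lambda>t. h2_norm (W t)) \<longlongrightarrow> 0) (at 0)"
    using der unfolding h2_curve_derivative_def W_def .
  then have n0: "(\<lambda>n. h2_norm (W (h n)) / sqrt (2 * Re s)) \<longlonglongrightarrow> 0"
    by (intro tendsto_divide_zero filterlim_compose[OF _ hl])
  have "(\<lambda>n. W (h n) s $ a $ e) \<longlonglongrightarrow> 0"
    by (rule Lim_null_comparison[OF _ n0]) (intro always_eventually allI entry_le_h2_norm W s)
  then have "(\<lambda>n. W (h n) s $ a $ e + V s $ a $ e) \<longlonglongrightarrow> 0 + V s $ a $ e" by (intro tendsto_intros)
  then show ?thesis by (simp add: W_def scaleR_conv_of_real[where 'a = complex] divide_inverse mult.commute)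
qed

text \<open>The Loewner form is used twice: with weights living in one matrix entry it fixes the
  poles of that entry and their order, and with full vector weights it then relates the entries of
  the coefficients.\<close>

lemma tangent_vector_form:
  fixes Hhat :: "complex \<Rightarrow> complex^'m^'p"
  assumes Hh: "\<And>s. s \<in> right_half_plane \<Longrightarrow> Hhat s = pole_residue r c b lam s"
    and lam: "\<forall>j\<in>{1..r}. Re (lam j) < 0" and inj: "inj_on lam {1..r}"
    and cb: "\<And>j. j \<in> {1..r} \<Longrightarrow> c j \<noteq> 0 \<and> b j \<noteq> 0"
    and V: "V \<in> tangent_space r Hhat"
  shows "\<exists>R S. (\<forall>s\<in>right_half_plane. \<forall>a e. V s $ a $ e = (\<Sum>j\<in>{1..r}. R j $ a $ e / (s - lam j) + S j $ a $ e / (s - lam j)\<^sup>2)) \<and>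
    (\<forall>i\<in>{1..r}. \<forall>x1 x2 y1 y2. (\<Sum>a\<in>UNIV. x1 $ a * c i $ a) = 0 \<longrightarrow> (\<Sum>e\<in>UNIV. cnj (b i $ e) * y1 $ e) = 0 \<longrightarrow>
      (\<Sum>a\<in>UNIV. \<Sum>e\<in>UNIV. x1 $ a * R i $ a $ e * y1 $ e + x2 $ a * S i $ a $ e * y1 $ e + x1 $ a * S i $ a $ e * y2 $ e) = 0)"
proof -
  let ?I = "{1..r}"
  obtain \<epsilon> D where eps: "\<epsilon> > 0" and D: "h2_smooth_derivatives {-\<epsilon><..<\<epsilon>} D"
    and st: "\<forall>t\<in>{-\<epsilon><..<\<epsilon>}. D 0 t \<in> stable_systems r" and D0: "D 0 0 = Hhat" and D1: "D (Suc 0) 0 = V"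
    using V unfolding tangent_space_def mem_Collect_eq by (elim exE conjE)
  have z: "0 \<in> {-\<epsilon><..<\<epsilon>}" using eps by simp
  have der: "h2_curve_derivative (D 0) V 0" using D z D1 unfolding h2_smooth_derivatives_def by metis
  have Dh: "\<forall>t\<in>{-\<epsilon><..<\<epsilon>}. D 0 t \<in> hardy2" using D unfolding h2_smooth_derivatives_def by blast
  have Vh: "V \<in> hardy2" using D z D1 unfolding h2_smooth_derivatives_def by blast
  define h where "h n = \<epsilon> / 2 * (1 / real (Suc n))" for n
  have h: "h \<longlonglongrightarrow> 0" unfolding h_def by (rule tendsto_mult_right_zero[OF LIMSEQ_Suc[OF lim_1_over_n]])
  have hpos: "h n > 0" for n using eps by (simp add: h_def)
  have hle: "h n < \<epsilon>" for n
  proof -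
    have "h n \<le> \<epsilon> / 2 * 1" unfolding h_def using eps by (intro mult_left_mono) auto
    then show ?thesis using eps by simp
  qed
  have hin: "h n \<in> {-\<epsilon><..<\<epsilon>}" for n using hpos[of n] hle[of n] eps by auto
  have hne: "h n \<noteq> 0" for n using hpos[of n] by simp
  have lim: "(\<lambda>n. (D 0 (h n) s $ a $ e - Hhat s $ a $ e) / of_real (h n)) \<longlonglongrightarrow> V s $ a $ e" if "s \<in> right_half_plane" for s a e
    using velocity_pointwise[OF der eps Dh Vh h hne hin that] unfolding D0 .
  have hc: "(\<lambda>n. complex_of_real (h n)) \<longlonglongrightarrow> 0" "\<And>n. complex_of_real (h n) \<noteq> 0"
    using tendsto_of_real[OF h, where 'a = complex] hne by simp_all
  have st': "D 0 (h n) \<in> stable_systems r" for n using st hin by blast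
  have dd: "loewner V N' N u v = 0"
    if N: "finite N'" "finite N" "N' \<subseteq> right_half_plane" "N \<subseteq> right_half_plane" "N' \<inter> N = {}"
      and u: "\<And>i. i \<in> ?I \<Longrightarrow> (\<Sum>s\<in>N'. (\<Sum>a\<in>UNIV. u s $ a * c i $ a) / (s - lam i)) = 0"
      and v: "\<And>i. i \<in> ?I \<Longrightarrow> (\<Sum>w\<in>N. (\<Sum>e\<in>UNIV. cnj (b i $ e) * v w $ e) / (w - lam i)) = 0" for N' N u v
    by (rule loewner_velocity[OF _ lam inj _ st' hc _ N]) (fact Hh cb lim u v)+
  have "\<exists>K R S. \<forall>s\<in>right_half_plane. V s $ a $ e = poly K s + (\<Sum>j\<in>?I. R j / (s - lam j) + S j / (s - lam j)\<^sup>2)" for a e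
  proof (rule double_difference_form)
    show "finite ?I" "inj_on lam ?I" "\<And>j. j \<in> ?I \<Longrightarrow> Re (lam j) < 0" using inj lam by auto
    show "continuous_on right_half_plane (\<lambda>s. V s $ a $ e)"
      using Vh by (intro holomorphic_on_imp_continuous_on) (simp add: hardy2_def)
    fix N' N \<alpha> \<beta>
    assume N: "finite N'" "finite N" "N' \<subseteq> right_half_plane" "N \<subseteq> right_half_plane" "N' \<inter> N = {}"
      and k: "\<And>i. i \<in> ?I \<Longrightarrow> (\<Sum>s\<in>N'. \<alpha> s / (s - lam i)) = 0" "\<And>i. i \<in> ?I \<Longrightarrow> (\<Sum>w\<in>N. \<beta> w / (w - lam i)) = 0"
    \<comment> \<open>Concentrating the weights in row \<open>a\<close> and column \<open>e\<close>
      reduces the vector conditions to the scalar ones on \<alpha> and \<beta>, up to the factors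
      \<open>c i $ a\<close> and \<open>cnj (b i $ e)\<close>.\<close>
    define u :: "complex \<Rightarrow> complex^'p" where "u s = (\<chi> a'. if a' = a then \<alpha> s else 0)" for s
    define v :: "complex \<Rightarrow> complex^'m" where "v w = (\<chi> e'. if e' = e then \<beta> w else 0)" for w
    have us: "(\<Sum>a'\<in>UNIV. u s $ a' * f a') = \<alpha> s * f a" for s f
    proof -
      have "(\<Sum>a'\<in>UNIV. u s $ a' * f a') = (\<Sum>a'\<in>UNIV. if a' = a then \<alpha> s * f a else 0)"
        by (intro sum.cong refl) (simp add: u_def)
      then show ?thesis by simp
    qed
    have vs: "(\<Sum>e'\<in>UNIV. f e' * v w $ e') = f e * \<beta> w" for w f
    proof -
      have "(\<Sum>e'\<in>UNIV. f e' * v w $ e') = (\<Sum>e'\<in>UNIV. if e' = e then f e * \<beta> w else 0)"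
        by (intro sum.cong refl) (simp add: v_def)
      then show ?thesis by simp
    qed
    have "loewner V N' N u v = 0"
    proof (rule dd, (fact N)+)
      fix i assume i: "i \<in> ?I"
      have "(\<Sum>s\<in>N'. (\<Sum>a'\<in>UNIV. u s $ a' * c i $ a') / (s - lam i)) = (\<Sum>s\<in>N'. \<alpha> s / (s - lam i)) * c i $ a"
        unfolding us sum_distrib_right by (intro sum.cong refl) simp
      then show "(\<Sum>s\<in>N'. (\<Sum>a'\<in>UNIV. u s $ a' * c i $ a') / (s - lam i)) = 0" using k(1)[OF i] by simp
      have "(\<Sum>w\<in>N. (\<Sum>e'\<in>UNIV. cnj (b i $ e') * v w $ e') / (w - lam i)) = cnj (b i $ e) * (\<Sum>w\<in>N. \<beta> w / (w - lam i))"
        unfolding vs sum_distrib_left by (intro sum.cong refl) simp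
      then show "(\<Sum>w\<in>N. (\<Sum>e'\<in>UNIV. cnj (b i $ e') * v w $ e') / (w - lam i)) = 0" using k(2)[OF i] by simp
    qed
    moreover have "loewner V N' N u v = (\<Sum>s\<in>N'. \<Sum>w\<in>N. \<alpha> s * \<beta> w * (V s $ a $ e - V w $ a $ e) / (s - w))"
    proof -
      have "loewner V N' N u v = (\<Sum>a'\<in>UNIV. if a' = a then (\<Sum>e'\<in>UNIV. if e' = e then (\<Sum>s\<in>N'. \<Sum>w\<in>N. \<alpha> s * \<beta> w * (V s $ a $ e - V w $ a $ e) / (s - w)) else 0) else 0)"
        unfolding loewner_def
      proof (rule sum.cong[OF refl])
        fix a'
        show "(\<Sum>e'\<in>UNIV. \<Sum>s\<in>N'. \<Sum>w\<in>N. u s $ a' * v w $ e' * (V s $ a' $ e' - V w $ a' $ e') / (s - w)) =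
          (if a' = a then (\<Sum>e'\<in>UNIV. if e' = e then (\<Sum>s\<in>N'. \<Sum>w\<in>N. \<alpha> s * \<beta> w * (V s $ a $ e - V w $ a $ e) / (s - w)) else 0) else 0)"
        proof (cases "a' = a")
          case True
          have "(\<Sum>s\<in>N'. \<Sum>w\<in>N. u s $ a * v w $ e' * (V s $ a $ e' - V w $ a $ e') / (s - w)) =
            (if e' = e then (\<Sum>s\<in>N'. \<Sum>w\<in>N. \<alpha> s * \<beta> w * (V s $ a $ e - V w $ a $ e) / (s - w)) else 0)" for e'
            by (cases "e' = e") (simp_all add: u_def v_def)
          then show ?thesis using True by simp
        qed (simp add: u_def)
      qed
      then show ?thesis by simp
    qed
    ultimately show "(\<Sum>s\<in>N'. \<alpha> s * (\<Sum>w\<in>N. \<beta> w * (V s $ a $ e - V w $ a $ e) / (s - w))) = 0"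
      by (simp add: sum_distrib_left mult.assoc)
  qed
  then have "\<forall>a. \<forall>e. \<exists>KRS. \<forall>s\<in>right_half_plane. V s $ a $ e = poly (fst KRS) s + (\<Sum>j\<in>?I. fst (snd KRS) j / (s - lam j) + snd (snd KRS) j / (s - lam j)\<^sup>2)"
    by simp
  then have "\<forall>a. \<exists>X. \<forall>e. \<forall>s\<in>right_half_plane. V s $ a $ e = poly (fst (X e)) s + (\<Sum>j\<in>?I. fst (snd (X e)) j / (s - lam j) + snd (snd (X e)) j / (s - lam j)\<^sup>2)"
    by (intro allI choice) blast
  from choice[OF this] obtain X where
    X: "\<forall>a e. \<forall>s\<in>right_half_plane. V s $ a $ e = poly (fst (X a e)) s + (\<Sum>j\<in>?I. fst (snd (X a e)) j / (s - lam j) + snd (snd (X a e)) j / (s - lam j)\<^sup>2)" ..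
  \<comment> \<open>Along the positive real axis both \<open>V\<close>, by its Hardy norm, and all
    pole terms tend to 0, which rules out a polynomial part.\<close>
  have K0: "fst (X a e) = 0" for a e
  proof (rule poly_tendsto_0_imp_0)
    have inf: "filterlim (\<lambda>x::real. complex_of_real x - lam j) at_infinity at_top" for j
    proof -
      have "filterlim (\<lambda>x::real. complex_of_real x + (- lam j)) at_infinity at_top"
        by (rule tendsto_add_filterlim_at_infinity'[OF filterlim_of_real_at_infinity tendsto_const])
      then show ?thesis by simp
    qed
    have inv: "((\<lambda>x::real. k / (complex_of_real x - lam j)) \<longlongrightarrow> 0) at_top" for j k
      by (rule tendsto_divide_0[OF tendsto_const inf])
    have t1: "((\<lambda>x. \<Sum>j\<in>?I. fst (snd (X a e)) j / (complex_of_real x - lam j) + snd (snd (X a e)) j / (complex_of_real x - lam j) * (1 / (complex_of_real x - lam j))) \<longlongrightarrow> (\<Sum>j\<in>?I. 0 + 0 * 0)) at_top"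
      by (intro tendsto_sum tendsto_add tendsto_mult inv)
    have t2: "((\<lambda>x. V (of_real x) $ a $ e) \<longlongrightarrow> 0) at_top"
    proof (rule Lim_null_comparison)
      have "filterlim (\<lambda>x. sqrt (2 * x)) at_top at_top"
        by (rule filterlim_compose[OF sqrt_at_top]) (rule filterlim_tendsto_pos_mult_at_top[OF tendsto_const _ filterlim_ident], simp)
      then show "((\<lambda>x. h2_norm V / sqrt (2 * x)) \<longlongrightarrow> 0) at_top"
        by (intro tendsto_divide_0[OF tendsto_const] filterlim_at_top_imp_at_infinity)
      show "\<forall>\<^sub>F x in at_top. norm (V (complex_of_real x) $ a $ e) \<le> h2_norm V / sqrt (2 * x)"
        using eventually_gt_at_top[of 0]
      proof eventually_elim
        case (elim x)
        then show ?case using entry_le_h2_norm[OF Vh, of "of_real x" a e] by (simp add: right_half_plane_def)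
      qed
    qed
    have "((\<lambda>x. V (of_real x) $ a $ e - (\<Sum>j\<in>?I. fst (snd (X a e)) j / (complex_of_real x - lam j) + snd (snd (X a e)) j / (complex_of_real x - lam j) * (1 / (complex_of_real x - lam j)))) \<longlongrightarrow> 0 - (\<Sum>j\<in>?I. 0 + 0 * 0)) at_top"
      by (intro tendsto_diff t1 t2)
    moreover have "\<forall>\<^sub>F x in at_top. V (of_real x) $ a $ e - (\<Sum>j\<in>?I. fst (snd (X a e)) j / (complex_of_real x - lam j) + snd (snd (X a e)) j / (complex_of_real x - lam j) * (1 / (complex_of_real x - lam j))) = poly (fst (X a e)) (of_real x)"
      using eventually_gt_at_top[of 0]
    proof eventually_elim
      case (elim x)
      then have "complex_of_real x \<in> right_half_plane" by (simp add: right_half_plane_def)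
      then show ?case using X by (simp add: power2_eq_square)
    qed
    ultimately have "((\<lambda>x. poly (fst (X a e)) (of_real x)) \<longlongrightarrow> 0 - (\<Sum>j\<in>?I. 0 + 0 * 0)) at_top"
      by (rule Lim_transform_eventually)
    then show "((\<lambda>x. poly (fst (X a e)) (of_real x)) \<longlongrightarrow> 0) at_top" by simp
  qed
  define R :: "nat \<Rightarrow> complex^'m^'p" where "R j = (\<chi> a e. fst (snd (X a e)) j)" for j
  define S :: "nat \<Rightarrow> complex^'m^'p" where "S j = (\<chi> a e. snd (snd (X a e)) j)" for j
  have form: "V s $ a $ e = (\<Sum>j\<in>?I. R j $ a $ e / (s - lam j) + S j $ a $ e / (s - lam j)\<^sup>2)" if "s \<in> right_half_plane" for s a e
    using X that K0 by (simp add: R_def S_def)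
  show ?thesis
  proof (rule exI[of _ R], rule exI[of _ S], intro conjI ballI allI impI)
    fix i x1 x2 y1 y2 assume i: "i \<in> ?I"
      and xy: "(\<Sum>a\<in>UNIV. x1 $ a * c i $ a) = 0" "(\<Sum>e\<in>UNIV. cnj (b i $ e) * y1 $ e) = 0"
    show "(\<Sum>a\<in>UNIV. \<Sum>e\<in>UNIV. x1 $ a * R i $ a $ e * y1 $ e + x2 $ a * S i $ a $ e * y1 $ e + x1 $ a * S i $ a $ e * y2 $ e) = 0"
    proof (rule double_difference_conditions[where I = ?I and lam = lam and V = V and c = c and b = b])
      show "Re (lam j) < 0" if "j \<in> ?I" for j using lam that by blast
      show "(\<Sum>a\<in>UNIV. \<Sum>e\<in>UNIV. \<Sum>s\<in>N'. \<Sum>w\<in>N. u s $ a * v w $ e * (V s $ a $ e - V w $ a $ e) / (s - w)) = 0"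
        if "finite N'" "finite N" "N' \<subseteq> right_half_plane" "N \<subseteq> right_half_plane" "N' \<inter> N = {}"
          "\<And>i. i \<in> ?I \<Longrightarrow> (\<Sum>s\<in>N'. (\<Sum>a\<in>UNIV. u s $ a * c i $ a) / (s - lam i)) = 0"
          "\<And>i. i \<in> ?I \<Longrightarrow> (\<Sum>w\<in>N. (\<Sum>e\<in>UNIV. cnj (b i $ e) * v w $ e) / (w - lam i)) = 0" for N' N u v
        using dd[OF that] unfolding loewner_def .
    qed (fact finite_atLeastAtMost i inj xy form)+
  qed (rule form)
qed

text \<open>The conditions say that \<open>S\<close> is a multiple of \<open>c\<close> times the
  adjoint of \<open>b\<close>, and that \<open>R\<close> vanishes on pairs of vectors annihilating
  \<open>c\<close> and \<open>b\<close>. The decomposition of \<open>R\<close> is never constructed: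
  the conjugated rows of \<open>A\<close> are admissible test vectors, and on them \<open>R\<close>
  takes values proportional to \<open>c\<close>.\<close>

lemma entry_pairing_tangent_0:
  fixes R S A A' :: "complex^'m^'p"
  assumes cb: "c \<noteq> 0" "b \<noteq> 0"
    and cond: "\<forall>x1 x2 y1 y2. (\<Sum>a\<in>UNIV. x1 $ a * c $ a) = 0 \<longrightarrow> (\<Sum>e\<in>UNIV. cnj (b $ e) * y1 $ e) = 0 \<longrightarrow>
      (\<Sum>a\<in>UNIV. \<Sum>e\<in>UNIV. x1 $ a * R $ a $ e * y1 $ e + x2 $ a * S $ a $ e * y1 $ e + x1 $ a * S $ a $ e * y2 $ e) = 0"
    and Ab: "\<And>a. (\<Sum>e\<in>UNIV. A $ a $ e * b $ e) = 0" and cA: "\<And>e. (\<Sum>a\<in>UNIV. cnj (c $ a) * A $ a $ e) = 0"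
    and A': "(\<Sum>a\<in>UNIV. \<Sum>e\<in>UNIV. cnj (c $ a) * A' $ a $ e * b $ e) = 0"
  shows "entry_pairing R A = 0" "entry_pairing S A' = 0"
proof -
  obtain k where k: "c $ k \<noteq> 0" using cb by (auto simp: Finite_Cartesian_Product.vec_eq_iff)
  obtain l where l: "b $ l \<noteq> 0" using cb by (auto simp: Finite_Cartesian_Product.vec_eq_iff)
  have zero: "(\<Sum>a\<in>UNIV. 0 $ a * c $ a) = 0" "(\<Sum>e\<in>UNIV. cnj (b $ e) * 0 $ e) = 0" by simp_all
  have ax: "(\<Sum>a\<in>UNIV. axis i x $ a * f a) = x * f i" for i :: "'k::finite" and x :: complex and f
  proof -
    have "(\<Sum>a\<in>UNIV. axis i x $ a * f a) = (\<Sum>a\<in>UNIV. if a = i then x * f i else 0)"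
      by (intro sum.cong refl) (simp add: axis_def)
    then show ?thesis by simp
  qed
  have dx: "(\<Sum>a\<in>UNIV. (axis i x - axis j y) $ a * f a) = x * f i - y * f j" for i j :: "'k::finite" and x y :: complex and f
    unfolding vector_minus_component left_diff_distrib sum_subtractf ax ..
  have S1: "S $ a $ e * cnj (b $ l) = S $ a $ l * cnj (b $ e)" for a e
  proof -
    \<comment> \<open>Two-entry vectors annihilated by \<open>b\<close>; the identity they yield is
      the vanishing of a 2 by 2 minor.\<close>
    define y :: "complex^'m" where "y = axis e (cnj (b $ l)) - axis l (cnj (b $ e))"
    have "(\<Sum>e\<in>UNIV. cnj (b $ e) * y $ e) = 0" using dx[of e "cnj (b $ l)" l "cnj (b $ e)" "\<lambda>e. cnj (b $ e)"]
      by (simp add: y_def mult.commute)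
    with cond zero(1) have "(\<Sum>a'\<in>UNIV. \<Sum>e\<in>UNIV. 0 $ a' * R $ a' $ e * y $ e + axis a 1 $ a' * S $ a' $ e * y $ e + 0 $ a' * S $ a' $ e * 0 $ e) = 0"
      by blast
    then have "(\<Sum>a'\<in>UNIV. axis a 1 $ a' * (\<Sum>e\<in>UNIV. y $ e * S $ a' $ e)) = 0"
      by (simp add: sum_distrib_left mult.commute mult.left_commute)
    then show ?thesis unfolding ax unfolding y_def dx by (simp add: mult.commute)
  qed
  have S2: "S $ a $ e * c $ k = S $ k $ e * c $ a" for a e
  proof -
    define x :: "complex^'p" where "x = axis a (c $ k) - axis k (c $ a)"
    have "(\<Sum>a\<in>UNIV. x $ a * c $ a) = 0" unfolding x_def dx by simp
    with cond zero(2) have "(\<Sum>a\<in>UNIV. \<Sum>e'\<in>UNIV. x $ a * R $ a $ e' * 0 $ e' + 0 $ a * S $ a $ e' * 0 $ e' + x $ a * S $ a $ e' * axis e 1 $ e') = 0"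
      by blast
    then have "(\<Sum>a\<in>UNIV. x $ a * (\<Sum>e'\<in>UNIV. axis e 1 $ e' * S $ a $ e')) = 0"
      by (simp add: sum_distrib_left mult.commute mult.left_commute)
    then show ?thesis unfolding ax unfolding x_def dx by (simp add: mult.commute)
  qed
  define \<sigma> where "\<sigma> = S $ k $ l / (c $ k * cnj (b $ l))"
  have S3: "S $ a $ e = \<sigma> * (c $ a * cnj (b $ e))" for a e
  proof -
    have "S $ a $ e * (c $ k * cnj (b $ l)) = (S $ a $ e * cnj (b $ l)) * c $ k" by simp
    also have "\<dots> = (S $ a $ l * c $ k) * cnj (b $ e)" unfolding S1[of a e] by simp
    also have "\<dots> = S $ k $ l * (c $ a * cnj (b $ e))" unfolding S2[of a l] by simp
    finally show ?thesis using k l by (simp add: \<sigma>_def field_simps)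
  qed
  have "entry_pairing S A' = \<sigma> * cnj (\<Sum>a\<in>UNIV. \<Sum>e\<in>UNIV. cnj (c $ a) * A' $ a $ e * b $ e)"
    unfolding entry_pairing_def S3 cnj_sum sum_distrib_left by (intro sum.cong refl) simp
  then show "entry_pairing S A' = 0" using A' by simp
  \<comment> \<open>Admissible as \<open>y1\<close> because \<open>A\<close> annihilates
    \<open>b\<close>.\<close>
  define y where "y a = (\<chi> e. cnj (A $ a $ e))" for a
  have yb: "(\<Sum>e\<in>UNIV. cnj (b $ e) * y a $ e) = 0" for a
  proof -
    have "(\<Sum>e\<in>UNIV. cnj (b $ e) * y a $ e) = cnj (\<Sum>e\<in>UNIV. A $ a $ e * b $ e)" by (simp add: y_def mult.commute)
    then show ?thesis by (simp add: Ab)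
  qed
  have R1: "(\<Sum>e\<in>UNIV. R $ a $ e * y a' $ e) * c $ k = (\<Sum>e\<in>UNIV. R $ k $ e * y a' $ e) * c $ a" for a a'
  proof -
    define x :: "complex^'p" where "x = axis a (c $ k) - axis k (c $ a)"
    have "(\<Sum>a\<in>UNIV. x $ a * c $ a) = 0" unfolding x_def dx by simp
    with cond yb have "(\<Sum>a\<in>UNIV. \<Sum>e\<in>UNIV. x $ a * R $ a $ e * y a' $ e + 0 $ a * S $ a $ e * y a' $ e + x $ a * S $ a $ e * 0 $ e) = 0"
      by blast
    then have "(\<Sum>a\<in>UNIV. x $ a * (\<Sum>e\<in>UNIV. R $ a $ e * y a' $ e)) = 0"
      by (simp add: sum_distrib_left mult.assoc)
    then show ?thesis unfolding x_def dx by (simp add: mult.commute)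
  qed
  have "entry_pairing R A * c $ k = (\<Sum>a\<in>UNIV. (\<Sum>e\<in>UNIV. R $ a $ e * y a $ e) * c $ k)"
    unfolding entry_pairing_def sum_distrib_right y_def by simp
  also have "\<dots> = (\<Sum>a\<in>UNIV. \<Sum>e\<in>UNIV. R $ k $ e * y a $ e * c $ a)" unfolding R1 by (simp add: sum_distrib_right)
  also have "\<dots> = (\<Sum>e\<in>UNIV. \<Sum>a\<in>UNIV. R $ k $ e * y a $ e * c $ a)" by (rule sum.swap)
  also have "\<dots> = (\<Sum>e\<in>UNIV. R $ k $ e * cnj (\<Sum>a\<in>UNIV. cnj (c $ a) * A $ a $ e))"
    unfolding cnj_sum sum_distrib_left by (intro sum.cong refl) (simp add: y_def mult.commute)
  also have "\<dots> = 0" by (simp add: cA)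
  finally show "entry_pairing R A = 0" using k by simp
qed

section \<open>Curves of stable systems\<close>

text \<open>On an affine curve the difference quotients are exact, so every derivative condition
  holds with remainder 0 and orders from 2 on vanish.\<close>

lemma tangent_line:
  fixes F G :: "complex \<Rightarrow> complex^'m^'p"
  assumes F: "F \<in> hardy2" and G: "G \<in> hardy2" and eps: "\<epsilon> > 0"
    and st: "\<And>t. \<bar>t\<bar> < \<epsilon> \<Longrightarrow> (\<lambda>s. F s + t *\<^sub>R G s) \<in> stable_systems r"
  shows "G \<in> tangent_space r F"
proof -
  define D where "D k t = (if k = 0 then (\<lambda>s. F s + t *\<^sub>R G s) else if k = Suc 0 then G else (\<lambda>s. 0))" for k :: nat and t :: real
  have "D k t \<in> hardy2" for k t
  proof -
    have "(\<lambda>s. F s + t *\<^sub>R G s) \<in> hardy2"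
      by (rule hardy2_lincomb[OF F G, where a = 1 and b = "of_real t"]) (simp add: scaleR_conv_of_real[where 'a = complex])
    then show ?thesis using G h2_zero(1)[of "\<lambda>s. 0 :: complex^'m^'p"] by (simp add: D_def)
  qed
  moreover have "h2_curve_derivative (D k) (D (Suc k) t) t" for k t
    unfolding h2_curve_derivative_def
  proof (rule tendsto_eventually)
    have "h2_norm (\<lambda>s. (1 / h) *\<^sub>R (D k (t + h) s - D k t s) - D (Suc k) t s) = 0" if "h \<noteq> 0" for h
      by (rule h2_zero(2)) (use that in \<open>simp add: D_def algebra_simps\<close>)
    then show "\<forall>\<^sub>F h in at 0. h2_norm (\<lambda>s. (1 / h) *\<^sub>R (D k (t + h) s - D k t s) - D (Suc k) t s) = 0"
      by (auto simp: eventually_at_filter)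
  qed
  ultimately have "h2_smooth_derivatives {-\<epsilon><..<\<epsilon>} D" by (simp add: h2_smooth_derivatives_def)
  moreover have "\<forall>t\<in>{-\<epsilon><..<\<epsilon>}. D 0 t \<in> stable_systems r" using st by (auto simp: D_def)
  moreover have "D 0 0 = F" "D (Suc 0) 0 = G" by (simp_all add: D_def)
  ultimately show ?thesis unfolding tangent_space_def mem_Collect_eq
    by (intro exI[of _ \<epsilon>] exI[of _ D] conjI eps)
qed

text \<open>The second-order Taylor bound for \<open>(1 - u)^-n\<close>, uniform on the disc of
  radius 1/2. Passing to \<open>n + 1\<close> divides by \<open>1 - u\<close>, whose modulus is at
  least 1/2 there; hence the factor 2 in the new constant.\<close>

lemma geometric_power_remainder:
  "\<exists>C\<ge>0. \<forall>u::complex. cmod u \<le> 1/2 \<longrightarrow> cmod ((1 / (1 - u)) ^ n - 1 - of_nat n * u) \<le> C * (cmod u)\<^sup>2"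
proof (induction n)
  case 0
  show ?case by (intro exI[of _ 0]) simp
next
  case (Suc n)
  then obtain C where C: "C \<ge> 0" "\<And>u::complex. cmod u \<le> 1/2 \<Longrightarrow> cmod ((1 / (1 - u)) ^ n - 1 - of_nat n * u) \<le> C * (cmod u)\<^sup>2" by blast
  have "cmod ((1 / (1 - u)) ^ Suc n - 1 - of_nat (Suc n) * u) \<le> 2 * (C + real (Suc n)) * (cmod u)\<^sup>2" if u: "cmod u \<le> 1/2" for u :: complex
  proof -
    have lower: "1/2 \<le> cmod (1 - u)" using norm_triangle_ineq2[of 1 u] u by simp
    then have nz: "1 - u \<noteq> 0" by auto
    have "(1 / (1 - u)) ^ Suc n - 1 - of_nat (Suc n) * u = (((1 / (1 - u)) ^ n - 1 - of_nat n * u) + of_nat (Suc n) * u\<^sup>2) / (1 - u)"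
    proof -
      have "(1 / (1 - u)) ^ Suc n = (1 / (1 - u)) ^ n / (1 - u)" by simp
      moreover have "1 + of_nat (Suc n) * u = (1 + of_nat n * u - of_nat (Suc n) * u\<^sup>2) / (1 - u)"
        using nz by (simp add: eq_divide_eq) (simp add: algebra_simps power2_eq_square)
      ultimately show ?thesis by (simp add: diff_diff_eq diff_divide_distrib[symmetric] del: of_nat_Suc)
    qed
    also have "cmod \<dots> \<le> (C * (cmod u)\<^sup>2 + real (Suc n) * (cmod u)\<^sup>2) / cmod (1 - u)"
      unfolding norm_divide
      using C(2)[OF u] by (intro divide_right_mono order.trans[OF norm_triangle_ineq] add_mono) (simp_all add: norm_mult norm_power del: of_nat_Suc)
    also have "\<dots> \<le> (C * (cmod u)\<^sup>2 + real (Suc n) * (cmod u)\<^sup>2) / (1/2)"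
      using lower C(1) by (intro divide_left_mono) auto
    finally show ?thesis by (simp add: algebra_simps del: of_nat_Suc)
  qed
  then show ?case using C(1) by (intro exI[of _ "2 * (C + real (Suc n))"]) auto
qed

text \<open>The remainder of the difference quotient is bounded pointwise by \<open>|h|\<close>
  times a constant times the kernel, which is square integrable. The nested sum has the shape that
  two applications of \<open>bdry_lincomb\<close> produce.\<close>

lemma pole_power_derivative:
  assumes mu: "Re \<mu> < 0"
  shows "((\<lambda>h. l2sq (\<lambda>\<omega>. of_real (1 / h) * (pole_fun (\<mu> + of_real h) 0 \<omega>) ^ n + (of_real (- 1 / h) * (pole_fun \<mu> 0 \<omega>) ^ n + (- of_nat n) * (pole_fun \<mu> 0 \<omega>) ^ Suc n))) \<longlongrightarrow> 0) (at 0)"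
proof -
  obtain C where C: "C \<ge> 0" "\<And>u::complex. cmod u \<le> 1/2 \<Longrightarrow> cmod ((1 / (1 - u)) ^ n - 1 - of_nat n * u) \<le> C * (cmod u)\<^sup>2"
    using geometric_power_remainder[of n] by blast
  define B where "B = 1 / \<bar>Re \<mu>\<bar>"
  have B: "B > 0" using mu by (simp add: B_def)
  have pb: "cmod (pole_fun \<mu> 0 \<omega>) \<le> B" for \<omega> unfolding B_def by (rule pole_fun_bound[OF mu]) simp
  define c where "c = C * B ^ Suc n"
  have "((\<lambda>h. (h * c)\<^sup>2 * l2sq (pole_fun \<mu> 0)) \<longlongrightarrow> (0 * c)\<^sup>2 * l2sq (pole_fun \<mu> 0)) (at 0)" by (intro tendsto_intros)
  then have lim: "((\<lambda>h. (h * c)\<^sup>2 * l2sq (pole_fun \<mu> 0)) \<longlongrightarrow> 0) (at 0)" by simp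
  show ?thesis
  proof (rule Lim_null_comparison[OF _ lim])
    have "\<forall>\<^sub>F h in at 0. \<bar>h\<bar> < 1 / (2 * B)"
      using B by (intro eventually_at_filter[THEN iffD2] eventually_mono[OF eventually_nhds_in_open[of "{-1/(2*B)<..<1/(2*B)}" 0]]) auto
    moreover have "\<forall>\<^sub>F h in at 0. h \<noteq> (0::real)" by (simp add: eventually_at_filter)
    ultimately show "\<forall>\<^sub>F h in at 0. norm (l2sq (\<lambda>\<omega>. of_real (1 / h) * (pole_fun (\<mu> + of_real h) 0 \<omega>) ^ n + (of_real (- 1 / h) * (pole_fun \<mu> 0 \<omega>) ^ n + (- of_nat n) * (pole_fun \<mu> 0 \<omega>) ^ Suc n))) \<le> (h * c)\<^sup>2 * l2sq (pole_fun \<mu> 0)"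
    proof eventually_elim
      case (elim h)
      let ?\<rho> = "\<lambda>\<omega>. of_real (1 / h) * (pole_fun (\<mu> + of_real h) 0 \<omega>) ^ n + (of_real (- 1 / h) * (pole_fun \<mu> 0 \<omega>) ^ n + (- of_nat n) * (pole_fun \<mu> 0 \<omega>) ^ Suc n)"
      have le: "cmod (?\<rho> \<omega>) \<le> cmod (of_real (h * c) * pole_fun \<mu> 0 \<omega>)" for \<omega>
      proof -
        define x where "x = pole_fun \<mu> 0 \<omega>"
        \<comment> \<open>Moving the pole by \<open>h\<close> multiplies the kernel \<open>x\<close>
          by \<open>1 / (1 - u)\<close>. The restriction \<open>|h| < 1 / (2 * B)\<close> serves to
          keep \<open>u\<close> in the disc of \<open>geometric_power_remainder\<close>.\<close>
        define u where "u = of_real h * x"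
        have xB: "cmod x \<le> B" using pb by (simp add: x_def)
        have nz: "Complex 0 \<omega> - \<mu> \<noteq> 0" using mu by (auto simp: complex_eq_iff)
        have "cmod u = \<bar>h\<bar> * cmod x" by (simp add: u_def norm_mult)
        also have "\<dots> \<le> 1 / (2 * B) * B" using elim xB B by (intro mult_mono) auto
        finally have u: "cmod u \<le> 1/2" using B by simp
        then have u1: "1 - u \<noteq> 0" by auto
        have px: "pole_fun (\<mu> + of_real h) 0 \<omega> = x * (1 / (1 - u))"
        proof -
          have "1 - u = (Complex 0 \<omega> - (\<mu> + of_real h)) / (Complex 0 \<omega> - \<mu>)"
            using nz by (simp add: u_def x_def pole_fun_def field_simps)
          then show ?thesis using nz by (simp add: x_def pole_fun_def)
        qed
        have "?\<rho> \<omega> = x ^ n * ((1 / (1 - u)) ^ n - 1 - of_nat n * u) / of_real h"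
          unfolding px x_def[symmetric] power_mult_distrib using elim
          by (simp add: u_def field_simps)
        then have "cmod (?\<rho> \<omega>) = cmod x ^ n * cmod ((1 / (1 - u)) ^ n - 1 - of_nat n * u) / \<bar>h\<bar>"
          by (simp add: norm_mult norm_divide norm_power)
        also have "\<dots> \<le> cmod x ^ n * (C * (cmod u)\<^sup>2) / \<bar>h\<bar>"
          using C(2)[OF u] by (intro divide_right_mono mult_left_mono) auto
        also have "\<dots> = C * \<bar>h\<bar> * (cmod x ^ Suc n * cmod x)"
          using elim by (simp add: u_def norm_mult power_mult_distrib power2_eq_square field_simps)
        also have "\<dots> \<le> C * \<bar>h\<bar> * (B ^ Suc n * cmod x)"
          using C(1) xB B by (intro mult_left_mono mult_right_mono power_mono) auto
        also have "\<dots> = \<bar>h * c\<bar> * cmod x" using C(1) B by (simp add: c_def abs_mult)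
        also have "\<dots> = cmod (of_real (h * c) * pole_fun \<mu> 0 \<omega>)" unfolding x_def[symmetric] by (simp only: norm_mult norm_of_real)
        finally show ?thesis .
      qed
      have LL: "L2 (\<lambda>\<omega>. of_real (h * c) * pole_fun \<mu> 0 \<omega>)" using mu by (intro L2_cmult pole_fun_L2) simp
      have m: "?\<rho> \<in> borel_measurable lborel" by measurable
      have "l2sq ?\<rho> \<le> l2sq (\<lambda>\<omega>. of_real (h * c) * pole_fun \<mu> 0 \<omega>)" by (rule L2_dominated(2)[OF LL m le])
      also have "\<dots> = (h * c)\<^sup>2 * l2sq (pole_fun \<mu> 0)" by (subst l2sq_cmult) (simp only: norm_of_real power2_abs)
      finally show ?case by simp
    qed
  qed
qed

lemma pole_matrix_derivative:
  fixes K :: "complex^'m^'p"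
  assumes mu: "Re \<mu> < 0"
  shows "((\<lambda>h. h2_norm (\<lambda>s. (1 / h) *\<^sub>R (pole_matrix K (\<mu> + of_real h) (Suc n) s - pole_matrix K \<mu> (Suc n) s) - of_nat (Suc n) *\<^sub>R pole_matrix K \<mu> (Suc (Suc n)) s)) \<longlongrightarrow> 0) (at 0)"
    (is "((\<lambda>h. h2_norm (?W h)) \<longlongrightarrow> 0) _")
proof -
  define \<rho> where "\<rho> h \<omega> = of_real (1 / h) * (pole_fun (\<mu> + of_real h) 0 \<omega>) ^ Suc n + (of_real (- 1 / h) * (pole_fun \<mu> 0 \<omega>) ^ Suc n + (- of_nat (Suc n)) * (pole_fun \<mu> 0 \<omega>) ^ Suc (Suc n))" for h \<omega>
  have "((\<lambda>h. sqrt ((\<Sum>i\<in>(UNIV::'p set). \<Sum>j\<in>(UNIV::'m set). (cmod (K $ i $ j))\<^sup>2 * l2sq (\<rho> h)) / (2 * pi))) \<longlongrightarrow> sqrt ((\<Sum>i\<in>(UNIV::'p set). \<Sum>j\<in>(UNIV::'m set). (cmod (K $ i $ j))\<^sup>2 * 0) / (2 * pi))) (at 0)"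
    unfolding \<rho>_def by (intro tendsto_intros pole_power_derivative[OF mu]) simp
  then have lim: "((\<lambda>h. sqrt ((\<Sum>i\<in>(UNIV::'p set). \<Sum>j\<in>(UNIV::'m set). (cmod (K $ i $ j))\<^sup>2 * l2sq (\<rho> h)) / (2 * pi))) \<longlongrightarrow> 0) (at 0)"
    by simp
  have "\<forall>\<^sub>F h in at 0. \<bar>h\<bar> < - Re \<mu>"
    using mu by (intro eventually_at_filter[THEN iffD2] eventually_mono[OF eventually_nhds_in_open[of "{Re \<mu><..<- Re \<mu>}" 0]]) auto
  then have "\<forall>\<^sub>F h in at 0. sqrt ((\<Sum>i\<in>(UNIV::'p set). \<Sum>j\<in>(UNIV::'m set). (cmod (K $ i $ j))\<^sup>2 * l2sq (\<rho> h)) / (2 * pi)) = h2_norm (?W h)"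
  proof eventually_elim
    case (elim h)
    have mh: "Re (\<mu> + of_real h) < 0" using elim by simp
    define f1 f2 f3 where "f1 = (\<lambda>s. (1 / (s - (\<mu> + of_real h))) ^ Suc n)" and "f2 = (\<lambda>s. (1 / (s - \<mu>)) ^ Suc n)" and "f3 = (\<lambda>s. (1 / (s - \<mu>)) ^ Suc (Suc n))"
    note H = pole_power_hardy[OF mh, of n, folded f1_def] pole_power_hardy[OF mu, of n, folded f2_def] pole_power_hardy[OF mu, of "Suc n", folded f3_def]
    note b = pole_power_bdry[OF mh, of n, folded f1_def] pole_power_bdry[OF mu, of n, folded f2_def] pole_power_bdry[OF mu, of "Suc n", folded f3_def]
    note H23 = hardy_bound_lincomb[OF H(2,3), of "of_real (- 1 / h)" "- of_nat (Suc n)"]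
    note b23 = bdry_lincomb[OF H(2,3) b(2,3), of "of_real (- 1 / h)" "- of_nat (Suc n)"]
    note H123 = hardy_bound_lincomb[OF H(1) H23, of "of_real (1 / h)" 1]
    note b123 = bdry_lincomb[OF H(1) H23 b(1) b23, of "of_real (1 / h)" 1]
    define g where "g = (\<lambda>s. of_real (1 / h) * f1 s + 1 * (of_real (- 1 / h) * f2 s + (- of_nat (Suc n)) * f3 s))"
    have gb: "bdry g (\<rho> h)" using b123 unfolding g_def \<rho>_def by simp
    have ent: "(\<lambda>s. ?W h s $ i $ j) = (\<lambda>s. K $ i $ j * g s + 0 * g s)" for i j
      unfolding g_def f1_def f2_def f3_def pole_matrix_def
      by (simp add: fun_eq_iff scaleR_conv_of_real[where 'a = complex] algebra_simps del: power_Suc of_nat_Suc)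
    have Wh: "?W h \<in> hardy2"
      by (rule hardy2I, subst ent, rule hardy_bound_lincomb[OF H123[folded g_def] H123[folded g_def]])
    have Wb: "bdry (\<lambda>s. ?W h s $ i $ j) (\<lambda>\<omega>. K $ i $ j * \<rho> h \<omega> + 0 * \<rho> h \<omega>)" for i j
      unfolding ent by (rule bdry_lincomb[OF H123[folded g_def] H123[folded g_def] gb gb])
    show ?case unfolding h2_norm_eq[OF Wh Wb] by (simp add: l2sq_cmult)
  qed
  with lim show ?thesis by (rule Lim_transform_eventually)
qed

text \<open>The derivatives of all orders are explicit: the order \<open>k\<close> in
  \<open>t\<close> of a simple pole at \<open>\<mu> + t\<close> is \<open>fact k\<close> times the
  pole of order \<open>k + 1\<close>. The bound on \<open>t\<close> keeps the pole in the left
  half-plane.\<close>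

lemma tangent_moving_pole:
  fixes F :: "complex \<Rightarrow> complex^'m^'p" and K :: "complex^'m^'p"
  assumes F: "F \<in> hardy2" and mu: "Re \<mu> < 0" and eps: "\<epsilon> > 0"
    and st: "\<And>t. \<bar>t\<bar> < \<epsilon> \<Longrightarrow> Re \<mu> + t < 0 \<and> (\<lambda>s. F s + (pole_matrix K (\<mu> + of_real t) 1 s - pole_matrix K \<mu> 1 s)) \<in> stable_systems r"
  shows "pole_matrix K \<mu> 2 \<in> tangent_space r F"
proof -
  define P where "P k t s = (fact k :: real) *\<^sub>R pole_matrix K (\<mu> + of_real t) (Suc k) s" for k t s
  \<comment> \<open>The part of \<open>F\<close> that stays fixed, which therefore contributes to
    order 0 only.\<close>
  define E where "E k s = (if k = (0::nat) then F s - pole_matrix K \<mu> 1 s else 0)" for k s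
  define D where "D k t s = E k s + P k t s" for k t s
  have neg: "Re (\<mu> + of_real t) < 0" if "t \<in> {-\<epsilon><..<\<epsilon>}" for t
    using st[of t] that by auto
  have Eh: "E k \<in> hardy2" for k
  proof (cases "k = 0")
    case True
    have "pole_matrix K \<mu> 1 \<in> hardy2" using pole_matrix_hardy2(1)[OF mu, of K 0] by simp
    then show ?thesis by (rule hardy2_lincomb[OF F, where a = 1 and b = "- 1"]) (simp add: E_def True)
  next
    case False
    then show ?thesis by (intro h2_zero(1)) (simp add: E_def)
  qed
  have Dh: "D k t \<in> hardy2" if "t \<in> {-\<epsilon><..<\<epsilon>}" for k t
    by (rule hardy2_lincomb[OF Eh[of k] pole_matrix_hardy2(1)[OF neg[OF that], of K k], where a = 1 and b = "of_real (fact k)"])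
       (simp add: D_def P_def scaleR_conv_of_real[where 'a = complex])
  have Dd: "h2_curve_derivative (D k) (D (Suc k) t) t" if "t \<in> {-\<epsilon><..<\<epsilon>}" for k t
  proof -
    define W where "W h s = (1 / h) *\<^sub>R (pole_matrix (fact k *\<^sub>R K) (\<mu> + of_real t + of_real h) (Suc k) s - pole_matrix (fact k *\<^sub>R K) (\<mu> + of_real t) (Suc k) s) -
      of_nat (Suc k) *\<^sub>R pole_matrix (fact k *\<^sub>R K) (\<mu> + of_real t) (Suc (Suc k)) s" for h s
    have sc: "pole_matrix (x *\<^sub>R K) \<nu> n s = x *\<^sub>R pole_matrix K \<nu> n s" for x :: real and \<nu> n s
      by (simp add: pole_matrix_def Finite_Cartesian_Product.vec_eq_iff)
    have "(\<lambda>s. (1 / h) *\<^sub>R (D k (t + h) s - D k t s) - D (Suc k) t s) = W h" for h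
      by (simp add: fun_eq_iff D_def P_def E_def W_def sc add.assoc mult.commute)
    then show ?thesis
      unfolding h2_curve_derivative_def W_def
      using pole_matrix_derivative[OF neg[OF that], of "fact k *\<^sub>R K" k] by simp
  qed
  have "h2_smooth_derivatives {-\<epsilon><..<\<epsilon>} D" unfolding h2_smooth_derivatives_def using Dh Dd by blast
  moreover have "\<forall>t\<in>{-\<epsilon><..<\<epsilon>}. D 0 t \<in> stable_systems r"
  proof
    fix t assume "t \<in> {-\<epsilon><..<\<epsilon>}"
    then have "(\<lambda>s. F s + (pole_matrix K (\<mu> + of_real t) 1 s - pole_matrix K \<mu> 1 s)) \<in> stable_systems r" using st[of t] by auto
    moreover have "(\<lambda>s. F s + (pole_matrix K (\<mu> + of_real t) 1 s - pole_matrix K \<mu> 1 s)) = D 0 t"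
      by (simp add: fun_eq_iff D_def E_def P_def)
    ultimately show "D 0 t \<in> stable_systems r" by simp
  qed
  moreover have "D 0 0 = F" by (simp add: fun_eq_iff D_def E_def P_def)
  moreover have "D (Suc 0) 0 = pole_matrix K \<mu> 2" by (simp add: fun_eq_iff D_def E_def P_def numeral_2_eq_2)
  ultimately show ?thesis unfolding tangent_space_def mem_Collect_eq
    by (intro exI[of _ \<epsilon>] exI[of _ D] conjI eps)
qed

text \<open>Supplies the length of a segment on which a residue vector stays nonzero; with distinct
  stable poles this keeps the system minimal.\<close>

lemma perturbed_vector_nonzero:
  fixes v x :: "complex^'n"
  assumes "v \<noteq> 0"
  obtains \<epsilon> where "\<epsilon> > 0" "\<And>t. \<bar>t\<bar> < \<epsilon> \<Longrightarrow> v + t *\<^sub>R x \<noteq> 0"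
proof
  show "norm v / (norm x + 1) > 0" using assms by (intro divide_pos_pos) (auto intro: add_nonneg_pos)
  fix t assume t: "\<bar>t\<bar> < norm v / (norm x + 1)"
  show "v + t *\<^sub>R x \<noteq> 0"
  proof
    assume "v + t *\<^sub>R x = 0"
    then have "norm v = \<bar>t\<bar> * norm x" by (metis add_eq_0_iff2 norm_minus_cancel norm_scaleR)
    also have "\<dots> \<le> \<bar>t\<bar> * (norm x + 1)" by (intro mult_left_mono) auto
    also have "\<dots> < norm v" using t by (simp add: pos_less_divide_eq add_nonneg_pos)
    finally show False by simp
  qed
qed

section \<open>Reading off the interpolation conditions, and the equivalence\<close>

lemma entry_pairing_outer_right:
  fixes A :: "complex^'m^'p"
  assumes "\<And>x :: complex^'p. entry_pairing (\<chi> a e. x $ a * cnj (b $ e)) A = 0"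
  shows "(\<Sum>e\<in>UNIV. A $ a $ e * b $ e) = 0"
proof -
  have "entry_pairing (\<chi> a' e. axis a 1 $ a' * cnj (b $ e)) A = (\<Sum>a'\<in>UNIV. if a' = a then cnj (\<Sum>e\<in>UNIV. A $ a $ e * b $ e) else 0)"
    unfolding entry_pairing_def
  proof (rule sum.cong[OF refl])
    fix a'
    show "(\<Sum>e\<in>UNIV. (\<chi> a' e. axis a 1 $ a' * cnj (b $ e)) $ a' $ e * cnj (A $ a' $ e)) = (if a' = a then cnj (\<Sum>e\<in>UNIV. A $ a $ e * b $ e) else 0)"
      by (cases "a' = a") (simp_all add: axis_def mult.commute)
  qed
  then have "cnj (\<Sum>e\<in>UNIV. A $ a $ e * b $ e) = 0" using assms[of "axis a 1"] by (simp del: cnj_sum)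
  then show ?thesis by (simp only: complex_cnj_zero_iff)
qed

lemma entry_pairing_outer_left:
  fixes A :: "complex^'m^'p"
  assumes "\<And>y :: complex^'m. entry_pairing (\<chi> a e. c $ a * cnj (y $ e)) A = 0"
  shows "(\<Sum>a\<in>UNIV. cnj (c $ a) * A $ a $ e) = 0"
proof -
  have "entry_pairing (\<chi> a e'. c $ a * cnj (axis e 1 $ e')) A = (\<Sum>a\<in>UNIV. \<Sum>e'\<in>UNIV. if e' = e then c $ a * cnj (A $ a $ e) else 0)"
    unfolding entry_pairing_def by (intro sum.cong refl) (auto simp: axis_def)
  also have "\<dots> = cnj (\<Sum>a\<in>UNIV. cnj (c $ a) * A $ a $ e)" by simp
  finally have "cnj (\<Sum>a\<in>UNIV. cnj (c $ a) * A $ a $ e) = 0" using assms[of "axis e 1"] by (simp del: cnj_sum)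
  then show ?thesis by (simp only: complex_cnj_zero_iff)
qed

theorem corollary6p3:
  fixes H Hhat :: "complex \<Rightarrow> complex^'m^'p"
    and r :: nat
    and b :: "nat \<Rightarrow> complex^'m"
    and c :: "nat \<Rightarrow> complex^'p"
    and lam :: "nat \<Rightarrow> complex"
  assumes "H \<in> hardy2"
    and "Hhat \<in> stable_systems r"
    and "\<forall>s\<in>right_half_plane. Hhat s = pole_residue r c b lam s"
    and "inj_on lam {1..r}"
  shows "h2_orthogonal (\<lambda>s. H s - Hhat s) (tangent_space r Hhat) \<longleftrightarrow>
    (\<forall>i\<in>{1..r}.
       H (- cnj (lam i)) *v b i = Hhat (- cnj (lam i)) *v b i \<and>
       cnj_vec (c i) v* H (- cnj (lam i)) = cnj_vec (c i) v* Hhat (- cnj (lam i)) \<and>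
       cinner_vec (c i) (matrix_deriv H (- cnj (lam i)) *v b i) =
         cinner_vec (c i) (matrix_deriv Hhat (- cnj (lam i)) *v b i))"
proof -
  let ?I = "{1..r}"
  have Hh: "Hhat s = pole_residue r c b lam s" if "s \<in> right_half_plane" for s using assms(3) that by blast
  note inj = assms(4)
  \<comment> \<open>Minimality and stability of \<open>Hhat\<close> are transferred to the given
    pole-residue data, after which its realization is no longer consulted.\<close>
  have cb: "c j \<noteq> 0 \<and> b j \<noteq> 0" and lamj: "Re (lam j) < 0" if "j \<in> ?I" for j
    using stable_pole_residue_nondegenerate[OF assms(2) Hh inj that] by auto
  have lam: "\<forall>j\<in>?I. Re (lam j) < 0" using lamj by blast
  define R0 :: "nat \<Rightarrow> complex^'m^'p" where "R0 j = (\<chi> a e. c j $ a * cnj (b j $ e))" for j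
  have Hent: "Hhat s $ a $ e = (\<Sum>j\<in>?I. R0 j $ a $ e / (s - lam j) + 0 $ a $ e / (s - lam j)\<^sup>2)" if "s \<in> right_half_plane" for s a e
    unfolding Hh[OF that] by (simp add: pole_residue_def R0_def)
  \<comment> \<open>Membership comes along with the inner product formula; \<open>H\<close> serves
    only as some element of the space to pair with.\<close>
  have Hhh: "Hhat \<in> hardy2"
    using h2_inner_pole_sum[OF assms(1) finite_atLeastAtMost lam, of Hhat R0 "\<lambda>_. 0"] Hent by blast
  define F where "F s = H s - Hhat s" for s
  have Fh: "F \<in> hardy2"
    by (rule hardy2_lincomb[OF assms(1) Hhh, where a = 1 and b = "- 1"]) (simp add: F_def)
  define z where "z i = - cnj (lam i)" for i
  have zR: "z i \<in> right_half_plane" if "i \<in> ?I" for i using lamj[OF that] by (simp add: z_def right_half_plane_def)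
  define G where "G i = matrix_deriv F (z i)" for i
  have Gd: "G i $ a $ e = matrix_deriv H (z i) $ a $ e - matrix_deriv Hhat (z i) $ a $ e" if "i \<in> ?I" for i a e
  proof -
    have "(\<lambda>s. H s $ a $ e) field_differentiable at (z i)" "(\<lambda>s. Hhat s $ a $ e) field_differentiable at (z i)"
      using assms(1) Hhh zR[OF that]
      by (auto simp: hardy2_def intro!: holomorphic_on_imp_differentiable_at[of _ right_half_plane])
    then show ?thesis by (simp add: G_def matrix_deriv_def F_def)
  qed
  \<comment> \<open>The interpolation conditions at one pole, written in entries for the error
    \<open>F\<close>, the form in which both directions meet them.\<close>
  define P where "P i \<longleftrightarrow> (\<forall>a. (\<Sum>e\<in>UNIV. F (z i) $ a $ e * b i $ e) = 0) \<and>
     (\<forall>e. (\<Sum>a\<in>UNIV. cnj (c i $ a) * F (z i) $ a $ e) = 0) \<and>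
     (\<Sum>a\<in>UNIV. \<Sum>e\<in>UNIV. cnj (c i $ a) * G i $ a $ e * b i $ e) = 0" for i
  have P: "P i \<longleftrightarrow> H (- cnj (lam i)) *v b i = Hhat (- cnj (lam i)) *v b i \<and>
       cnj_vec (c i) v* H (- cnj (lam i)) = cnj_vec (c i) v* Hhat (- cnj (lam i)) \<and>
       cinner_vec (c i) (matrix_deriv H (- cnj (lam i)) *v b i) =
         cinner_vec (c i) (matrix_deriv Hhat (- cnj (lam i)) *v b i)" if i: "i \<in> ?I" for i
  proof -
    have 1: "(\<forall>a. (\<Sum>e\<in>UNIV. F (z i) $ a $ e * b i $ e) = 0) \<longleftrightarrow> H (z i) *v b i = Hhat (z i) *v b i"
      by (simp add: Finite_Cartesian_Product.vec_eq_iff matrix_vector_mult_def F_def left_diff_distrib sum_subtractf)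
    have 2: "(\<forall>e. (\<Sum>a\<in>UNIV. cnj (c i $ a) * F (z i) $ a $ e) = 0) \<longleftrightarrow> cnj_vec (c i) v* H (z i) = cnj_vec (c i) v* Hhat (z i)"
      by (simp add: Finite_Cartesian_Product.vec_eq_iff vector_matrix_mult_def cnj_vec_def F_def algebra_simps sum_subtractf)
    have "(\<Sum>a\<in>UNIV. \<Sum>e\<in>UNIV. cnj (c i $ a) * G i $ a $ e * b i $ e) =
      cinner_vec (c i) (matrix_deriv H (z i) *v b i) - cinner_vec (c i) (matrix_deriv Hhat (z i) *v b i)"
      unfolding Gd[OF i] cinner_vec_def matrix_vector_mult_def vec_lambda_beta sum_distrib_left sum_subtractf[symmetric]
      by (intro sum.cong refl) (simp add: algebra_simps)
    then show ?thesis unfolding P_def 1 2 by (simp add: z_def)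
  qed
  have main: "h2_orthogonal F (tangent_space r Hhat) \<longleftrightarrow> (\<forall>i\<in>?I. P i)"
  proof
    assume interp: "\<forall>i\<in>?I. P i"
    show "h2_orthogonal F (tangent_space r Hhat)"
      unfolding h2_orthogonal_def
    proof
      fix V assume V: "V \<in> tangent_space r Hhat"
      have "\<exists>R S. (\<forall>s\<in>right_half_plane. \<forall>a e. V s $ a $ e = (\<Sum>j\<in>?I. R j $ a $ e / (s - lam j) + S j $ a $ e / (s - lam j)\<^sup>2)) \<and>
        (\<forall>i\<in>?I. \<forall>x1 x2 y1 y2. (\<Sum>a\<in>UNIV. x1 $ a * c i $ a) = 0 \<longrightarrow> (\<Sum>e\<in>UNIV. cnj (b i $ e) * y1 $ e) = 0 \<longrightarrow>
          (\<Sum>a\<in>UNIV. \<Sum>e\<in>UNIV. x1 $ a * R i $ a $ e * y1 $ e + x2 $ a * S i $ a $ e * y1 $ e + x1 $ a * S i $ a $ e * y2 $ e) = 0)"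
        by (rule tangent_vector_form[OF _ lam inj _ V]) (fact Hh cb)+
      then obtain R S where form: "\<forall>s\<in>right_half_plane. \<forall>a e. V s $ a $ e = (\<Sum>j\<in>?I. R j $ a $ e / (s - lam j) + S j $ a $ e / (s - lam j)\<^sup>2)"
        and cond: "\<forall>i\<in>?I. \<forall>x1 x2 y1 y2. (\<Sum>a\<in>UNIV. x1 $ a * c i $ a) = 0 \<longrightarrow> (\<Sum>e\<in>UNIV. cnj (b i $ e) * y1 $ e) = 0 \<longrightarrow>
          (\<Sum>a\<in>UNIV. \<Sum>e\<in>UNIV. x1 $ a * R i $ a $ e * y1 $ e + x2 $ a * S i $ a $ e * y1 $ e + x1 $ a * S i $ a $ e * y2 $ e) = 0"
        by (elim exE conjE)
      have "h2_inner F V = (\<Sum>j\<in>?I. entry_pairing (R j) (F (- cnj (lam j))) - entry_pairing (S j) (matrix_deriv F (- cnj (lam j))))"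
        using h2_inner_pole_sum[OF Fh finite_atLeastAtMost lam, of V R S] form by blast
      also have "\<dots> = 0"
      proof (rule sum.neutral, rule ballI)
        fix j assume j: "j \<in> ?I"
        have "P j" using interp j by blast
        then have p: "(\<Sum>e\<in>UNIV. F (z j) $ a $ e * b j $ e) = 0" "(\<Sum>a\<in>UNIV. cnj (c j $ a) * F (z j) $ a $ e) = 0"
          "(\<Sum>a\<in>UNIV. \<Sum>e\<in>UNIV. cnj (c j $ a) * G j $ a $ e * b j $ e) = 0" for a e
          unfolding P_def by blast+
        have "entry_pairing (R j) (F (z j)) = 0" "entry_pairing (S j) (G j) = 0"
          using entry_pairing_tangent_0[OF _ _ bspec[OF cond j] p] cb[OF j] by blast+
        then show "entry_pairing (R j) (F (- cnj (lam j))) - entry_pairing (S j) (matrix_deriv F (- cnj (lam j))) = 0"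
          by (simp add: G_def z_def)
      qed
      finally show "h2_inner F V = 0" .
    qed
  next
    assume orth: "h2_orthogonal F (tangent_space r Hhat)"
    show "\<forall>i\<in>?I. P i"
    proof
      fix i assume i: "i \<in> ?I"
      note li = lamj[OF i]
      have ph: "pole_matrix K (lam i) 1 \<in> hardy2" for K :: "complex^'m^'p"
        using pole_matrix_hardy2(1)[OF li, of K 0] by simp
      have split: "pole_residue r c' b' lam' s = (\<chi> a e. c' i $ a * cnj (b' i $ e) / (s - lam' i) + (\<Sum>j\<in>?I - {i}. c' j $ a * cnj (b' j $ e) / (s - lam' j)))" for c' b' lam' s
        unfolding pole_residue_def Finite_Cartesian_Product.vec_eq_iff vec_lambda_beta
        by (intro allI sum.remove[OF finite_atLeastAtMost i])
      \<comment> \<open>Moving \<open>c i\<close> along \<open>x\<close> changes \<open>Hhat\<close>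
        by a simple pole at \<open>lam i\<close>, linearly in \<open>t\<close>. As \<open>x\<close>
        is any complex vector, orthogonality gives the full right condition.\<close>
      have orth_c: "entry_pairing (\<chi> a e. x $ a * cnj (b i $ e)) (F (z i)) = 0" for x
      proof -
        define K :: "complex^'m^'p" where "K = (\<chi> a e. x $ a * cnj (b i $ e))"
        obtain \<epsilon> where eps: "\<epsilon> > 0" "\<And>t. \<bar>t\<bar> < \<epsilon> \<Longrightarrow> c i + t *\<^sub>R x \<noteq> 0"
          by (rule perturbed_vector_nonzero[of "c i" x]) (use cb[OF i] in auto)
        have "pole_matrix K (lam i) 1 \<in> tangent_space r Hhat"
        proof (rule tangent_line[OF Hhh ph eps(1)])
          fix t :: real assume t: "\<bar>t\<bar> < \<epsilon>"
          show "(\<lambda>s. Hhat s + t *\<^sub>R pole_matrix K (lam i) 1 s) \<in> stable_systems r"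
          proof (rule pole_residue_stable[OF inj lamj, of "c(i := c i + t *\<^sub>R x)" b])
            show "(c(i := c i + t *\<^sub>R x)) j \<noteq> 0 \<and> b j \<noteq> 0" if "j \<in> ?I" for j
              using cb[OF that] eps(2)[OF t] by auto
            fix s assume "s \<in> right_half_plane"
            then show "Hhat s + t *\<^sub>R pole_matrix K (lam i) 1 s = pole_residue r (c(i := c i + t *\<^sub>R x)) b lam s"
              by (simp add: Hh split pole_matrix_def K_def Finite_Cartesian_Product.vec_eq_iff scaleR_conv_of_real[where 'a = complex] algebra_simps add_divide_distrib)
          qed
        qed
        then have "h2_inner F (pole_matrix K (lam i) 1) = 0" using orth by (simp add: h2_orthogonal_def)
        then show ?thesis using h2_inner_pole_matrix(1)[OF Fh li, of K] by (simp add: z_def K_def)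
      qed
      have 1: "(\<Sum>e\<in>UNIV. F (z i) $ a $ e * b i $ e) = 0" for a by (rule entry_pairing_outer_right[where A = "F (z i)" and b = "b i"], rule orth_c)
      have orth_b: "entry_pairing (\<chi> a e. c i $ a * cnj (y $ e)) (F (z i)) = 0" for y
      proof -
        define K :: "complex^'m^'p" where "K = (\<chi> a e. c i $ a * cnj (y $ e))"
        obtain \<epsilon> where eps: "\<epsilon> > 0" "\<And>t. \<bar>t\<bar> < \<epsilon> \<Longrightarrow> b i + t *\<^sub>R y \<noteq> 0"
          by (rule perturbed_vector_nonzero[of "b i" y]) (use cb[OF i] in auto)
        have "pole_matrix K (lam i) 1 \<in> tangent_space r Hhat"
        proof (rule tangent_line[OF Hhh ph eps(1)])
          fix t :: real assume t: "\<bar>t\<bar> < \<epsilon>"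
          show "(\<lambda>s. Hhat s + t *\<^sub>R pole_matrix K (lam i) 1 s) \<in> stable_systems r"
          proof (rule pole_residue_stable[OF inj lamj, of c "b(i := b i + t *\<^sub>R y)"])
            show "c j \<noteq> 0 \<and> (b(i := b i + t *\<^sub>R y)) j \<noteq> 0" if "j \<in> ?I" for j
              using cb[OF that] eps(2)[OF t] by auto
            fix s assume "s \<in> right_half_plane"
            then show "Hhat s + t *\<^sub>R pole_matrix K (lam i) 1 s = pole_residue r c (b(i := b i + t *\<^sub>R y)) lam s"
              by (simp add: Hh split pole_matrix_def K_def Finite_Cartesian_Product.vec_eq_iff scaleR_conv_of_real[where 'a = complex] algebra_simps add_divide_distrib)
          qed
        qed
        then have "h2_inner F (pole_matrix K (lam i) 1) = 0" using orth by (simp add: h2_orthogonal_def)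
        then show ?thesis using h2_inner_pole_matrix(1)[OF Fh li, of K] by (simp add: z_def K_def)
      qed
      have 2: "(\<Sum>a\<in>UNIV. cnj (c i $ a) * F (z i) $ a $ e) = 0" for e by (rule entry_pairing_outer_left[where A = "F (z i)" and c = "c i"], rule orth_b)
      have 3: "(\<Sum>a\<in>UNIV. \<Sum>e\<in>UNIV. cnj (c i $ a) * G i $ a $ e * b i $ e) = 0"
      proof -
        obtain d where d: "d > 0" "\<forall>x\<in>lam ` ?I. x \<noteq> lam i \<longrightarrow> d \<le> dist (lam i) x"
          using finite_set_avoid[of "lam ` ?I" "lam i"] by auto
        \<comment> \<open>Within this radius the moved pole meets no other pole and does not reach
          the imaginary axis, so the poles remain distinct and stable.\<close>
        define \<epsilon> where "\<epsilon> = min d (- Re (lam i))"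
        have eps: "\<epsilon> > 0" using d li by (simp add: \<epsilon>_def)
        have "pole_matrix (R0 i) (lam i) 2 \<in> tangent_space r Hhat"
        proof (rule tangent_moving_pole[OF Hhh li eps])
          fix t :: real assume t: "\<bar>t\<bar> < \<epsilon>"
          define lam' where "lam' = lam(i := lam i + of_real t)"
          have ret: "Re (lam i) + t < 0" using t abs_ge_self[of t] by (simp add: \<epsilon>_def)
          have sep: "lam j \<noteq> lam i + of_real t" if "j \<in> ?I" "j \<noteq> i" for j
          proof
            assume eq: "lam j = lam i + of_real t"
            have "lam j \<noteq> lam i" using inj_onD[OF inj, of j i] that i by auto
            then have "d \<le> dist (lam i) (lam j)" using d(2) that by blast
            also have "\<dots> = \<bar>t\<bar>" unfolding eq by (simp add: dist_norm)
            finally show False using t by (simp add: \<epsilon>_def)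
          qed
          have inj': "inj_on lam' ?I"
          proof (rule inj_onI)
            fix j k assume jk: "j \<in> ?I" "k \<in> ?I" "lam' j = lam' k"
            show "j = k"
            proof (cases "j = i \<or> k = i")
              case True
              then show ?thesis
              proof
                assume "j = i"
                then show ?thesis using jk sep[of k] by (cases "k = i") (simp_all add: lam'_def)
              next
                assume "k = i"
                then show ?thesis using jk sep[of j] by (cases "j = i") (simp_all add: lam'_def)
              qed
            next
              case False
              then show ?thesis using jk inj_onD[OF inj, of j k] by (simp add: lam'_def)
            qed
          qed
          have "(\<lambda>s. Hhat s + (pole_matrix (R0 i) (lam i + of_real t) 1 s - pole_matrix (R0 i) (lam i) 1 s)) \<in> stable_systems r"
          proof (rule pole_residue_stable[OF inj', where b = b and c = c])
            show "Re (lam' j) < 0" if "j \<in> ?I" for j using lamj[OF that] ret by (simp add: lam'_def)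
            show "c j \<noteq> 0 \<and> b j \<noteq> 0" if "j \<in> ?I" for j by (rule cb[OF that])
            fix s assume "s \<in> right_half_plane"
            then show "Hhat s + (pole_matrix (R0 i) (lam i + of_real t) 1 s - pole_matrix (R0 i) (lam i) 1 s) = pole_residue r c b lam' s"
              by (simp add: Hh split pole_matrix_def R0_def lam'_def Finite_Cartesian_Product.vec_eq_iff)
          qed
          then show "Re (lam i) + t < 0 \<and> (\<lambda>s. Hhat s + (pole_matrix (R0 i) (lam i + of_real t) 1 s - pole_matrix (R0 i) (lam i) 1 s)) \<in> stable_systems r"
            using ret by blast
        qed
        then have "h2_inner F (pole_matrix (R0 i) (lam i) 2) = 0" using orth by (simp add: h2_orthogonal_def)
        then have "entry_pairing (R0 i) (G i) = 0" using h2_inner_pole_matrix(2)[OF Fh li, of "R0 i"] by (simp add: z_def G_def)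
        moreover have "entry_pairing (R0 i) (G i) = cnj (\<Sum>a\<in>UNIV. \<Sum>e\<in>UNIV. cnj (c i $ a) * G i $ a $ e * b i $ e)"
          unfolding entry_pairing_def cnj_sum by (intro sum.cong refl) (simp add: R0_def mult_ac)
        ultimately show ?thesis by (simp del: cnj_sum)
      qed
      show "P i" unfolding P_def by (intro conjI allI 1 2 3)
    qed
  qed
  have Feq: "(\<lambda>s. H s - Hhat s) = F" unfolding F_def ..
  show ?thesis
    unfolding Feq main
  proof (rule ball_cong[OF refl])
    fix i assume "i \<in> ?I"
    then show "P i \<longleftrightarrow> H (- cnj (lam i)) *v b i = Hhat (- cnj (lam i)) *v b i \<and>
       cnj_vec (c i) v* H (- cnj (lam i)) = cnj_vec (c i) v* Hhat (- cnj (lam i)) \<and>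
       cinner_vec (c i) (matrix_deriv H (- cnj (lam i)) *v b i) =
         cinner_vec (c i) (matrix_deriv Hhat (- cnj (lam i)) *v b i)"
      by (rule P)
  qed
qed

end
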